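(* All of the following identities hold. Level 2: (La2-1) $\displaystyle \Pi_q^4=6\sum_{n\geq 1}\frac{q^{4n-2}}{(1-q^{2n-1})^4}+\sum_{n\geq 1}\frac{q^{2n-1}}{(1-q^{2n-1})^2}=\sum_{n\geq 1}\frac{n^3q^n}{1-q^{2n}}$. Level 4: (La4-1) $\displaystyle \sum_{n\geq 1}\frac{q^n}{(1-q^n)^2}-2\sum_{n\geq 1}\frac{q^{2n}}{(1-q^{2n})^2}=\frac{1}{24}\left(\frac{\Pi_q^4}{\Pi_{q^2}^2}-1 \right)+\frac{2}{3}\Pi_{q^2}^2$; (La4-2) $\displaystyle \sum_{n\geq 1} \frac{q^n}{(1-q^n)^2}-4\sum_{n\geq 1}\frac{q^{4n}}{(1-q^{4n})^2}=\frac{1}{8}\left(\frac{\Pi_q^4}{\Pi_{q^2}^2}-1 \right)$; (La4-3) $\displaystyle \sum_{n\geq 1} \frac{q^{2n-1}}{(1-q^{2n-1})^2}-2\sum_{n\geq 1}\frac{q^{4n-2}}{(1-q^{4n-2})^2}=\Pi_{q^2}^2=\sum_{n\geq 1}\frac{(2n-1)q^{2n-1}}{1-q^{4n-2}}$. Level 6: (La6-1) $\displaystyle \sum_{n\geq 1}\frac{q^n}{(1-q^n)^2}-3\sum_{n\geq 1}\frac{q^{3n}}{(1-q^{3n})^2}=\frac{(\Pi_q^2+3\Pi_{q^3}^2)^2}{12\Pi_q\Pi_{q^3}}-\frac{1}{12}$; (La6-2) $\displaystyle \sum_{n\geq 1}\frac{q^{2n-1}}{(1-q^{2n-1})^2}-3\sum_{n\geq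 1}\frac{q^{6n-3}}{(1-q^{6n-3})^2}=\Pi_q\Pi_{q^3}$. Level 8: (La8-1) $\displaystyle \sum_{n\geq 1}\frac{q^{2n-1}}{(1-q^{2n-1})^2}-4\sum_{n\geq 1}\frac{q^{8n-4}}{(1-q^{8n-4})^2}=\frac{1}{8}\left(\frac{\Pi_q^4}{\Pi_{q^2}^2}-\frac{\Pi_{q^2}^4}{\Pi_{q^4}^2} \right)=\Pi_{q^2}^2+2\Pi_{q^4}^2$. Level 10: (La10-1) $\displaystyle 6\Big(\sum_{n\geq 1}\frac{q^n}{(1-q^n)^2}-5\sum_{n\geq 1}\frac{q^{5n}}{(1-q^{5n})^2} \Big)+1=\left(\frac{\Pi_q}{\Pi_{q^5}}+2+5\frac{\Pi_{q^5}}{\Pi_q} \right)\Big(\sum_{n\geq 1}\frac{q^{2n-1}}{(1-q^{2n-1})^2}-5\sum_{n\geq 1}\frac{q^{10n-5}}{(1-q^{10n-5})^2} \Big)$; (La10-2) $\displaystyle \frac{1}{\Pi_{q^5}^2}\Big(\sum_{n\geq 1}\frac{q^{2n-1}}{(1-q^{2n-1})^2}-5\sum_{n\geq 1}\frac{q^{10n-5}}{(1-q^{10n-5})^2}\Big)=\sqrt{\frac{\Pi_q^3}{\Pi_{q^5}^3}-2\frac{\Pi_q^2}{\Pi_{q^5}^2}+5\frac{\Pi_q}{\Pi_{q^5}}}$. Level 12: (La12-1) $\displaystyle \sum_{n\geq 1}\frac{q^{2n-1}}{(1-q^{2n-1})^2}-6\sum_{n\geq 1}\frac{q^{12n-6}}{(1-q^{12n-6})^2}=\Pi_{q^2}^2+2\Pi_{q^2}\Pi_{q^6}=\Pi_q\Pi_{q^3}+3\Pi_{q^6}^2$.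 Level 18: (La18-1) $\displaystyle \sum_{n\geq 1}\frac{q^{2n}}{(1-q^{2n})^2}-9\sum_{n\geq 1}\frac{q^{18n}}{(1-q^{18n})^2}=\frac{\Pi_{q^3}^3}{\Pi_q}+\frac{1}{3}\Big(\frac{\Pi_{q^3}^3}{\Pi_{q^9}}-1 \Big)$; (La18-2) $\displaystyle \sum_{n\geq 1}\frac{q^{2n-1}}{(1-q^{2n-1})^2}-9\sum_{n\geq 1}\frac{q^{18n-9}}{(1-q^{18n-9})^2}=\left(\Pi_q\Pi_{q^9}+3\Pi_{q^9}^2 \right)\sqrt{\left(\frac{\Pi_q}{\Pi_{q^9}} \right)^{3/2}-3\frac{\Pi_q}{\Pi_{q^9}}+3\left(\frac{\Pi_q}{\Pi_{q^9}} \right)^{1/2}}$; (La18-3) $\displaystyle 3\Big(\sum_{n\geq 1}\frac{q^n}{(1-q^n)^2}-9\sum_{n\geq 1}\frac{q^{9n}}{(1-q^{9n})^2} \Big)+1=\Big(\sqrt{\frac{\Pi_q}{\Pi_{q^9}}}+3\sqrt{\frac{\Pi_{q^9}}{\Pi_q}} \Big)\Big(\sum_{n\geq 1}\frac{q^{2n-1}}{(1-q^{2n-1})^2}-9\sum_{n\geq 1}\frac{q^{18n-9}}{(1-q^{18n-9})^2} \Big)$; (La18-4) $\displaystyle 3\Big(\sum_{n\geq 1}\frac{q^n}{(1-q^n)^2}-9\sum_{n\geq 1}\frac{q^{9n}}{(1-q^{9n})^2} \Big)+1=3\Pi_q\Pi_{q^3}+9\Pi_{q^3}\Pi_{q^9}+3\frac{\Pi_{q^3}^3}{\Pi_{q}}+\frac{\Pi_{q^3}^3}{\Pi_{q^9}}$.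 Level 20: (La20-1) $\displaystyle \frac{1}{\Pi_{q^5}^2}\Big(\sum_{n\geq 1}\frac{q^{2n-1}}{(1-q^{2n-1})^2}-5\sum_{n\geq 1}\frac{q^{10n-5}}{(1-q^{10n-5})^2}\Big)=\frac{\dfrac{\Pi_{q^5}^2}{\Pi_{q^{10}}^2}+16\dfrac{\Pi_{q^{10}}^2}{\Pi_{q^5}^2} }{\dfrac{\Pi_q}{\Pi_{q^5}}-4-\dfrac{\Pi_{q^5}}{\Pi_q}}$.
   Context: Let $q=e^{2\pi i z}$ with $\mathrm{Im}\, z>0$, and for rational $r$ put $q^{r}:=e^{2\pi i r z}$. Write $(a;q)_\infty=\prod_{n=0}^\infty(1-aq^n)$. Define $$\Pi_q:=q^{1/4}\frac{(q^2;q^2)_\infty^2}{(q;q^2)_\infty^2}=q^{1/4}\psi(q)^2,\qquad \psi(q)=\sum_{n=0}^\infty q^{n(n+1)/2},$$ and for a positive integer $n$ let $\Pi_{q^n}$ denote the function obtained by replacing $q$ by $q^n$ (equivalently $z$ by $nz$), i.e. $\Pi_{q^n}=q^{n/4}\psi(q^n)^2$. Half-integral powers of $\Pi_{q^n}$ are interpreted via $\sqrt{\Pi_{q^n}}=q^{n/8}\psi(q^n)$, so that $(\Pi_q/\Pi_{q^9})^{1/2}=q^{-1}\psi(q)/\psi(q^9)$. The outer square roots in (La10-2) and (La18-2) denote the holomorphic branch on the upper half plane whose expansion in (fractional) powers of $q$ has positive leading coefficient (as $\mathrm{Im}\,z\to\infty$ the two branches behave like $q^{-3/2}$ in both cases).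 The identities are identities of meromorphic functions of $z$ on the upper half plane. The labels (La$N$-$n$) are only names for the identities. *)

theory Defs
  imports "HOL-Complex_Analysis.Complex_Analysis"
begin

definition upper_half :: "complex set" where
  "upper_half = {z. Im z > 0}"

text \<open>
  The power \<open>q\<^sup>r\<close> of the nome, where \<open>q = exp (2 \<pi> i z)\<close>. It depends on \<open>z\<close>, not only on the
  value of \<open>q\<close>, so that fractional powers involve no choice of a branch.
\<close>
definition qpow :: "rat \<Rightarrow> complex \<Rightarrow> complex" where
  "qpow r z = exp (2 * of_real pi * \<i> * of_rat r * z)"

abbreviation nome :: "complex \<Rightarrow> complex" where
  "nome z \<equiv> qpow 1 z"

definition qpochhammer_inf :: "complex \<Rightarrow> complex \<Rightarrow> complex" where
  "qpochhammer_inf a q = (\<Prod>n. 1 - a * q ^ n)"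

definition ramanujan_psi :: "complex \<Rightarrow> complex" where
  "ramanujan_psi q = (\<Sum>n. q ^ (n * (n + 1) div 2))"

definition Pi_fun :: "complex \<Rightarrow> complex" where
  "Pi_fun z = qpow (1/4) z * (qpochhammer_inf (nome z ^ 2) (nome z ^ 2)) ^ 2
                           / (qpochhammer_inf (nome z) (nome z ^ 2)) ^ 2"

text \<open>\<open>Pi_q n\<close> is \<open>\<Pi>\<close> with \<open>q\<close> replaced by \<open>q\<^sup>n\<close>, that is, with \<open>z\<close> replaced by \<open>n z\<close>.\<close>
definition Pi_q :: "nat \<Rightarrow> complex \<Rightarrow> complex" where
  "Pi_q n z = Pi_fun (of_nat n * z)"

text \<open>
  The square root of \<open>Pi_q n\<close> that defines all half-integral powers of it; by Gauss's product
  formula for \<open>\<psi>\<close> its square is \<open>Pi_q n\<close>.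
\<close>
definition sqrt_Pi_q :: "nat \<Rightarrow> complex \<Rightarrow> complex" where
  "sqrt_Pi_q n z = qpow (of_nat n / 8) z * ramanujan_psi (nome z ^ n)"

text \<open>
  The sums of \<open>x / (1 - x)\<^sup>2\<close> over \<open>x = q\<^bsup>d n\<^esup>\<close> and over \<open>x = q\<^bsup>d (2 n - 1)\<^esup>\<close> with \<open>n \<ge> 1\<close>.
\<close>
definition lambert_all :: "nat \<Rightarrow> complex \<Rightarrow> complex" where
  "lambert_all d z =
     (\<Sum>\<^sub>\<infinity>n\<in>{1..}. nome z ^ (d * n) / (1 - nome z ^ (d * n)) ^ 2)"

definition lambert_odd :: "nat \<Rightarrow> complex \<Rightarrow> complex" where
  "lambert_odd d z =
     (\<Sum>\<^sub>\<infinity>n\<in>{1..}. nome z ^ (d * (2 * n - 1)) / (1 - nome z ^ (d * (2 * n - 1))) ^ 2)"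

text \<open>
  \<open>s\<close> is the holomorphic branch of the square root of \<open>F\<close> on the upper half plane whose expansion
  \<open>\<Sum>n. a n q\<^bsup>r + n/N\<^esup>\<close> in fractional powers of \<open>q\<close> has a positive leading coefficient \<open>a 0\<close>.
  For \<open>F\<close> that does not vanish identically, at most one function on the upper half plane has
  this property.
\<close>
definition is_sqrt_branch :: "(complex \<Rightarrow> complex) \<Rightarrow> (complex \<Rightarrow> complex) \<Rightarrow> bool" where
  "is_sqrt_branch F s \<longleftrightarrow>
     s holomorphic_on upper_half \<and>
     (\<forall>z\<in>upper_half. s z ^ 2 = F z) \<and>
     (\<exists>(N::nat) (r::rat) (a :: nat \<Rightarrow> complex).
        N > 0 \<and> a 0 \<in> \<real> \<and> Re (a 0) > 0 \<and>
        (\<forall>z\<in>upper_half. (\<lambda>n. a n * qpow (r + of_nat n / of_nat N) z) sums s z))"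

text \<open>
  \<open>G\<close> equals \<open>c \<sqrt>F\<close> with this branch of the root. The branch is required to exist; it is
  unique as a function on the upper half plane, so the universal quantifier only serves to name it.
\<close>
definition equals_times_sqrt ::
  "(complex \<Rightarrow> complex) \<Rightarrow> (complex \<Rightarrow> complex) \<Rightarrow> (complex \<Rightarrow> complex) \<Rightarrow> bool" where
  "equals_times_sqrt G c F \<longleftrightarrow>
     (\<exists>s. is_sqrt_branch F s) \<and>
     (\<forall>s. is_sqrt_branch F s \<longrightarrow> (\<forall>z\<in>upper_half. G z = c z * s z))"

end

theory Submission
  imports Defs
begin

text \<open>All Lambert sums are values of \<open>p(x) = \<Sum> x Q\<^sup>n / (1 - x Q\<^sup>n)\<^sup>2\<close>, summed over all integers
  \<open>n\<close>, at torsion points of the multiplicative group modulo \<open>Q\<^sup>\<int>\<close>. By Liouville's theorem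
  \<open>p(x) - p(y) = x (Q;Q)\<^sup>4 \<theta>(x y) \<theta>(y / x) / (\<theta>(x) \<theta>(y))\<^sup>2\<close> with \<open>\<theta>(x) = (x;Q) (Q/x;Q)\<close>, so every
  difference of two values is a product, and the trivial linear and Pluecker relations among such
  differences become the algebraic relations between \<open>\<psi>(q)\<close>, \<open>\<psi>(q\<^sup>2)\<close>, \<open>\<psi>(q\<^sup>3)\<close>, and so on. In the
  identities of level 10 and 20 this determines the squares of both sides, and the signs are read off
  at \<open>q = 0\<close>. Level 18 follows from level 6 and the 3-dissection of \<open>\<psi>\<close>, which comes from the Jacobi
  triple product. The sum of cubes at level 2 is the second-order limit of the formula for
  \<open>p(x) - p(y)\<close> at a half period.\<close>

text \<open>The theta values at torsion points are products over residue classes of exponents. For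
  the nomes q^2, q^3 and q^6 each such value is a quotient of Euler products, and the relations can
  be solved directly. For q^5 and q^10 the classes come in conjugate pairs, and only the product
  over a pair is evaluated as such a quotient; the single values are of Rogers-Ramanujan type. A
  Lambert combination of level 10 is a sum s + t of two differences of p, for which s t and s - t
  are known, so it is reached only through (s + t)^2 = (s - t)^2 + 4 s t. This is why signs have to
  be fixed, and why the relevant expressions are written so that they stay holomorphic at q = 0. The
  triple product has a similar gap: Liouville's theorem gives proportionality in y but says nothing
  about the constant as a function of Q. That constant is found from its behaviour under Q -> Q^4
  together with the limit Q -> 0.\<close>

lemma holomorphic_on_locally:
  assumes "\<And>z. z \<in> A \<Longrightarrow> \<exists>r>0. f holomorphic_on ball z r"
  shows "f holomorphic_on A"
proof -
  have "f analytic_on A"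
    using assms by (auto simp: analytic_on_def)
  thus ?thesis
    by (rule analytic_imp_holomorphic)
qed

text \<open>The majorant may fail on a finite set \<open>F\<close> because the geometric bounds used
  later start only at some |n| >= N depending on the disc. On the exceptional terms compactness
  supplies the bound \<open>C\<close>, and the Weierstrass test is applied to the patched majorant
  \<open>M'\<close>.\<close>

lemma holomorphic_on_infsum:
  fixes u :: "'a \<Rightarrow> complex \<Rightarrow> complex"
  assumes A: "open A" and u: "\<And>n. n \<in> S \<Longrightarrow> u n holomorphic_on A"
    and M: "\<And>z. z \<in> A \<Longrightarrow> \<exists>r>0. \<exists>M F. M summable_on S \<and> finite F \<and>
              (\<forall>n\<in>S - F. \<forall>x\<in>cball z r. norm (u n x) \<le> M n)"
  shows "(\<lambda>x. \<Sum>\<^sub>\<infinity>n\<in>S. u n x) holomorphic_on A"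
proof (rule holomorphic_on_locally)
  fix z assume z: "z \<in> A"
  obtain r1 where r1: "r1 > 0" "cball z r1 \<subseteq> A"
    using A z open_contains_cball by blast
  obtain r2 M F where r2: "r2 > 0" "M summable_on S" "finite F"
    "\<And>n x. n \<in> S - F \<Longrightarrow> x \<in> cball z r2 \<Longrightarrow> norm (u n x) \<le> M n"
    using M[OF z] by blast
  define r where "r = min r1 r2"
  have r: "r > 0" "cball z r \<subseteq> A" "cball z r \<subseteq> cball z r2"
    using r1 r2 unfolding r_def by auto
  have cont: "continuous_on (cball z r) (u n)" if "n \<in> S" for n
    using u[OF that] r(2) holomorphic_on_imp_continuous_on holomorphic_on_subset by blast
  have "\<exists>C. \<forall>x\<in>cball z r. norm (u n x) \<le> C" if "n \<in> S" for n
    using compact_imp_bounded[OF compact_continuous_image[OF cont[OF that] compact_cball]]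
    by (auto simp: bounded_iff)
  then obtain C where C: "\<And>n x. n \<in> S \<Longrightarrow> x \<in> cball z r \<Longrightarrow> norm (u n x) \<le> C n"
    by metis
  define M' where "M' n = (if n \<in> F then C n else M n)" for n
  have "M summable_on (S - F)"
    using r2(2) by (rule summable_on_subset) auto
  hence "M' summable_on (S - F)"
    by (rule summable_on_cong[THEN iffD1, rotated]) (auto simp: M'_def)
  moreover have "M' summable_on (S \<inter> F)"
    using r2(3) by auto
  ultimately have "M' summable_on ((S - F) \<union> (S \<inter> F))"
    by (rule summable_on_union)
  also have "(S - F) \<union> (S \<inter> F) = S"
    by blast
  finally have M': "M' summable_on S" .
  have le: "norm (u n x) \<le> M' n" if "n \<in> S" "x \<in> cball z r" for n x
    using that C r2(4) r(3) by (auto simp: M'_def)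
  have lim: "uniform_limit (cball z r) (\<lambda>X x. \<Sum>n\<in>X. u n x) (\<lambda>x. \<Sum>\<^sub>\<infinity>n\<in>S. u n x)
          (finite_subsets_at_top S)"
    by (rule Weierstrass_m_test_general[OF le M'])
  have ev: "eventually (\<lambda>X. continuous_on (cball z r) (\<lambda>x. \<Sum>n\<in>X. u n x) \<and>
               (\<lambda>x. \<Sum>n\<in>X. u n x) holomorphic_on ball z r) (finite_subsets_at_top S)"
  proof (rule eventually_finite_subsets_at_top_weakI)
    fix X assume X: "finite X" "X \<subseteq> S"
    have "(\<lambda>x. \<Sum>n\<in>X. u n x) holomorphic_on A"
      using X u by (intro holomorphic_intros) auto
    thus "continuous_on (cball z r) (\<lambda>x. \<Sum>n\<in>X. u n x) \<and>
               (\<lambda>x. \<Sum>n\<in>X. u n x) holomorphic_on ball z r"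
      by (meson r(2) ball_subset_cball holomorphic_on_imp_continuous_on holomorphic_on_subset)
  qed
  show "\<exists>r>0. (\<lambda>x. \<Sum>\<^sub>\<infinity>n\<in>S. u n x) holomorphic_on ball z r"
    by (rule holomorphic_uniform_limit[OF ev lim]) (use r(1) in auto)
qed

section \<open>The infinite product (a;q) as a function of both arguments\<close>

lemma qpochhammer_convergent:
  fixes a q :: complex
  assumes "norm q < 1"
  shows "convergent_prod (\<lambda>n. 1 - a * q ^ n)"
proof -
  have "summable (\<lambda>n. norm (1 - a * q ^ n - 1))"
    using assms by (auto simp: norm_mult norm_power intro!: summable_mult summable_geometric)
  thus ?thesis
    using abs_convergent_prod_imp_convergent_prod abs_convergent_prod_conv_summable by blast
qed

lemma qpochhammer_LIMSEQ:
  fixes a q :: complex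
  assumes "norm q < 1"
  shows "(\<lambda>N. \<Prod>n<N. 1 - a * q ^ n) \<longlonglongrightarrow> qpochhammer_inf a q"
  unfolding qpochhammer_inf_def
  by (rule LIMSEQ_lessThan_iff_atMost[THEN iffD2])
     (rule convergent_prod_LIMSEQ[OF qpochhammer_convergent[OF assms]])

lemma qpochhammer_nonzero:
  assumes "norm q < 1" "\<And>n. a * q ^ n \<noteq> 1"
  shows "qpochhammer_inf a q \<noteq> 0"
  unfolding qpochhammer_inf_def
  by (rule prodinf_nonzero[OF qpochhammer_convergent[OF assms(1)]]) (use assms(2) in \<open>metis right_minus_eq\<close>)

lemma qpochhammer_0_left [simp]: "qpochhammer_inf 0 q = 1"
  by (simp add: qpochhammer_inf_def)

lemma qpochhammer_rec:
  assumes "norm q < 1"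
  shows "qpochhammer_inf a q = (1 - a) * qpochhammer_inf (a * q) q"
proof -
  have "(\<lambda>N. \<Prod>n<Suc N. 1 - a * q ^ n) \<longlonglongrightarrow> qpochhammer_inf a q"
    using qpochhammer_LIMSEQ[OF assms, of a] by (rule LIMSEQ_Suc)
  moreover have "(\<lambda>N. \<Prod>n<Suc N. 1 - a * q ^ n) = (\<lambda>N. (1 - a) * (\<Prod>n<N. 1 - a * q * q ^ n))"
    by (subst prod.lessThan_Suc_shift) (simp add: mult.assoc)
  moreover have "(\<lambda>N. (1 - a) * (\<Prod>n<N. 1 - a * q * q ^ n)) \<longlonglongrightarrow>
                   (1 - a) * qpochhammer_inf (a * q) q"
    by (intro tendsto_intros qpochhammer_LIMSEQ assms)
  ultimately show ?thesis
    using LIMSEQ_unique by metis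
qed

lemma qpochhammer_1_left:
  assumes "norm q < 1"
  shows "qpochhammer_inf 1 q = 0"
  using qpochhammer_rec[OF assms, of 1] by simp

lemma qpochhammer_split:
  assumes "norm q < 1" "m > 0"
  shows "qpochhammer_inf a q = (\<Prod>k<m. qpochhammer_inf (a * q ^ k) (q ^ m))"
proof -
  have qm: "norm (q ^ m) < 1"
    using assms by (simp add: norm_power power_less_one_iff)
  have lim1: "(\<lambda>N. \<Prod>n<N * m. 1 - a * q ^ n) \<longlonglongrightarrow> qpochhammer_inf a q"
    using LIMSEQ_subseq_LIMSEQ[OF qpochhammer_LIMSEQ[OF assms(1)], of "\<lambda>N. N * m" a] assms(2)
    by (auto simp: strict_mono_def o_def)
  have eq: "\<And>N. (\<Prod>n<N * m. 1 - a * q ^ n) = (\<Prod>k<m. \<Prod>n<N. 1 - a * q ^ k * (q ^ m) ^ n)"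
  proof -
    fix N
    have "(\<Prod>n<N * m. 1 - a * q ^ n) = (\<Prod>n<N. prod (\<lambda>n. 1 - a * q ^ n) {n * m..<n * m + m})"
      by (rule prod.nat_group[symmetric])
    also have "\<dots> = (\<Prod>n<N. \<Prod>k<m. 1 - a * q ^ k * (q ^ m) ^ n)"
    proof (rule prod.cong[OF refl])
      fix n
      have "prod (\<lambda>n. 1 - a * q ^ n) {n * m..<n * m + m} = (\<Prod>k<m. 1 - a * q ^ (k + n * m))"
        using prod.shift_bounds_nat_ivl[of "\<lambda>n. 1 - a * q ^ n" 0 "n * m" m]
        by (simp add: lessThan_atLeast0 add.commute)
      thus "prod (\<lambda>n. 1 - a * q ^ n) {n * m..<n * m + m} = (\<Prod>k<m. 1 - a * q ^ k * (q ^ m) ^ n)"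
        by (simp add: power_add mult.assoc power_mult[symmetric] mult.commute[of n])
    qed
    also have "\<dots> = (\<Prod>k<m. \<Prod>n<N. 1 - a * q ^ k * (q ^ m) ^ n)"
      by (rule prod.swap)
    finally show "(\<Prod>n<N * m. 1 - a * q ^ n) = (\<Prod>k<m. \<Prod>n<N. 1 - a * q ^ k * (q ^ m) ^ n)" .
  qed
  have lim2: "(\<lambda>N. \<Prod>k<m. \<Prod>n<N. 1 - a * q ^ k * (q ^ m) ^ n) \<longlonglongrightarrow>
          (\<Prod>k<m. qpochhammer_inf (a * q ^ k) (q ^ m))"
    by (intro tendsto_intros qpochhammer_LIMSEQ qm)
  show ?thesis
    by (rule LIMSEQ_unique[OF lim1[unfolded eq] lim2])
qed

lemma qpochhammer_mult_uminus:
  assumes "norm q < 1"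
  shows "qpochhammer_inf a q * qpochhammer_inf (-a) q = qpochhammer_inf (a\<^sup>2) (q\<^sup>2)"
proof -
  have "(1 - a * q ^ n) * (1 - (-a) * q ^ n) = 1 - a\<^sup>2 * (q\<^sup>2) ^ n" for n
    by (simp add: algebra_simps power2_eq_square power_mult_distrib)
  thus ?thesis
    unfolding qpochhammer_inf_def
    by (subst prodinf_mult) (simp_all only: qpochhammer_convergent assms)
qed

text \<open>Both arguments vary at once: constant \<open>h\<close> gives holomorphy of the theta
  function for a fixed nome, and powers of q in both places give holomorphy of eta products on the
  disc, including q = 0.\<close>

lemma qpochhammer_holomorphic [holomorphic_intros]:
  assumes g: "g holomorphic_on A" and h: "h holomorphic_on A" and A: "open A"
    and h1: "\<And>z. z \<in> A \<Longrightarrow> norm (h z) < 1"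
  shows "(\<lambda>z. qpochhammer_inf (g z) (h z)) holomorphic_on A"
proof (rule holomorphic_on_locally)
  fix z assume z: "z \<in> A"
  obtain r where r: "r > 0" "cball z r \<subseteq> A"
    using A z open_contains_cball by blast
  have contg: "continuous_on (cball z r) g" and conth: "continuous_on (cball z r) h"
    using g h r(2) holomorphic_on_imp_continuous_on holomorphic_on_subset by blast+
  have "bounded (g ` cball z r)"
    by (intro compact_imp_bounded compact_continuous_image contg compact_cball)
  then obtain B where "\<forall>y\<in>g ` cball z r. norm y \<le> B"
    unfolding bounded_iff ..
  hence B: "\<And>x. x \<in> cball z r \<Longrightarrow> norm (g x) \<le> B"
    by simp
  have "continuous_on (cball z r) (\<lambda>x. norm (h x))"
    by (intro continuous_intros conth)
  then obtain x0 where x0: "x0 \<in> cball z r" "\<And>x. x \<in> cball z r \<Longrightarrow> norm (h x) \<le> norm (h x0)"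
    using continuous_attains_sup[of "cball z r" "\<lambda>x. norm (h x)"] r(1) by auto
  define \<rho> where "\<rho> = norm (h x0)"
  have \<rho>: "0 \<le> \<rho>" "\<rho> < 1"
    using h1 x0(1) r(2) by (auto simp: \<rho>_def)
  have "uniformly_convergent_on (cball z r) (\<lambda>N x. \<Sum>n<N. norm (- g x * h x ^ n))"
  proof (rule Weierstrass_m_test')
    fix n x assume x: "x \<in> cball z r"
    have "norm (h x) ^ n \<le> \<rho> ^ n"
      using x0(2)[OF x] by (intro power_mono) (auto simp: \<rho>_def)
    moreover have "0 \<le> B"
      using B[OF x] norm_ge_zero order_trans by blast
    ultimately show "norm (norm (- g x * h x ^ n)) \<le> B * \<rho> ^ n"
      using B[OF x] by (auto simp: norm_mult norm_power intro!: mult_mono)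
  qed (use \<rho> in \<open>auto intro!: summable_mult summable_geometric\<close>)
  hence "uniformly_convergent_on (cball z r) (\<lambda>N x. \<Prod>n<N. 1 + - g x * h x ^ n)"
    by (intro uniformly_convergent_on_prod continuous_intros contg conth) auto
  then obtain l where l: "uniform_limit (cball z r) (\<lambda>N x. \<Prod>n<N. 1 - g x * h x ^ n) l sequentially"
    by (auto simp: uniformly_convergent_on_def)
  have "qpochhammer_inf (g x) (h x) = l x" if "x \<in> cball z r" for x
    by (rule LIMSEQ_unique[OF qpochhammer_LIMSEQ tendsto_uniform_limitI[OF l that]])
       (use h1 r(2) that in blast)
  hence l': "uniform_limit (cball z r) (\<lambda>N x. \<Prod>n<N. 1 - g x * h x ^ n)
          (\<lambda>x. qpochhammer_inf (g x) (h x)) sequentially"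
    by (subst uniform_limit_cong'[OF refl]) (use l in auto)
  have ev: "\<forall>\<^sub>F N in sequentially. continuous_on (cball z r) (\<lambda>x. \<Prod>n<N. 1 - g x * h x ^ n) \<and>
          (\<lambda>x. \<Prod>n<N. 1 - g x * h x ^ n) holomorphic_on ball z r"
  proof (intro always_eventually allI conjI)
    fix N
    show "continuous_on (cball z r) (\<lambda>x. \<Prod>n<N. 1 - g x * h x ^ n)"
      by (intro continuous_intros contg conth)
    have "ball z r \<subseteq> A" using r(2) ball_subset_cball by blast
    thus "(\<lambda>x. \<Prod>n<N. 1 - g x * h x ^ n) holomorphic_on ball z r"
      by (intro holomorphic_intros holomorphic_on_subset[OF g] holomorphic_on_subset[OF h])
  qed
  show "\<exists>r>0. (\<lambda>z. qpochhammer_inf (g z) (h z)) holomorphic_on ball z r"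
    by (rule holomorphic_uniform_limit[OF ev l']) (use r(1) in auto)
qed

lemma summable_on_int_geometric:
  fixes \<rho> :: real
  assumes "0 \<le> \<rho>" "\<rho> < 1"
  shows "(\<lambda>n::int. \<rho> ^ nat \<bar>n\<bar>) summable_on S"
proof -
  have *: "(\<lambda>n::nat. \<rho> ^ n) summable_on UNIV"
    using assms by (intro norm_summable_imp_summable_on) (auto simp: norm_power intro!: summable_geometric)
  have "(\<lambda>n::int. \<rho> ^ nat \<bar>n\<bar>) summable_on range int"
    using * by (subst summable_on_reindex) (auto simp: o_def)
  moreover have "(\<lambda>n::int. \<rho> ^ nat \<bar>n\<bar>) summable_on range (\<lambda>n. - int n)"
    using * by (subst summable_on_reindex) (auto simp: o_def inj_on_def)
  ultimately have "(\<lambda>n::int. \<rho> ^ nat \<bar>n\<bar>) summable_on (range int \<union> range (\<lambda>n. - int n))"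
    by (rule summable_on_union)
  also have "range int \<union> range (\<lambda>n. - int n) = (UNIV :: int set)"
  proof -
    have "n \<in> range int \<union> range (\<lambda>n. - int n)" for n :: int
      by (cases "n \<ge> 0") (auto simp: image_iff intro: exI[of _ "nat n"] exI[of _ "nat (-n)"])
    thus ?thesis by blast
  qed
  finally show ?thesis
    by (rule summable_on_subset) auto
qed

section \<open>The Weierstrass function in multiplicative notation\<close>

definition koebe :: "complex \<Rightarrow> complex" where
  "koebe x = x / (1 - x)\<^sup>2"

lemma koebe_0 [simp]: "koebe 0 = 0" and koebe_1 [simp]: "koebe 1 = 0"
  by (simp_all add: koebe_def)

text \<open>This symmetry lets a sum over all integers converge: for large negative n the argument
  \<open>x * Q powi n\<close> is huge, but its inverse is small. It also makes the resulting
  function invariant under inversion.\<close>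

lemma koebe_inverse: "koebe (inverse x) = koebe x"
proof (cases "x = 0 \<or> x = 1")
  case False
  hence [simp]: "x \<noteq> 0" "1 - x \<noteq> 0" "x - 1 \<noteq> 0" by auto
  have "1 - inverse x = (x - 1) / x" by (simp add: field_simps)
  hence "koebe (inverse x) = x / (x - 1)\<^sup>2"
    by (simp add: koebe_def power_divide power2_eq_square field_simps)
  thus ?thesis by (simp add: koebe_def power2_commute)
qed auto

text \<open>The factor 4 is (1 + x)^2 - (1 - x)^2 = 4 x. At x^2 = 1 the formula fails under the
  convention \<open>koebe 1 = 0\<close>, as the left side is then -1/4.\<close>

lemma koebe_add_uminus:
  assumes "x\<^sup>2 \<noteq> 1"
  shows "koebe x + koebe (-x) = 4 * koebe (x\<^sup>2)"
proof -
  define a b where "a = 1 - x" and "b = 1 + x"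
  have eq: "1 - x\<^sup>2 = a * b" "b\<^sup>2 - a\<^sup>2 = 4 * x"
    by (simp_all add: a_def b_def algebra_simps power2_eq_square)
  with assms have [simp]: "a \<noteq> 0" "b \<noteq> 0" by auto
  have "koebe x + koebe (-x) = x / a\<^sup>2 - x / b\<^sup>2"
    by (simp add: koebe_def a_def b_def)
  also have "\<dots> = x * (b\<^sup>2 - a\<^sup>2) / (a * b)\<^sup>2"
    by (simp add: divide_simps power_mult_distrib) (simp add: algebra_simps)
  also have "\<dots> = 4 * koebe (x\<^sup>2)"
    unfolding eq koebe_def by (simp add: power2_eq_square)
  finally show ?thesis .
qed

lemma norm_koebe_le:
  assumes "norm x \<le> 1 / 2"
  shows "norm (koebe x) \<le> 4 * norm x"
proof -
  have "1 / 2 \<le> norm (1 - x)"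
    using norm_triangle_ineq2[of 1 x] assms by simp
  hence "(1 / 2)\<^sup>2 \<le> (norm (1 - x))\<^sup>2"
    by (intro power_mono) auto
  hence *: "1 \<le> 4 * (norm (1 - x))\<^sup>2"
    by (simp add: power2_eq_square)
  hence "norm x * 1 \<le> norm x * (4 * (norm (1 - x))\<^sup>2)"
    by (intro mult_left_mono) auto
  moreover have "(norm (1 - x))\<^sup>2 > 0"
    using * by linarith
  ultimately show ?thesis
    by (simp add: koebe_def norm_divide norm_power divide_le_eq mult_ac)
qed

text \<open>Up to an additive constant, \<open>koebe_sum Q UNIV\<close> is the Weierstrass function of the
  lattice \<open>Q\<^sup>\<int>\<close> in multiplicative notation. Because \<open>koebe 1 = 0\<close>, its value at a lattice point is
  the sum with the polar term left out.\<close>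

definition koebe_sum :: "complex \<Rightarrow> int set \<Rightarrow> complex \<Rightarrow> complex" where
  "koebe_sum Q S x = (\<Sum>\<^sub>\<infinity>n\<in>S. koebe (x * Q powi n))"

text \<open>Beyond N either the argument (n >= 0) or its inverse (n < 0) lies in the disc of radius
  1/2, where \<open>koebe\<close> is bounded linearly; \<open>max b (1 / a)\<close> dominates both
  |x| and 1/|x| on the annulus.\<close>

lemma koebe_sum_bound:
  assumes Q: "Q \<noteq> 0" "norm Q < 1" and ab: "0 < a" "0 < b"
  shows "\<exists>N C. \<forall>x n. a \<le> norm x \<longrightarrow> norm x \<le> b \<longrightarrow> \<bar>n\<bar> \<ge> int N \<longrightarrow>
     norm (koebe (x * Q powi n)) \<le> C * norm Q ^ nat \<bar>n\<bar>"
proof -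
  define C where "C = max b (1 / a)"
  have C: "b \<le> C" "1 / a \<le> C" "C > 0" using ab by (auto simp: C_def)
  have "(\<lambda>n. C * norm Q ^ n) \<longlonglongrightarrow> C * 0"
    using Q by (intro tendsto_intros LIMSEQ_power_zero) auto
  hence "eventually (\<lambda>n. C * norm Q ^ n < 1 / 2) sequentially"
    by (rule order_tendstoD) auto
  then obtain N where N: "\<And>n. n \<ge> N \<Longrightarrow> C * norm Q ^ n < 1 / 2"
    by (auto simp: eventually_at_top_linorder)
  show ?thesis
  proof (rule exI[of _ N], rule exI[of _ "4 * C"], intro allI impI)
    fix x :: complex and n :: int assume x: "a \<le> norm x" "norm x \<le> b" and n: "\<bar>n\<bar> \<ge> int N"
    define k where "k = nat \<bar>n\<bar>"
    have k: "k \<ge> N" using n by (simp add: k_def)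
    have x0: "norm x > 0" using x ab by linarith
    show "norm (koebe (x * Q powi n)) \<le> 4 * C * norm Q ^ nat \<bar>n\<bar>"
    proof (cases "n \<ge> 0")
      case True
      hence eq: "Q powi n = Q ^ k" by (simp add: k_def power_int_def)
      have le: "norm (x * Q powi n) \<le> C * norm Q ^ k"
        using x C by (auto simp: eq norm_mult norm_power intro!: mult_right_mono)
      hence "norm (x * Q powi n) \<le> 1 / 2" using N[OF k] by linarith
      from norm_koebe_le[OF this] le show ?thesis by (simp add: k_def)
    next
      case False
      hence eq: "inverse (x * Q powi n) = inverse x * Q ^ k"
        by (simp add: k_def power_int_def field_simps)
      have "inverse (norm x) \<le> 1 / a" using x x0 ab by (simp add: field_simps)
      hence le: "norm (inverse (x * Q powi n)) \<le> C * norm Q ^ k"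
        unfolding eq using C by (auto simp: norm_mult norm_power norm_inverse intro!: mult_right_mono)
      hence "norm (inverse (x * Q powi n)) \<le> 1 / 2" using N[OF k] by linarith
      from norm_koebe_le[OF this] le show ?thesis by (simp add: k_def koebe_inverse del: inverse_mult_distrib)
    qed
  qed
qed

lemma koebe_summable:
  assumes Q: "Q \<noteq> 0" "norm Q < 1" and x: "x \<noteq> 0"
  shows "(\<lambda>n. norm (koebe (x * Q powi n))) summable_on S"
proof -
  have "norm x > 0"
    using x by simp
  obtain N C where NC: "\<And>y n. norm x \<le> norm y \<Longrightarrow> norm y \<le> norm x \<Longrightarrow> \<bar>n\<bar> \<ge> int N \<Longrightarrow>
      norm (koebe (y * Q powi n)) \<le> C * norm Q ^ nat \<bar>n\<bar>"
    using koebe_sum_bound[OF Q \<open>norm x > 0\<close> \<open>norm x > 0\<close>] by blast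
  have "(\<lambda>n. C * norm Q ^ nat \<bar>n\<bar>) summable_on (- {-int N..int N})"
    by (intro summable_on_cmult_right summable_on_int_geometric) (use Q in auto)
  hence "(\<lambda>n. norm (koebe (x * Q powi n))) summable_on (- {-int N..int N})"
  proof (rule Infinite_Sum.abs_summable_on_comparison_test')
    fix n assume "n \<in> - {-int N..int N}"
    hence "\<bar>n\<bar> \<ge> int N" by (auto simp: abs_if)
    thus "norm (koebe (x * Q powi n)) \<le> C * norm Q ^ nat \<bar>n\<bar>" by (rule NC[OF order_refl order_refl])
  qed
  moreover have "(\<lambda>n. norm (koebe (x * Q powi n))) summable_on {-int N..int N}"
    by (rule summable_on_finite) (rule finite_atLeastAtMost_int)
  ultimately have "(\<lambda>n. norm (koebe (x * Q powi n))) summable_on (- {-int N..int N} \<union> {-int N..int N})"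
    by (rule summable_on_union)
  thus ?thesis
    by (rule summable_on_subset) auto
qed

lemma koebe_sum_holomorphic:
  assumes Q: "Q \<noteq> 0" "norm Q < 1" and A: "open A" "0 \<notin> A"
    and S: "\<And>x n. x \<in> A \<Longrightarrow> n \<in> S \<Longrightarrow> x * Q powi n \<noteq> 1"
  shows "koebe_sum Q S holomorphic_on A"
proof -
  have "(\<lambda>x. \<Sum>\<^sub>\<infinity>n\<in>S. koebe (x * Q powi n)) holomorphic_on A"
  proof (rule holomorphic_on_infsum[OF A(1)])
    fix n assume "n \<in> S"
    thus "(\<lambda>x. koebe (x * Q powi n)) holomorphic_on A"
      unfolding koebe_def using S[of _ n] by (intro holomorphic_intros) auto
  next
    fix z assume "z \<in> A"
    hence z: "z \<noteq> 0" using A by auto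
    have pos: "norm z / 2 > 0" "2 * norm z > 0" using z by simp_all
    obtain N C where NC: "\<And>x n. norm z / 2 \<le> norm x \<Longrightarrow> norm x \<le> 2 * norm z \<Longrightarrow> \<bar>n\<bar> \<ge> int N \<Longrightarrow>
        norm (koebe (x * Q powi n)) \<le> C * norm Q ^ nat \<bar>n\<bar>"
      using koebe_sum_bound[OF Q pos] by blast
    have "(\<lambda>n. C * norm Q ^ nat \<bar>n\<bar>) summable_on S"
      by (intro summable_on_cmult_right summable_on_int_geometric) (use Q in auto)
    moreover have "norm (koebe (x * Q powi n)) \<le> C * norm Q ^ nat \<bar>n\<bar>"
      if "n \<in> S - {-int N..int N}" "x \<in> cball z (norm z / 2)" for n x
    proof (rule NC)
      have "norm (z - x) \<le> norm z / 2"
        using that(2) by (simp add: dist_norm)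
      thus "norm z / 2 \<le> norm x" "norm x \<le> 2 * norm z"
        using norm_triangle_ineq2[of z x] norm_triangle_ineq2[of x z] norm_minus_commute[of x z]
          norm_ge_zero[of z]
        by linarith+
      show "\<bar>n\<bar> \<ge> int N"
        using that(1) by (auto simp: abs_if)
    qed
    ultimately show "\<exists>r>0. \<exists>M F. M summable_on S \<and> finite F \<and>
       (\<forall>n\<in>S - F. \<forall>x\<in>cball z r. norm (koebe (x * Q powi n)) \<le> M n)"
      using z
      by (intro exI[of _ "norm z / 2"] exI[of _ "\<lambda>n. C * norm Q ^ nat \<bar>n\<bar>"] exI[of _ "{-int N..int N}"]
          conjI ballI) simp_all
  qed
  thus ?thesis by (simp add: koebe_sum_def[abs_def])
qed

section \<open>The theta function and Liouville's theorem on the multiplicative torus\<close>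

definition theta :: "complex \<Rightarrow> complex \<Rightarrow> complex" where
  "theta Q x = qpochhammer_inf x Q * qpochhammer_inf (Q / x) Q"

context
  fixes Q :: complex
  assumes Q: "Q \<noteq> 0" "norm Q < 1"
begin

lemma koebe_sum_shift:
  "koebe_sum Q UNIV (x * Q powi k) = koebe_sum Q UNIV x"
  unfolding koebe_sum_def
  by (rule infsum_reindex_bij_witness[of _ "\<lambda>n. n - k" "\<lambda>n. n + k"])
     (use Q in \<open>auto simp: power_int_add mult_ac\<close>)

lemma koebe_sum_inverse:
  "koebe_sum Q UNIV (inverse x) = koebe_sum Q UNIV x"
  unfolding koebe_sum_def
proof (rule infsum_reindex_bij_witness[of _ uminus uminus])
  fix n :: int
  have "inverse (inverse x * Q powi n) = x * Q powi (-n)"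
    by (simp add: power_int_minus)
  thus "koebe (x * Q powi (-n)) = koebe (inverse x * Q powi n)"
    using koebe_inverse by metis
qed auto

text \<open>Only the term n = 0 is singular at x = 1; the rest is holomorphic there, which prepares
  the local analysis at the pole.\<close>

lemma koebe_sum_insert_0:
  assumes "x \<noteq> 0"
  shows "koebe_sum Q UNIV x = koebe x + koebe_sum Q (-{0}) x"
proof -
  have "insert 0 (-{0}) = (UNIV :: int set)" by auto
  moreover have "(\<lambda>n. koebe (x * Q powi n)) summable_on (-{0})"
    by (rule Infinite_Sum.abs_summable_summable[OF koebe_summable[OF Q assms]])
  ultimately show ?thesis
    using infsum_insert[of "\<lambda>n. koebe (x * Q powi n)" "-{0}" 0] by (simp add: koebe_sum_def)
qed

lemma theta_1 [simp]: "theta Q 1 = 0"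
  using Q by (simp add: theta_def qpochhammer_1_left)

lemma theta_factor:
  "theta Q x = (1 - x) * (qpochhammer_inf (x * Q) Q * qpochhammer_inf (Q / x) Q)"
  using Q by (simp add: theta_def qpochhammer_rec[of Q x])

lemma theta_shift:
  assumes x: "x \<noteq> 0"
  shows "theta Q (x * Q) = - theta Q x / x"
proof -
  have "theta Q (x * Q) = qpochhammer_inf (x * Q) Q * qpochhammer_inf (1 / x) Q"
    using Q x by (simp add: theta_def)
  also have "qpochhammer_inf (1 / x) Q = (1 - 1 / x) * qpochhammer_inf (Q / x) Q"
    using Q by (subst qpochhammer_rec) auto
  finally show ?thesis
    using x by (simp add: theta_factor field_simps)
qed

lemma theta_inverse:
  assumes x: "x \<noteq> 0"
  shows "theta Q (inverse x) = - theta Q x / x"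
proof -
  have "theta Q (inverse x) = theta Q (x * Q)"
    using Q x by (simp add: theta_def field_simps)
  thus ?thesis using theta_shift[OF x] by simp
qed

lemma theta_reflect:
  assumes x: "x \<noteq> 0"
  shows "theta Q (Q / x) = theta Q x"
  using Q x by (simp add: theta_def field_simps)

lemma theta_shift_eq_0_iff:
  assumes x: "x \<noteq> 0"
  shows "theta Q (x * Q powi k) = 0 \<longleftrightarrow> theta Q x = 0"
proof -
  have *: "theta Q (y * Q) = 0 \<longleftrightarrow> theta Q y = 0" if "y \<noteq> 0" for y
    using that by (simp add: theta_shift)
  have nat: "theta Q (y * Q ^ n) = 0 \<longleftrightarrow> theta Q y = 0" if "y \<noteq> 0" for y n
  proof (induction n)
    case (Suc n)
    have "theta Q (y * Q ^ n * Q) = 0 \<longleftrightarrow> theta Q (y * Q ^ n) = 0"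
      using that Q by (intro *) auto
    with Suc show ?case by (simp add: mult_ac)
  qed auto
  show ?thesis
  proof (cases "k \<ge> 0")
    case True
    thus ?thesis using nat[OF x, of "nat k"] by (simp add: power_int_def)
  next
    case False
    define y where "y = x * Q powi k"
    have eq: "y * Q ^ nat (-k) = x"
      using Q False by (simp add: y_def power_int_def power_inverse)
    have "y \<noteq> 0" using x Q by (simp add: y_def)
    from nat[OF this, of "nat (-k)"] show ?thesis
      unfolding eq by (simp add: y_def)
  qed
qed

lemma theta_eq_0_iff:
  assumes x: "x \<noteq> 0"
  shows "theta Q x = 0 \<longleftrightarrow> (\<exists>n. x * Q powi n = 1)"
proof
  assume "theta Q x = 0"
  hence "qpochhammer_inf x Q = 0 \<or> qpochhammer_inf (Q / x) Q = 0"
    by (simp add: theta_def)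
  then consider n where "x * Q ^ n = 1" | n where "Q / x * Q ^ n = 1"
    using qpochhammer_nonzero[OF Q(2)] by blast
  thus "\<exists>n. x * Q powi n = 1"
  proof cases
    case 1
    thus ?thesis by (intro exI[of _ "int n"]) simp
  next
    case 2
    hence "Q ^ Suc n = x" using x by (simp add: field_simps)
    hence "x * Q powi (- int (Suc n)) = 1"
      using x by (simp only: power_int_minus power_int_of_nat) simp
    thus ?thesis ..
  qed
next
  assume "\<exists>n. x * Q powi n = 1"
  thus "theta Q x = 0" using theta_shift_eq_0_iff[OF x] theta_1 by metis
qed

lemma theta_holomorphic:
  assumes "f holomorphic_on A" "open A" "\<And>x. x \<in> A \<Longrightarrow> f x \<noteq> 0"
  shows "(\<lambda>x. theta Q (f x)) holomorphic_on A"
  unfolding theta_def using assms Q by (intro holomorphic_intros) auto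

lemma open_theta_nonzero: "open {x. x \<noteq> 0 \<and> theta Q x \<noteq> 0}"
proof -
  have "continuous_on (-{0}) (theta Q)"
    by (intro holomorphic_on_imp_continuous_on theta_holomorphic holomorphic_intros) auto
  hence "open (-{0} \<inter> theta Q -` (-{0}))"
    by (intro continuous_open_preimage) auto
  also have "-{0} \<inter> theta Q -` (-{0}) = {x. x \<noteq> 0 \<and> theta Q x \<noteq> 0}" by auto
  finally show ?thesis .
qed

text \<open>Packages the simple zero at 1: \<open>theta Q x\<close> is 1 - x times a cofactor
  without zeros on a small disc.\<close>

lemma theta_near_1:
  obtains e where "0 < e" "e < 1" "theta Q holomorphic_on ball 1 e" "\<forall>x\<in>ball (1::complex) e. x \<noteq> 0"
    "\<forall>x\<in>ball 1 e. qpochhammer_inf (x * Q) Q * qpochhammer_inf (Q / x) Q \<noteq> 0"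
    "(\<lambda>x. qpochhammer_inf (x * Q) Q * qpochhammer_inf (Q / x) Q) holomorphic_on ball 1 e"
proof -
  define h where "h = (\<lambda>x. qpochhammer_inf (x * Q) Q * qpochhammer_inf (Q / x) Q)"
  have hol: "h holomorphic_on -{0}"
    unfolding h_def using Q by (intro holomorphic_intros) auto
  have "Q * Q ^ n \<noteq> 1" for n
    using Q power_Suc_less_one[of "norm Q" n] by (metis norm_ge_zero norm_mult norm_one norm_power less_irrefl
        power_Suc zero_less_norm_iff)
  hence "qpochhammer_inf Q Q \<noteq> 0"
    using qpochhammer_nonzero[OF Q(2)] by blast
  hence h1: "h 1 \<noteq> 0" by (simp add: h_def)
  have "isCont h 1"
    using holomorphic_on_imp_continuous_on[OF hol] by (auto simp: continuous_on_eq_continuous_at open_Compl)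
  then obtain e where e: "e > 0" "\<And>x. dist 1 x < e \<Longrightarrow> h x \<noteq> 0"
    using continuous_at_avoid[of 1 h 0] h1 by auto
  define d where "d = min e (1/2)"
  have nz: "x \<noteq> 0" if "x \<in> ball 1 d" for x :: complex
  proof
    assume "x = 0"
    with that have "dist (1 :: complex) 0 < 1 / 2" by (simp add: d_def)
    thus False by simp
  qed
  show ?thesis
  proof (rule that[of d])
    show "0 < d" "d < 1" using e by (auto simp: d_def)
    show "theta Q holomorphic_on ball 1 d"
      using nz by (intro theta_holomorphic holomorphic_intros) auto
    show "(\<lambda>x. qpochhammer_inf (x * Q) Q * qpochhammer_inf (Q / x) Q) holomorphic_on ball 1 d"
      using hol unfolding h_def by (rule holomorphic_on_subset) (use nz in blast)
    show "\<forall>x\<in>ball 1 d. qpochhammer_inf (x * Q) Q * qpochhammer_inf (Q / x) Q \<noteq> 0"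
      using e(2) by (simp add: h_def d_def)
    show "\<forall>x\<in>ball (1::complex) d. x \<noteq> 0"
      using nz by blast
  qed
qed

lemma scale_to_annulus:
  assumes x: "x \<noteq> 0"
  obtains k where "norm Q \<le> norm (x * Q powi k)" "norm (x * Q powi k) \<le> 1"
proof -
  define l where "l = ln (norm Q)"
  have l: "l < 0" using Q by (simp add: l_def)
  define r where "r = ln (norm x) / l"
  define k where "k = - \<lfloor>r\<rfloor>"
  have "norm Q powi k = exp (of_int k * l)"
    using Q powr_real_of_int'[of "norm Q" k] by (simp add: powr_def l_def)
  hence eq: "norm (x * Q powi k) = exp ((r + of_int k) * l)"
    using x l by (simp add: norm_mult norm_power_int r_def algebra_simps exp_add)
  have *: "0 \<le> r + of_int k" "r + of_int k \<le> 1"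
    unfolding k_def by linarith+
  have "norm Q = exp l" using Q by (simp add: l_def)
  moreover have "1 * l \<le> (r + of_int k) * l" "(r + of_int k) * l \<le> 0 * l"
    using * l by (intro mult_right_mono_neg; simp)+
  ultimately show ?thesis
    using eq by (intro that[of k]) auto
qed

text \<open>The limit at 1 makes the singularity there removable, and periodicity carries this to
  the whole orbit of 1. The extension \<open>F\<close> is bounded because the annulus |Q| <= |x| <=
  1 meets every orbit. Since \<open>F\<close> lives on the punctured plane, Liouville's theorem is
  applied to its composition with \<open>exp\<close>.\<close>

lemma elliptic_Liouville:
  assumes hol: "f holomorphic_on {x. x \<noteq> 0 \<and> theta Q x \<noteq> 0}"
    and per: "\<And>x. x \<noteq> 0 \<Longrightarrow> theta Q x \<noteq> 0 \<Longrightarrow> f (x * Q) = f x"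
    and lim: "f \<midarrow>1\<rightarrow> L"
    and x: "x \<noteq> 0" "theta Q x \<noteq> 0"
  shows "f x = L"
proof -
  define F where "F = (\<lambda>x. if theta Q x = 0 then L else f x)"
  have perF: "F (x * Q) = F x" if "x \<noteq> 0" for x
    using that per theta_shift_eq_0_iff[of x 1] by (auto simp: F_def)
  have perFn: "F (x * Q ^ n) = F x" if "x \<noteq> 0" for x n
  proof (induction n)
    case (Suc n)
    thus ?case using perF[of "x * Q ^ n"] that Q by (simp add: mult_ac)
  qed auto
  have perFi: "F (x * Q powi k) = F x" if "x \<noteq> 0" for x k
  proof (cases "k \<ge> 0")
    case True
    thus ?thesis using perFn[OF that, of "nat k"] by (simp add: power_int_def)
  next
    case False
    have eq: "x * Q powi k * Q ^ nat (-k) = x" using Q False by (simp add: power_int_def power_inverse)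
    have "x * Q powi k \<noteq> 0" using that Q by simp
    from perFn[OF this, of "nat (-k)"] show ?thesis unfolding eq by (rule sym)
  qed
  obtain e where e: "0 < e" "e < 1" "theta Q holomorphic_on ball 1 e" "\<forall>x\<in>ball (1::complex) e. x \<noteq> 0"
    "\<forall>x\<in>ball 1 e. qpochhammer_inf (x * Q) Q * qpochhammer_inf (Q / x) Q \<noteq> 0"
    "(\<lambda>x. qpochhammer_inf (x * Q) Q * qpochhammer_inf (Q / x) Q) holomorphic_on ball 1 e"
    by (rule theta_near_1)
  note e4 = e(4)[rule_format] and e5 = e(5)[rule_format]
  have th0: "theta Q x = 0 \<longleftrightarrow> x = 1" if "x \<in> ball 1 e" for x
    using e5[OF that] by (auto simp: theta_factor)
  have z0: "0 \<notin> ball (1::complex) e"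
    using e4 by blast
  have "f holomorphic_on ball 1 e - {1}"
    by (rule holomorphic_on_subset[OF hol]) (use z0 th0 in blast)
  hence "(\<lambda>x. if x = 1 then L else f x) holomorphic_on ball 1 e"
    by (rule removable_singularity) (use lim in auto)
  hence F1: "F holomorphic_on ball 1 e"
    by (rule holomorphic_transform) (use th0 in \<open>auto simp: F_def\<close>)
  have F2: "F holomorphic_on {x. x \<noteq> 0 \<and> theta Q x \<noteq> 0}"
    by (rule holomorphic_transform[OF hol]) (auto simp: F_def)
  have FC: "F analytic_on -{0}"
    unfolding analytic_on_def
  proof
    fix x :: complex assume "x \<in> -{0}"
    hence x: "x \<noteq> 0" by simp
    show "\<exists>r>0. F holomorphic_on ball x r"
    proof (cases "theta Q x = 0")
      case False
      then obtain r where "r > 0" "ball x r \<subseteq> {x. x \<noteq> 0 \<and> theta Q x \<noteq> 0}"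
        using open_theta_nonzero x by (auto simp: open_contains_ball)
      thus ?thesis using F2 holomorphic_on_subset by blast
    next
      case True
      then obtain n where n: "x * Q powi n = 1" using theta_eq_0_iff[OF x] by blast
      \<comment> \<open>Multiplication by \<open>Q powi n\<close> scales distances by its norm, so
        this ball about the orbit point x is carried into the disc about 1.\<close>
      define r where "r = e / norm (Q powi n)"
      have r: "r > 0" using e(1) Q by (simp add: r_def)
      have sub: "y * Q powi n \<in> ball 1 e" if "y \<in> ball x r" for y
      proof -
        have "1 - y * Q powi n = (x - y) * Q powi n"
          using n by (simp only: left_diff_distrib)
        hence "norm (1 - y * Q powi n) = norm ((x - y) * Q powi n)"
          by (rule arg_cong)
        also have "\<dots> < r * norm (Q powi n)"
          unfolding norm_mult using that Q by (intro mult_strict_right_mono) (auto simp: dist_norm)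
        also have "\<dots> = e" using Q by (simp add: r_def)
        finally show ?thesis by (simp add: dist_norm)
      qed
      have "(F \<circ> (\<lambda>y. y * Q powi n)) holomorphic_on ball x r"
        by (rule holomorphic_on_compose_gen[OF _ F1]) (use sub in \<open>auto intro!: holomorphic_intros\<close>)
      moreover have "(F \<circ> (\<lambda>y. y * Q powi n)) y = F y" if "y \<in> ball x r" for y
      proof -
        have "y * Q powi n \<noteq> 0" by (rule e4[OF sub[OF that]])
        hence "y \<noteq> 0" by auto
        thus ?thesis using perFi by simp
      qed
      ultimately have "F holomorphic_on ball x r"
        by (rule holomorphic_transform)
      thus ?thesis using r by blast
    qed
  qed
  hence FC: "F holomorphic_on -{0}" by (rule analytic_imp_holomorphic)
  have "compact (cball (0::complex) 1 - ball 0 (norm Q))"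
    by (intro compact_diff compact_cball open_ball)
  moreover have "continuous_on (cball (0::complex) 1 - ball 0 (norm Q)) F"
    by (rule continuous_on_subset[OF holomorphic_on_imp_continuous_on[OF FC]]) (use Q in auto)
  ultimately have "bounded (F ` (cball (0::complex) 1 - ball 0 (norm Q)))"
    by (intro compact_imp_bounded compact_continuous_image)
  then obtain B where "\<forall>y\<in>F ` (cball (0::complex) 1 - ball 0 (norm Q)). norm y \<le> B"
    unfolding bounded_iff ..
  hence B: "\<And>y. y \<in> cball 0 1 - ball 0 (norm Q) \<Longrightarrow> norm (F y) \<le> B"
    by blast
  have bd: "norm (F y) \<le> B" if y: "y \<noteq> 0" for y
  proof -
    obtain k where "norm Q \<le> norm (y * Q powi k)" "norm (y * Q powi k) \<le> 1"
      by (rule scale_to_annulus[OF y])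
    thus ?thesis using B[of "y * Q powi k"] perFi[OF y] by simp
  qed
  have "(F \<circ> exp) holomorphic_on UNIV"
    by (rule holomorphic_on_compose_gen[OF _ FC]) (auto intro!: holomorphic_intros)
  moreover have "bounded (range (F \<circ> exp))"
    unfolding bounded_iff using bd by (intro exI[of _ B]) auto
  ultimately have "(F \<circ> exp) constant_on UNIV"
    by (rule Liouville_theorem)
  then obtain c where c: "\<And>w. F (exp w) = c"
    by (auto simp: constant_on_def)
  have "F x = c" "F 1 = c"
    using c[of "Ln x"] c[of 0] x by auto
  thus ?thesis using x by (simp add: F_def)
qed

text \<open>As functions of x both sides are periodic with at most double poles, on the orbit of 1.
  Their difference \<open>g\<close> is constant because the double-pole coefficients agree and the
  simple-pole term is killed by invariance under x -> 1/x; the constant is \<open>g y\<close> = 0,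
  since \<open>theta Q 1 = 0\<close>.\<close>

lemma koebe_sum_diff:
  assumes x: "x \<noteq> 0" "theta Q x \<noteq> 0" and y: "y \<noteq> 0" "theta Q y \<noteq> 0"
  shows "koebe_sum Q UNIV x - koebe_sum Q UNIV y =
           qpochhammer_inf Q Q ^ 4 * x * theta Q (x * y) * theta Q (y / x) / (theta Q x * theta Q y)\<^sup>2"
proof -
  define c where "c = qpochhammer_inf Q Q ^ 4 / (theta Q y)\<^sup>2"
  define A where "A = {x. x \<noteq> 0 \<and> theta Q x \<noteq> 0}"
  define g where "g = (\<lambda>x. koebe_sum Q UNIV x - koebe_sum Q UNIV y -
            c * x * theta Q (x * y) * theta Q (y / x) / (theta Q x)\<^sup>2)"
  have A: "open A" "0 \<notin> A" using open_theta_nonzero by (auto simp: A_def)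
  have hol: "g holomorphic_on A"
    unfolding g_def using A y(1)
    by (intro holomorphic_intros koebe_sum_holomorphic theta_holomorphic Q)
       (auto simp: A_def theta_eq_0_iff)
  have per: "g (x * Q) = g x" if x: "x \<noteq> 0" "theta Q x \<noteq> 0" for x
  proof -
    have eq1: "theta Q (y / (x * Q)) = - theta Q (y / x) * (y / x) / Q"
      using theta_shift[of "y / (x * Q)"] x y Q by (simp add: field_simps)
    have eq2: "theta Q (x * Q * y) = - theta Q (x * y) / (x * y)"
      using theta_shift[of "x * y"] x y by (simp add: mult_ac)
    have eq3: "theta Q (x * Q) = - theta Q x / x"
      using theta_shift x by simp
    have "c * (x * Q) * theta Q (x * Q * y) * theta Q (y / (x * Q)) / (theta Q (x * Q))\<^sup>2 =
          c * x * theta Q (x * y) * theta Q (y / x) / (theta Q x)\<^sup>2"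
      unfolding eq1 eq2 eq3 using x y Q by (simp add: divide_simps power2_eq_square)
    thus ?thesis using koebe_sum_shift[of x 1] by (simp add: g_def)
  qed
  have sym: "g (inverse x) = g x" if x: "x \<noteq> 0" for x
  proof -
    have eq: "inverse x * y = y / x" "y / inverse x = x * y"
      by (simp_all add: field_simps)
    have "c * inverse x * theta Q (y / x) * theta Q (x * y) / (- theta Q x / x)\<^sup>2 =
            c * x * theta Q (x * y) * theta Q (y / x) / (theta Q x)\<^sup>2"
      using x by (simp add: power_divide power2_eq_square)
    thus ?thesis
      unfolding g_def eq theta_inverse[OF x] koebe_sum_inverse by simp
  qed
  obtain e where e: "0 < e" "e < 1" "theta Q holomorphic_on ball 1 e" "\<forall>x\<in>ball (1::complex) e. x \<noteq> 0"
    "\<forall>x\<in>ball 1 e. qpochhammer_inf (x * Q) Q * qpochhammer_inf (Q / x) Q \<noteq> 0"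
    "(\<lambda>x. qpochhammer_inf (x * Q) Q * qpochhammer_inf (Q / x) Q) holomorphic_on ball 1 e"
    by (rule theta_near_1)
  note e4 = e(4)[rule_format] and e5 = e(5)[rule_format]
  define h where "h = (\<lambda>x. qpochhammer_inf (x * Q) Q * qpochhammer_inf (Q / x) Q)"
  have nz: "x * Q powi n \<noteq> 1" if "x \<in> ball 1 e" "n \<in> -{0}" for x n
  proof
    assume *: "x * Q powi n = 1"
    hence "theta Q x = 0" using e4[OF that(1)] theta_eq_0_iff by blast
    hence "x = 1" using e5[OF that(1)] by (simp add: theta_factor)
    with * have "norm Q powi n = 1" by (metis mult_1 norm_one norm_power_int)
    moreover have "norm Q powi n \<noteq> 1"
      using Q that(2) power_int_strict_decreasing[of n 0 "norm Q"] power_int_strict_decreasing[of 0 n "norm Q"]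
      by (cases "n < 0") (auto simp: less_le)
    ultimately show False by simp
  qed
  \<comment> \<open>\<open>W\<close> is \<open>g\<close> with the double pole at 1 cleared;
    \<open>V\<close> and \<open>U\<close> below divide out x - 1 once more each time the value at 1
    is shown to vanish.\<close>
  define W where "W = (\<lambda>x. x + (1 - x)\<^sup>2 * (koebe_sum Q (-{0}) x - koebe_sum Q UNIV y) -
            c * x * theta Q (x * y) * theta Q (y / x) / (h x)\<^sup>2)"
  have hhol: "h holomorphic_on ball 1 e" and hnz: "\<And>x. x \<in> ball 1 e \<Longrightarrow> h x \<noteq> 0"
    using e(6) e5 by (simp_all add: h_def del: mem_ball)
  have z0: "0 \<notin> ball (1::complex) e"
    using e4 by blast
  have Whol: "W holomorphic_on ball 1 e"
    unfolding W_def using y(1)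
    by (intro holomorphic_intros koebe_sum_holomorphic theta_holomorphic Q hhol open_ball z0)
       (simp_all add: e4 hnz nz del: mem_ball)
  have gW: "g x = W x / (x - 1)\<^sup>2" if "x \<in> ball 1 e" "x \<noteq> 1" for x
  proof -
    have "x \<noteq> 0" "h x \<noteq> 0" using e4[OF that(1)] e5[OF that(1)] by (auto simp: h_def)
    moreover have "theta Q x = (1 - x) * h x" by (simp add: h_def theta_factor)
    moreover have "1 - x \<noteq> 0" using that by simp
    moreover have "(x - 1)\<^sup>2 = (1 - x)\<^sup>2" by (rule power2_commute)
    ultimately show ?thesis
      unfolding g_def W_def
      by (simp add: koebe_sum_insert_0 koebe_def add_divide_distrib diff_divide_distrib power_mult_distrib)
  qed
  have "qpochhammer_inf Q Q \<noteq> 0" using e5[of 1] e(1) by simp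
  \<comment> \<open>Here the fourth power of (Q;Q) is forced: at x = 1 the two theta factors cancel
    the square of \<open>theta Q y\<close>, and \<open>h 1\<close> is the square of (Q;Q).\<close>
  hence W1: "W 1 = 0"
    using y by (simp add: W_def c_def h_def power2_eq_square power4_eq_xxxx)
  define V where "V = (\<lambda>x. if x = 1 then deriv W 1 else W x / (x - 1))"
  have Vhol: "V holomorphic_on ball 1 e"
    using pole_lemma_open[OF Whol open_ball, of 1] unfolding W1 V_def by (simp cong: if_cong)
  have Vlim: "V \<midarrow>1\<rightarrow> V 1"
    using holomorphic_on_imp_continuous_on[OF Vhol] e(1)
    by (auto simp: continuous_on_eq_continuous_at isCont_def)
  have gV: "g x = V x / (x - 1)" if "x \<in> ball 1 e" "x \<noteq> 1" for x
    using gW[OF that] that by (simp add: V_def power2_eq_square)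
  have inv_lim: "(inverse :: complex \<Rightarrow> complex) \<midarrow>1\<rightarrow> 1"
    by (auto intro!: tendsto_eq_intros)
  have "filterlim (inverse :: complex \<Rightarrow> complex) (at 1) (at 1)"
    unfolding filterlim_at using inv_lim by (auto simp: eventually_at_filter)
  hence Vlim': "((\<lambda>x. V (inverse x)) \<longlongrightarrow> V 1) (at 1)"
    using Vlim filterlim_compose by blast
  have ev1: "\<forall>\<^sub>F x in at 1. x \<in> ball 1 e - {1}"
    using e(1) by (intro eventually_at_in_open) auto
  have "\<forall>\<^sub>F x in at 1. inverse x \<in> ball (1::complex) e"
    by (rule topological_tendstoD[OF inv_lim open_ball]) (use e(1) in simp)
  hence "\<forall>\<^sub>F x in at 1. V (inverse x) = - V x / x"
    using ev1
  proof eventually_elim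
    case (elim x)
    hence x: "x \<noteq> 0" "x \<noteq> 1" "inverse x \<noteq> 1" using e4 by auto
    have "V (inverse x) / (inverse x - 1) = V x / (x - 1)"
      using gV[of x] gV[of "inverse x"] sym[OF x(1)] elim x by auto
    moreover have "inverse x - 1 \<noteq> 0" "x - 1 \<noteq> 0" using x by auto
    ultimately have "V (inverse x) * (x - 1) = V x * (inverse x - 1)"
      by (rule iffD1[OF frac_eq_eq, rotated 2])
    hence "V (inverse x) * (x - 1) * x = V x * (inverse x - 1) * x"
      by simp
    also have "\<dots> = V x * (1 - x)"
      using x by (simp add: field_simps)
    finally have "(x - 1) * (V (inverse x) * x + V x) = 0"
      by (simp add: algebra_simps)
    hence "V (inverse x) * x = - V x"
      using x by (simp add: eq_neg_iff_add_eq_0)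
    thus ?case using x by (simp add: field_simps)
  qed
  moreover have "((\<lambda>x. - V x / x) \<longlongrightarrow> - V 1 / 1) (at 1)"
    by (intro tendsto_intros Vlim) auto
  ultimately have "((\<lambda>x. V (inverse x)) \<longlongrightarrow> - V 1 / 1) (at 1)"
    by (subst tendsto_cong) auto
  \<comment> \<open>Invariance of \<open>g\<close> under inversion has become V(1/x) = - V(x)/x, and
    x -> 1 leaves V(1) = - V(1).\<close>
  with Vlim' have "V 1 = - V 1 / 1"
    by (intro tendsto_unique[of "at 1"]) auto
  hence V1: "V 1 = 0"
    by (simp add: eq_neg_iff_add_eq_0)
  define U where "U = (\<lambda>x. if x = 1 then deriv V 1 else V x / (x - 1))"
  have Uhol: "U holomorphic_on ball 1 e"
    using pole_lemma_open[OF Vhol open_ball, of 1] unfolding V1 U_def by (simp cong: if_cong)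
  have "U \<midarrow>1\<rightarrow> U 1"
    using holomorphic_on_imp_continuous_on[OF Uhol] e(1)
    by (auto simp: continuous_on_eq_continuous_at isCont_def)
  moreover have "\<forall>\<^sub>F x in at 1. U x = g x"
    using ev1 by eventually_elim (use gV in \<open>auto simp: U_def\<close>)
  ultimately have lim: "g \<midarrow>1\<rightarrow> U 1"
    by (subst tendsto_cong[symmetric]) 
  have "g x = U 1" if "x \<noteq> 0" "theta Q x \<noteq> 0" for x
    by (rule elliptic_Liouville[OF hol[unfolded A_def] per lim that])
  hence "g x = g y" using x y by simp
  also have "g y = 0" using y by (simp add: g_def)
  finally show ?thesis
    using y by (simp add: g_def c_def power_mult_distrib field_simps)
qed

end

lemma infsum_int_split:
  fixes f :: "int \<Rightarrow> 'a :: banach"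
  assumes f: "f summable_on UNIV" and m: "m > 0"
  shows "(\<Sum>\<^sub>\<infinity>n\<in>UNIV. f n) = (\<Sum>j<m. \<Sum>\<^sub>\<infinity>k\<in>UNIV. f (int m * k + int j))"
proof -
  define g where "g = (\<lambda>(j, k). f (int m * k + int j))"
  have bij: "f summable_on UNIV \<longleftrightarrow> g summable_on ({..<m} \<times> UNIV)"
            "(\<Sum>\<^sub>\<infinity>n\<in>UNIV. f n) = (\<Sum>\<^sub>\<infinity>p\<in>{..<m} \<times> UNIV. g p)"
    by ((rule summable_on_reindex_bij_witness[of _ "\<lambda>(j,k). int m * k + int j"
              "\<lambda>n. (nat (n mod int m), n div int m)"]
         | rule infsum_reindex_bij_witness[of _ "\<lambda>(j,k). int m * k + int j"
              "\<lambda>n. (nat (n mod int m), n div int m)"]),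
        use m in \<open>auto simp: g_def nat_less_iff\<close>)+
  have "(\<Sum>\<^sub>\<infinity>p\<in>{..<m} \<times> UNIV. g p) = (\<Sum>\<^sub>\<infinity>j\<in>{..<m}. \<Sum>\<^sub>\<infinity>k\<in>UNIV. g (j, k))"
    using bij(1) f by (intro infsum_Sigma_banach[symmetric]) auto
  thus ?thesis
    unfolding bij(2) by (simp add: g_def)
qed

section \<open>Lambert series as values at torsion points\<close>

text \<open>This is \<Sum> \<sigma>(n) Q^n = (1 - E_2)/24, with the divisor sum \<sigma> and the
  quasi-modular Eisenstein series E_2.\<close>

definition lambert_koebe :: "complex \<Rightarrow> complex" where
  "lambert_koebe Q = (\<Sum>\<^sub>\<infinity>n\<in>{1::nat..}. koebe (Q ^ n))"

context
  fixes Q :: complex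
  assumes Q: "Q \<noteq> 0" "norm Q < 1"
begin

lemma koebe_summable':
  assumes "x \<noteq> 0"
  shows "(\<lambda>n. koebe (x * Q powi n)) summable_on S"
  by (rule Infinite_Sum.abs_summable_summable[OF koebe_summable[OF Q assms]])

text \<open>Passes from the group generated by Q to its subgroup generated by Q^m; for x = 1 the
  points on the right are torsion points modulo Q^m.\<close>

lemma koebe_sum_split:
  assumes x: "x \<noteq> 0" and m: "m > 0"
  shows "koebe_sum Q UNIV x = (\<Sum>j<m. koebe_sum (Q ^ m) UNIV (x * Q ^ j))"
proof -
  have eq: "x * Q powi (int m * k + int j) = x * Q ^ j * (Q ^ m) powi k" for j k
    using Q by (simp add: power_int_add power_int_mult)
  thus ?thesis
    unfolding koebe_sum_def infsum_int_split[OF koebe_summable'[OF x] m] by (simp only: eq)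
qed

text \<open>The index set is kept general since at x = 1 the polar index 0 has to be left out:
  termwise duplication fails there.\<close>

lemma koebe_sum_add_uminus:
  assumes x: "x \<noteq> 0" and S: "\<And>n. n \<in> S \<Longrightarrow> (x * Q powi n)\<^sup>2 \<noteq> 1"
  shows "koebe_sum Q S x + koebe_sum Q S (-x) = 4 * koebe_sum (Q\<^sup>2) S (x\<^sup>2)"
proof -
  have "koebe_sum Q S x + koebe_sum Q S (-x) =
          (\<Sum>\<^sub>\<infinity>n\<in>S. koebe (x * Q powi n) + koebe (-x * Q powi n))"
    unfolding koebe_sum_def using x by (intro infsum_add[symmetric] koebe_summable') auto
  also have "\<dots> = (\<Sum>\<^sub>\<infinity>n\<in>S. 4 * koebe (x\<^sup>2 * Q\<^sup>2 powi n))"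
  proof (rule infsum_cong)
    fix n assume "n \<in> S"
    from koebe_add_uminus[OF S[OF this]]
    show "koebe (x * Q powi n) + koebe (-x * Q powi n) = 4 * koebe (x\<^sup>2 * Q\<^sup>2 powi n)"
      by (simp add: power_mult_distrib power_int_power power_int_power' mult.commute)
  qed
  also have "\<dots> = 4 * koebe_sum (Q\<^sup>2) S (x\<^sup>2)"
    by (simp add: koebe_sum_def infsum_cmult_right')
  finally show ?thesis .
qed

lemma koebe_sum_1: "koebe_sum Q UNIV 1 = 2 * lambert_koebe Q"
proof -
  have pos: "(\<Sum>\<^sub>\<infinity>n\<in>{1..}. koebe (1 * Q powi n)) = lambert_koebe Q"
    unfolding lambert_koebe_def
    by (rule infsum_reindex_bij_witness[of _ int nat]) (auto simp: power_int_def)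
  have neg: "(\<Sum>\<^sub>\<infinity>n\<in>{..-1}. koebe (1 * Q powi n)) = lambert_koebe Q"
    unfolding lambert_koebe_def
  proof (rule infsum_reindex_bij_witness[of _ "\<lambda>n. - int n" "\<lambda>n. nat (-n)"])
    fix n :: int assume "n \<in> {..-1}"
    hence "Q ^ nat (-n) = inverse (1 * Q powi n)" by (simp add: power_int_def power_inverse)
    thus "koebe (Q ^ nat (- n)) = koebe (1 * Q powi n)" by (simp only: koebe_inverse)
  qed auto
  have "-{0} = {1..} \<union> {..(-1::int)}" by auto
  hence "koebe_sum Q (-{0}) 1 = (\<Sum>\<^sub>\<infinity>n\<in>{1..} \<union> {..-1}. koebe (1 * Q powi n))"
    by (simp add: koebe_sum_def)
  also have "\<dots> = lambert_koebe Q + lambert_koebe Q"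
    by (subst infsum_Un_disjoint) (use pos neg koebe_summable'[of 1] in auto)
  finally show ?thesis
    using koebe_sum_insert_0[OF Q, of 1] by simp
qed

lemma power_int_neq_1:
  assumes "n \<noteq> 0" shows "norm (Q powi n) \<noteq> 1"
proof -
  have "norm Q powi n \<noteq> 1"
    using Q assms power_int_strict_decreasing[of n 0 "norm Q"] power_int_strict_decreasing[of 0 n "norm Q"]
    by (cases "n < 0") (auto simp: less_le)
  thus ?thesis by (simp add: norm_power_int)
qed

end

context
  fixes Q :: complex
  assumes Q: "Q \<noteq> 0" "norm Q < 1"
begin

text \<open>Duplication at x = 1 with the index 0 removed, after which the missing term
  \<open>koebe (-1)\<close> = -1/4 is put back. This term is the source of the additive rational
  constants in the identities.\<close>

lemma koebe_sum_minus_1: "koebe_sum Q UNIV (-1) = -1/4 + 8 * lambert_koebe (Q\<^sup>2) - 2 * lambert_koebe Q"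
proof -
  have Q2: "Q\<^sup>2 \<noteq> 0" "norm (Q\<^sup>2) < 1"
    using Q by (auto simp: norm_power power_less_one_iff)
  have "koebe_sum Q (-{0}) 1 + koebe_sum Q (-{0}) (-1) = 4 * koebe_sum (Q\<^sup>2) (-{0}) (1\<^sup>2)"
  proof (rule koebe_sum_add_uminus[OF Q])
    fix n :: int assume "n \<in> -{0}"
    hence "norm (Q powi n) \<noteq> 1" by (intro power_int_neq_1[OF Q]) auto
    thus "(1 * Q powi n)\<^sup>2 \<noteq> 1" by (auto simp: power2_eq_1_iff)
  qed auto
  moreover have "koebe_sum (Q\<^sup>2) (-{0}) (1\<^sup>2) = 2 * lambert_koebe (Q\<^sup>2)"
    using koebe_sum_1[OF Q2] koebe_sum_insert_0[OF Q2, of 1] by simp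
  moreover have "koebe_sum Q (-{0}) 1 = 2 * lambert_koebe Q"
    using koebe_sum_1[OF Q] koebe_sum_insert_0[OF Q, of 1] by simp
  ultimately have "koebe_sum Q (-{0}) (-1) = 8 * lambert_koebe (Q\<^sup>2) - 2 * lambert_koebe Q"
    by (simp add: eq_diff_eq add.commute)
  moreover have "koebe (-1) = -1/4" by (simp add: koebe_def)
  ultimately show ?thesis
    using koebe_sum_insert_0[OF Q, of "-1"] by simp
qed

lemma theta_nonzero:
  assumes "norm Q < norm x" "norm x \<le> 1" "x \<noteq> 1"
  shows "theta Q x \<noteq> 0"
proof
  assume "theta Q x = 0"
  moreover have "qpochhammer_inf x Q \<noteq> 0"
  proof (rule qpochhammer_nonzero[OF Q(2)])
    fix n show "x * Q ^ n \<noteq> 1"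
    proof (cases n)
      case (Suc k)
      have "norm (x * Q ^ n) = norm x * norm Q ^ n" by (simp add: norm_mult norm_power)
      also have "\<dots> \<le> 1 * norm Q ^ n" using assms by (intro mult_right_mono) auto
      also have "\<dots> < 1" using Q Suc power_Suc_less_one[of "norm Q" k] by simp
      finally show ?thesis by auto
    qed (use assms in auto)
  qed
  moreover have "qpochhammer_inf (Q / x) Q \<noteq> 0"
  proof (rule qpochhammer_nonzero[OF Q(2)])
    fix n
    have x: "norm x > 0" using assms(1) norm_ge_zero[of Q] by linarith
    have "norm (Q / x * Q ^ n) = norm Q / norm x * norm Q ^ n" by (simp add: norm_divide norm_mult norm_power)
    also have "\<dots> \<le> norm Q / norm x * 1" using Q x by (intro mult_left_mono power_le_one) auto
    also have "\<dots> < 1" using assms x by (simp add: field_simps)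
    finally show "Q / x * Q ^ n \<noteq> 1" by auto
  qed
  ultimately show False by (simp add: theta_def)
qed

lemma qpochhammer_self_nonzero: "qpochhammer_inf Q Q \<noteq> 0"
proof (rule qpochhammer_nonzero[OF Q(2)])
  fix n
  have "norm (Q * Q ^ n) = norm Q ^ Suc n" by (simp add: norm_mult norm_power)
  also have "\<dots> < 1" using Q by (intro power_Suc_less_one) auto
  finally show "Q * Q ^ n \<noteq> 1" by auto
qed

end

lemma lambert_odd_koebe:
  assumes Q: "Q \<noteq> 0" "norm Q < 1"
  shows "(\<Sum>\<^sub>\<infinity>n\<in>{1::nat..}. koebe (Q ^ (2 * n - 1))) = lambert_koebe Q - lambert_koebe (Q\<^sup>2)"
proof -
  have sum: "(\<lambda>n. koebe (Q ^ n)) summable_on {1::nat..}"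
  proof -
    have "(\<lambda>n. koebe (1 * Q powi n)) summable_on {1..}"
      by (rule koebe_summable'[OF Q]) auto
    also have "?this \<longleftrightarrow> ?thesis"
      by (rule summable_on_reindex_bij_witness[of _ int nat]) (auto simp: power_int_def)
    finally show ?thesis .
  qed
  have eq: "{1::nat..} = {n. odd n} \<union> {n. even n \<and> n \<ge> 1}"
    by (auto simp: Suc_le_eq odd_pos)
  have o: "(\<Sum>\<^sub>\<infinity>n\<in>{n. odd n}. koebe (Q ^ n)) = (\<Sum>\<^sub>\<infinity>n\<in>{1::nat..}. koebe (Q ^ (2 * n - 1)))"
    by (rule infsum_reindex_bij_witness[of _ "\<lambda>n. 2 * n - 1" "\<lambda>n. Suc n div 2"]) (auto elim!: oddE)
  have e: "(\<Sum>\<^sub>\<infinity>n\<in>{n. even n \<and> n \<ge> 1}. koebe (Q ^ n)) = lambert_koebe (Q\<^sup>2)"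
    unfolding lambert_koebe_def
    by (rule infsum_reindex_bij_witness[of _ "\<lambda>n. 2 * n" "\<lambda>n. n div 2"])
       (auto elim!: evenE simp: power_mult)
  have "lambert_koebe Q = (\<Sum>\<^sub>\<infinity>n\<in>{n. odd n} \<union> {n. even n \<and> n \<ge> 1}. koebe (Q ^ n))"
    unfolding lambert_koebe_def eq ..
  also have "\<dots> = (\<Sum>\<^sub>\<infinity>n\<in>{n. odd n}. koebe (Q ^ n)) + (\<Sum>\<^sub>\<infinity>n\<in>{n. even n \<and> n \<ge> 1}. koebe (Q ^ n))"
    by (rule infsum_Un_disjoint; (rule summable_on_subset[OF sum])?) (auto simp: Suc_le_eq odd_pos)
  finally show ?thesis using o e by simp
qed

section \<open>Sums of torsion values expressed by Lambert series\<close>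

context
  fixes q :: complex
  assumes q: "q \<noteq> 0" "norm q < 1"
begin

lemma nome_power: "n > 0 \<Longrightarrow> q ^ n \<noteq> 0 \<and> norm (q ^ n) < 1"
  using q by (auto simp: norm_power power_less_one_iff)

lemma koebe_sum_reflect:
  assumes "0 < k" "k < N"
  shows "koebe_sum (q ^ N) UNIV (q ^ (N - k)) = koebe_sum (q ^ N) UNIV (q ^ k)"
proof -
  have qN: "q ^ N \<noteq> 0" "norm (q ^ N) < 1"
    using nome_power[of N] assms by auto
  have "q ^ (N - k) = inverse (q ^ k) * (q ^ N) powi 1"
    using q assms by (simp add: power_diff field_simps)
  thus ?thesis
    by (simp only: koebe_sum_shift[OF qN] koebe_sum_inverse[OF qN])
qed

lemma theta_power_nonzero:
  assumes "0 < k" "k < N" "norm s = 1"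
  shows "theta (q ^ N) (s * q ^ k) \<noteq> 0"
proof (rule theta_nonzero)
  show "norm (q ^ N) < norm (s * q ^ k)"
    using q assms by (auto simp: norm_mult norm_power intro!: power_strict_decreasing)
  have "norm (s * q ^ k) < 1"
    using nome_power[OF assms(1)] assms(3) by (simp add: norm_mult)
  thus "norm (s * q ^ k) \<le> 1" "s * q ^ k \<noteq> 1" by auto
qed (use nome_power[of N] assms in auto)

lemma koebe_sum_power_add_uminus:
  assumes "0 < k" "k < N"
  shows "koebe_sum (q ^ N) UNIV (q ^ k) + koebe_sum (q ^ N) UNIV (- (q ^ k)) =
           4 * koebe_sum (q ^ (2 * N)) UNIV (q ^ (2 * k))"
proof -
  have qN: "q ^ N \<noteq> 0" "norm (q ^ N) < 1"
    using nome_power[of N] assms by auto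
  have ne: "(q ^ k * (q ^ N) powi n)\<^sup>2 \<noteq> 1" for n
  proof
    assume "(q ^ k * (q ^ N) powi n)\<^sup>2 = 1"
    hence "q ^ k * (q ^ N) powi n = 1 \<or> - (q ^ k) * (q ^ N) powi n = 1"
      by (auto simp: power2_eq_1_iff)
    hence "theta (q ^ N) (1 * q ^ k) = 0 \<or> theta (q ^ N) (-1 * q ^ k) = 0"
      using theta_eq_0_iff[OF qN, of "q ^ k"] theta_eq_0_iff[OF qN, of "- (q ^ k)"] q by auto
    thus False
      using theta_power_nonzero[OF assms, of 1] theta_power_nonzero[OF assms, of "-1"] by auto
  qed
  have "koebe_sum (q ^ N) UNIV (q ^ k) + koebe_sum (q ^ N) UNIV (- (q ^ k)) =
      4 * koebe_sum ((q ^ N)\<^sup>2) UNIV ((q ^ k)\<^sup>2)"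
    using q ne by (intro koebe_sum_add_uminus qN) auto
  thus ?thesis by (simp add: power_mult[symmetric] mult.commute)
qed

text \<open>The coset decomposition at x = 1 leaves the nontrivial torsion points, and inversion
  pairs k with N - k. For halves and thirds a single value remains and is determined; the lemmas for
  5, 6 and 10 give only a sum of values.\<close>

lemma koebe_sum_half:
  assumes "k > 0"
  shows "koebe_sum (q ^ (2 * k)) UNIV (q ^ k) = 2 * lambert_koebe (q ^ k) - 2 * lambert_koebe (q ^ (2 * k))"
proof -
  have qk: "q ^ k \<noteq> 0" "norm (q ^ k) < 1" and q2k: "q ^ (2 * k) \<noteq> 0" "norm (q ^ (2 * k)) < 1"
    using nome_power[of k] nome_power[of "2 * k"] assms by auto
  have "koebe_sum (q ^ k) UNIV 1 = koebe_sum (q ^ (2 * k)) UNIV 1 + koebe_sum (q ^ (2 * k)) UNIV (q ^ k)"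
    using koebe_sum_split[OF qk, of 1 2]
    by (simp add: numeral_2_eq_2 power_add mult_2)
  thus ?thesis
    unfolding koebe_sum_1[OF qk] koebe_sum_1[OF q2k] by (simp add: eq_diff_eq add.commute)
qed

lemma koebe_sum_third:
  assumes "k > 0"
  shows "koebe_sum (q ^ (3 * k)) UNIV (q ^ k) = lambert_koebe (q ^ k) - lambert_koebe (q ^ (3 * k))"
proof -
  have qk: "q ^ k \<noteq> 0" "norm (q ^ k) < 1" and q3k: "q ^ (3 * k) \<noteq> 0" "norm (q ^ (3 * k)) < 1"
    using nome_power[of k] nome_power[of "3 * k"] assms by auto
  have "koebe_sum (q ^ k) UNIV 1 = koebe_sum (q ^ (3 * k)) UNIV 1 + koebe_sum (q ^ (3 * k)) UNIV (q ^ k)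
           + koebe_sum (q ^ (3 * k)) UNIV (q ^ (2 * k))"
  proof -
    have "{..<3::nat} = {0, 1, 2}" and "(q ^ k) ^ 3 = q ^ (3 * k)" and "(q ^ k) ^ 2 = q ^ (2 * k)"
      by (auto simp: power_mult[symmetric] mult.commute)
    thus ?thesis
      using koebe_sum_split[OF qk, of 1 3] by (simp add: add.assoc)
  qed
  also have "koebe_sum (q ^ (3 * k)) UNIV (q ^ (2 * k)) = koebe_sum (q ^ (3 * k)) UNIV (q ^ k)"
    using koebe_sum_reflect[of k "3 * k"] assms by simp
  finally have "2 * lambert_koebe (q ^ k) = 2 * (lambert_koebe (q ^ (3 * k)) + koebe_sum (q ^ (3 * k)) UNIV (q ^ k))"
    unfolding koebe_sum_1[OF qk] koebe_sum_1[OF q3k] by simp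
  hence "lambert_koebe (q ^ k) = lambert_koebe (q ^ (3 * k)) + koebe_sum (q ^ (3 * k)) UNIV (q ^ k)"
    by (simp only: mult_cancel_left) simp
  thus ?thesis by simp
qed

lemma koebe_sum_fifth:
  "koebe_sum (q ^ 5) UNIV q + koebe_sum (q ^ 5) UNIV (q ^ 2) = lambert_koebe q - lambert_koebe (q ^ 5)"
proof -
  have q5: "q ^ 5 \<noteq> 0" "norm (q ^ 5) < 1"
    using nome_power[of 5] by auto
  have "koebe_sum q UNIV 1 = koebe_sum (q ^ 5) UNIV 1 + koebe_sum (q ^ 5) UNIV q
     + koebe_sum (q ^ 5) UNIV (q ^ 2) + koebe_sum (q ^ 5) UNIV (q ^ 3) + koebe_sum (q ^ 5) UNIV (q ^ 4)"
    using koebe_sum_split[OF q, of 1 5] by (simp add: eval_nat_numeral)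
  also have "koebe_sum (q ^ 5) UNIV (q ^ 4) = koebe_sum (q ^ 5) UNIV q"
    using koebe_sum_reflect[of 1 5] by simp
  also have "koebe_sum (q ^ 5) UNIV (q ^ 3) = koebe_sum (q ^ 5) UNIV (q ^ 2)"
    using koebe_sum_reflect[of 2 5] by simp
  finally have "2 * lambert_koebe q = 2 * lambert_koebe (q ^ 5) +
      2 * (koebe_sum (q ^ 5) UNIV q + koebe_sum (q ^ 5) UNIV (q ^ 2))"
    unfolding koebe_sum_1[OF q] koebe_sum_1[OF q5] by (simp add: algebra_simps)
  hence "2 * lambert_koebe q = 2 * (lambert_koebe (q ^ 5) +
      (koebe_sum (q ^ 5) UNIV q + koebe_sum (q ^ 5) UNIV (q ^ 2)))"
    by (simp only: distrib_left)
  hence "lambert_koebe q = lambert_koebe (q ^ 5) +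
      (koebe_sum (q ^ 5) UNIV q + koebe_sum (q ^ 5) UNIV (q ^ 2))"
    by (simp only: mult_cancel_left) simp
  thus ?thesis by simp
qed

text \<open>Starting from x = q modulo q^2 selects the odd exponents, as in
  \<open>lambert_odd\<close>; modulo 6 they fall into the classes 1, 3 and 5, and 5 is paired with
  1.\<close>

lemma koebe_sum_sixth:
  "2 * koebe_sum (q ^ 6) UNIV q + koebe_sum (q ^ 6) UNIV (q ^ 3) =
     2 * lambert_koebe q - 2 * lambert_koebe (q ^ 2)"
proof -
  have q2: "q ^ 2 \<noteq> 0" "norm (q ^ 2) < 1"
    using nome_power[of 2] by auto
  have "koebe_sum (q ^ 2) UNIV q = koebe_sum (q ^ 6) UNIV q + koebe_sum (q ^ 6) UNIV (q ^ 3)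
          + koebe_sum (q ^ 6) UNIV (q ^ 5)"
    using koebe_sum_split[OF q2, of q 3] q by (simp add: eval_nat_numeral mult.assoc)
  also have "koebe_sum (q ^ 6) UNIV (q ^ 5) = koebe_sum (q ^ 6) UNIV q"
    using koebe_sum_reflect[of 1 6] by simp
  finally show ?thesis
    using koebe_sum_half[of 1] by simp
qed

lemma koebe_sum_tenth:
  "2 * koebe_sum (q ^ 10) UNIV q + 2 * koebe_sum (q ^ 10) UNIV (q ^ 3) + koebe_sum (q ^ 10) UNIV (q ^ 5) =
     2 * lambert_koebe q - 2 * lambert_koebe (q ^ 2)"
proof -
  have q2: "q ^ 2 \<noteq> 0" "norm (q ^ 2) < 1"
    using nome_power[of 2] by auto
  have "koebe_sum (q ^ 2) UNIV q = koebe_sum (q ^ 10) UNIV q + koebe_sum (q ^ 10) UNIV (q ^ 3)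
          + koebe_sum (q ^ 10) UNIV (q ^ 5) + koebe_sum (q ^ 10) UNIV (q ^ 7) + koebe_sum (q ^ 10) UNIV (q ^ 9)"
    using koebe_sum_split[OF q2, of q 5] q by (simp add: eval_nat_numeral mult.assoc)
  also have "koebe_sum (q ^ 10) UNIV (q ^ 9) = koebe_sum (q ^ 10) UNIV q"
    using koebe_sum_reflect[of 1 10] by simp
  also have "koebe_sum (q ^ 10) UNIV (q ^ 7) = koebe_sum (q ^ 10) UNIV (q ^ 3)"
    using koebe_sum_reflect[of 3 10] by simp
  finally have "2 * koebe_sum (q ^ 10) UNIV q + 2 * koebe_sum (q ^ 10) UNIV (q ^ 3) +
      koebe_sum (q ^ 10) UNIV (q ^ 5) = koebe_sum (q ^ 2) UNIV q"
    by simp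
  thus ?thesis
    using koebe_sum_half[of 1] by simp
qed

lemma koebe_sum_power_minus_1:
  assumes "k > 0"
  shows "koebe_sum (q ^ k) UNIV (-1) = -1/4 + 8 * lambert_koebe (q ^ (2 * k)) - 2 * lambert_koebe (q ^ k)"
  using koebe_sum_minus_1[of "q ^ k"] nome_power[OF assms] by (simp add: power_mult[symmetric] mult.commute)

end

text \<open>The numerator of p(x) - p(y), the multiplicative form of the Weierstrass product
  \<sigma>(u + v) \<sigma>(v - u). The prefactor x makes it antisymmetric.\<close>

definition theta_form :: "complex \<Rightarrow> complex \<Rightarrow> complex \<Rightarrow> complex" where
  "theta_form Q x y = x * theta Q (x * y) * theta Q (y / x)"

lemma koebe_sum_diff_theta_form:
  assumes "Q \<noteq> 0" "norm Q < 1" "x \<noteq> 0" "theta Q x \<noteq> 0" "y \<noteq> 0" "theta Q y \<noteq> 0"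
  shows "koebe_sum Q UNIV x - koebe_sum Q UNIV y =
           qpochhammer_inf Q Q ^ 4 * theta_form Q x y / (theta Q x * theta Q y)\<^sup>2"
  using koebe_sum_diff[OF assms] by (simp add: theta_form_def mult.assoc)

lemma theta_form_antisym:
  assumes "Q \<noteq> 0" "norm Q < 1" "x \<noteq> 0" "y \<noteq> 0"
  shows "theta_form Q x y = - theta_form Q y x"
proof -
  have "theta Q (x / y) = - theta Q (y / x) * x / y"
    using theta_inverse[of Q "y / x"] assms by simp
  thus ?thesis using assms by (simp add: theta_form_def mult.commute)
qed

text \<open>The telescoping sum (p(x) - p(y)) + (p(y) - p(z)) = p(x) - p(z), cleared of denominators
  and of the nonzero factor (Q;Q)^4.\<close>

lemma theta_three_term:
  assumes Q: "Q \<noteq> 0" "norm Q < 1"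
    and x: "x \<noteq> 0" "theta Q x \<noteq> 0" and y: "y \<noteq> 0" "theta Q y \<noteq> 0" and z: "z \<noteq> 0" "theta Q z \<noteq> 0"
  shows "theta_form Q x y * (theta Q z)\<^sup>2 + theta_form Q y z * (theta Q x)\<^sup>2 = theta_form Q x z * (theta Q y)\<^sup>2"
proof -
  define c where "c = qpochhammer_inf Q Q ^ 4"
  have c: "c \<noteq> 0" using qpochhammer_self_nonzero[OF Q] by (simp add: c_def)
  have "c * theta_form Q x y / (theta Q x * theta Q y)\<^sup>2 + c * theta_form Q y z / (theta Q y * theta Q z)\<^sup>2 =
        c * theta_form Q x z / (theta Q x * theta Q z)\<^sup>2"
    unfolding c_def koebe_sum_diff_theta_form[OF Q x y, symmetric] koebe_sum_diff_theta_form[OF Q y z, symmetric]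
      koebe_sum_diff_theta_form[OF Q x z, symmetric] by simp
  hence "c * (theta_form Q x y * (theta Q z)\<^sup>2) + c * (theta_form Q y z * (theta Q x)\<^sup>2) =
           c * (theta_form Q x z * (theta Q y)\<^sup>2)"
    using x y z c by (simp add: power_mult_distrib divide_simps) (simp add: mult.assoc)
  hence "c * (theta_form Q x y * (theta Q z)\<^sup>2 + theta_form Q y z * (theta Q x)\<^sup>2) =
           c * (theta_form Q x z * (theta Q y)\<^sup>2)"
    by (simp only: distrib_left)
  thus ?thesis using c by (simp only: mult_cancel_left) simp
qed

text \<open>The Weierstrass three-term relation: it is the Pluecker identity for differences of the
  values of one function.\<close>
lemma theta_four_term:
  assumes Q: "Q \<noteq> 0" "norm Q < 1"
    and x: "x \<noteq> 0" "theta Q x \<noteq> 0" and y: "y \<noteq> 0" "theta Q y \<noteq> 0"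
    and z: "z \<noteq> 0" "theta Q z \<noteq> 0" and w: "w \<noteq> 0" "theta Q w \<noteq> 0"
  shows "theta_form Q x y * theta_form Q z w + theta_form Q x w * theta_form Q y z =
           theta_form Q x z * theta_form Q y w"
proof -
  define c where "c = qpochhammer_inf Q Q ^ 4"
  define d where "d = (theta Q x * theta Q y * theta Q z * theta Q w)\<^sup>2"
  have cd: "c \<noteq> 0" "d \<noteq> 0"
    using qpochhammer_self_nonzero[OF Q] x y z w by (auto simp: c_def d_def)
  define K where "K = koebe_sum Q UNIV"
  have form: "theta_form Q a b = (K a - K b) * (theta Q a * theta Q b)\<^sup>2 / c"
    if "a \<noteq> 0" "theta Q a \<noteq> 0" "b \<noteq> 0" "theta Q b \<noteq> 0" for a b
    using koebe_sum_diff_theta_form[OF Q that] cd that by (simp add: K_def c_def)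
  show ?thesis
    unfolding form[OF x y] form[OF z w] form[OF x w] form[OF y z] form[OF x z] form[OF y w]
    using cd by (simp add: divide_simps power_mult_distrib) (simp add: algebra_simps)
qed

section \<open>Theta values as eta products\<close>

definition euler_prod :: "complex \<Rightarrow> nat \<Rightarrow> complex" where
  "euler_prod q n = qpochhammer_inf (q ^ n) (q ^ n)"

definition odd_prod :: "complex \<Rightarrow> nat \<Rightarrow> complex" where
  "odd_prod q n = qpochhammer_inf (q ^ n) (q ^ (2 * n))"

text \<open>For s = 1 or s = -1 this is \<open>theta (q ^ N) (s * q ^ k)\<close>, written without
  division so that it remains holomorphic at q = 0, where it equals 1 for 0 < k < N.\<close>

definition theta_pow :: "complex \<Rightarrow> nat \<Rightarrow> nat \<Rightarrow> complex \<Rightarrow> complex" where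
  "theta_pow s N k q = qpochhammer_inf (s * q ^ k) (q ^ N) * qpochhammer_inf (s * q ^ (N - k)) (q ^ N)"

context
  fixes q :: complex
  assumes q: "q \<noteq> 0" "norm q < 1"
begin

lemma euler_prod_nonzero: "n > 0 \<Longrightarrow> euler_prod q n \<noteq> 0"
  unfolding euler_prod_def using nome_power[OF q, of n] by (intro qpochhammer_self_nonzero) auto

lemma euler_prod_eq: "n > 0 \<Longrightarrow> euler_prod q n = odd_prod q n * euler_prod q (2 * n)"
  using qpochhammer_split[of "q ^ n" 2 "q ^ n"] nome_power[OF q, of n]
  by (simp add: euler_prod_def odd_prod_def numeral_2_eq_2 power_add mult_2 power_mult[symmetric])

lemma odd_prod_nonzero: "n > 0 \<Longrightarrow> odd_prod q n \<noteq> 0"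
  using euler_prod_nonzero[of n] euler_prod_eq[of n] by auto

text \<open>Euler's identity (-q;q) (q;q^2) = 1: both (q;q) (-q;q) and (q;q) divided by its odd part
  equal (q^2;q^2).\<close>

lemma qpochhammer_minus:
  assumes "n > 0"
  shows "qpochhammer_inf (- (q ^ n)) (q ^ n) = 1 / odd_prod q n"
proof -
  have "euler_prod q n * qpochhammer_inf (- (q ^ n)) (q ^ n) = euler_prod q (2 * n)"
    using qpochhammer_mult_uminus[of "q ^ n" "q ^ n"] nome_power[OF q assms]
    by (simp add: euler_prod_def power_mult[symmetric] mult.commute)
  thus ?thesis
    using euler_prod_eq[OF assms] euler_prod_nonzero[of "2 * n"] odd_prod_nonzero[OF assms] assms
    by (simp add: field_simps)
qed

lemma qpochhammer_minus_odd:
  assumes "n > 0"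
  shows "qpochhammer_inf (- (q ^ n)) (q ^ (2 * n)) = odd_prod q (2 * n) / odd_prod q n"
proof -
  have "odd_prod q n * qpochhammer_inf (- (q ^ n)) (q ^ (2 * n)) = odd_prod q (2 * n)"
    using qpochhammer_mult_uminus[of "q ^ (2 * n)" "q ^ n"] nome_power[OF q, of "2 * n"] assms
    by (simp add: odd_prod_def power_mult[symmetric] mult.commute)
  thus ?thesis using odd_prod_nonzero[OF assms] by (simp add: field_simps)
qed

lemma theta_eq_theta_pow:
  assumes "s\<^sup>2 = 1" "k \<le> N"
  shows "theta (q ^ N) (s * q ^ k) = theta_pow s N k q"
proof -
  have "s * s = 1" using assms(1) by (simp add: power2_eq_square)
  hence s: "s \<noteq> 0" "inverse s = s" by (auto simp: inverse_unique)
  have "q ^ N / (s * q ^ k) = inverse s * q ^ (N - k)"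
    using q assms(2) s(1) by (simp add: power_diff field_simps)
  thus ?thesis by (simp add: theta_def theta_pow_def s(2))
qed

lemma theta_pow_sym: "k \<le> N \<Longrightarrow> theta_pow s N (N - k) q = theta_pow s N k q"
  by (simp add: theta_pow_def mult.commute)

lemma theta_pow_nonzero:
  assumes "s = 1 \<or> s = -1" "0 < k" "k < N"
  shows "theta_pow s N k q \<noteq> 0"
  using theta_power_nonzero[OF q assms(2,3), of s] theta_eq_theta_pow[of s k N] assms by auto

lemma theta_form_pow:
  assumes "s = 1 \<or> s = -1" "t = 1 \<or> t = -1" "i < j" "i + j \<le> N"
  shows "theta_form (q ^ N) (s * q ^ i) (t * q ^ j) =
     s * q ^ i * theta_pow (s * t) N (i + j) q * theta_pow (s * t) N (j - i) q"
proof -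
  have st: "(s * t)\<^sup>2 = 1" using assms by auto
  have eq1: "(s * q ^ i) * (t * q ^ j) = (s * t) * q ^ (i + j)"
    by (simp add: power_add)
  have eq2: "(t * q ^ j) / (s * q ^ i) = (s * t) * q ^ (j - i)"
    using q assms by (auto simp: power_diff)
  have eq3: "theta (q ^ N) ((s * t) * q ^ (i + j)) = theta_pow (s * t) N (i + j) q"
    by (rule theta_eq_theta_pow[OF st assms(4)])
  have eq4: "theta (q ^ N) ((s * t) * q ^ (j - i)) = theta_pow (s * t) N (j - i) q"
    by (rule theta_eq_theta_pow[OF st]) (use assms in auto)
  show ?thesis
    by (simp only: theta_form_def eq1 eq2 eq3 eq4)
qed

lemma theta_form_pow_minus:
  assumes "s \<noteq> 0"
  shows "theta_form (q ^ N) (s * q ^ i) (- (s * q ^ i)) =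
     s * q ^ i * theta (q ^ N) (- (s\<^sup>2 * q ^ (2 * i))) * theta (q ^ N) (-1)"
proof -
  have "(s * q ^ i) * (- (s * q ^ i)) = - (s\<^sup>2 * q ^ (2 * i))"
    by (simp add: power2_eq_square power_add mult_2)
  moreover have "- (s * q ^ i) / (s * q ^ i) = -1"
    using q assms by simp
  ultimately show ?thesis by (simp only: theta_form_def)
qed

text \<open>As -1 is its own inverse, the two theta factors agree up to an elementary factor and
  merge into a square. Hence differences against p(-1) are squares of theta quotients up to a
  constant.\<close>

lemma theta_form_minus_1:
  assumes "s = 1 \<or> s = -1" "0 < i" "i < N"
  shows "theta_form (q ^ N) (s * q ^ i) (-1) = (theta_pow (-s) N i q)\<^sup>2"
proof -
  have qN: "q ^ N \<noteq> 0" "norm (q ^ N) < 1" using nome_power[OF q, of N] assms by auto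
  have "-1 / (s * q ^ i) = inverse (- s * q ^ i)" using assms(1) by (auto simp: field_simps)
  hence "theta (q ^ N) (-1 / (s * q ^ i)) = theta (q ^ N) (-s * q ^ i) / (s * q ^ i)"
    using theta_inverse[OF qN, of "-s * q ^ i"] q assms(1) by auto
  thus ?thesis
    using theta_eq_theta_pow[of "-s" i N] assms q by (auto simp: theta_form_def power2_eq_square)
qed

lemma theta_minus_1: "N > 0 \<Longrightarrow> theta (q ^ N) (-1) = 2 / (odd_prod q N)\<^sup>2"
  using qpochhammer_rec[of "q ^ N" "-1"] nome_power[OF q, of N] qpochhammer_minus[of N]
  by (simp add: theta_def power2_eq_square)

lemma theta_pow_half: "k > 0 \<Longrightarrow> theta_pow 1 (2 * k) k q = (odd_prod q k)\<^sup>2"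
  by (simp add: theta_pow_def odd_prod_def power2_eq_square)

lemma theta_pow_half_minus: "k > 0 \<Longrightarrow> theta_pow (-1) (2 * k) k q = (odd_prod q (2 * k) / odd_prod q k)\<^sup>2"
  using qpochhammer_minus_odd[of k] by (simp add: theta_pow_def power2_eq_square)

lemma theta_pow_3: "theta_pow 1 3 1 q = euler_prod q 1 / euler_prod q 3"
  using qpochhammer_split[of q 3 q] q euler_prod_nonzero[of 3]
  by (simp add: euler_prod_def theta_pow_def eval_nat_numeral mult.assoc)

lemma theta_pow_3_minus: "theta_pow (-1) 3 1 q = odd_prod q 3 / odd_prod q 1"
proof -
  have "qpochhammer_inf (-q) q = theta_pow (-1) 3 1 q * qpochhammer_inf (- (q ^ 3)) (q ^ 3)"
    using qpochhammer_split[of q 3 "-q"] q by (simp add: theta_pow_def eval_nat_numeral mult.assoc)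
  thus ?thesis
    using qpochhammer_minus[of 1] qpochhammer_minus[of 3] odd_prod_nonzero[of 1] odd_prod_nonzero[of 3]
    by (simp add: field_simps)
qed

lemma theta_pow_6: "theta_pow 1 6 1 q = odd_prod q 1 / odd_prod q 3"
proof -
  have "odd_prod q 1 = theta_pow 1 6 1 q * odd_prod q 3"
    using qpochhammer_split[of "q ^ 2" 3 q] nome_power[OF q, of 2]
    by (simp add: odd_prod_def theta_pow_def eval_nat_numeral mult.assoc mult.left_commute mult.commute)
  thus ?thesis using odd_prod_nonzero[of 3] by simp
qed

text \<open>The separate factors are the reciprocals of the Rogers-Ramanujan functions; only their
  product is an eta quotient. For the other pairs of level 5 and 10, too, only products are
  evaluated, which dictates the theta relations usable there.\<close>

lemma theta_pow_5: "theta_pow 1 5 1 q * theta_pow 1 5 2 q = euler_prod q 1 / euler_prod q 5"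
  using qpochhammer_split[of q 5 q] q euler_prod_nonzero[of 5]
  by (simp add: euler_prod_def theta_pow_def eval_nat_numeral mult.assoc mult.left_commute mult.commute)

lemma theta_pow_5_minus: "theta_pow (-1) 5 1 q * theta_pow (-1) 5 2 q = odd_prod q 5 / odd_prod q 1"
proof -
  have "qpochhammer_inf (-q) q = theta_pow (-1) 5 1 q * theta_pow (-1) 5 2 q * qpochhammer_inf (- (q ^ 5)) (q ^ 5)"
    using qpochhammer_split[of q 5 "-q"] q
    by (simp add: theta_pow_def eval_nat_numeral mult.assoc mult.left_commute mult.commute)
  thus ?thesis
    using qpochhammer_minus[of 1] qpochhammer_minus[of 5] odd_prod_nonzero[of 1] odd_prod_nonzero[of 5]
    by (simp add: field_simps)
qed

lemma theta_pow_10: "theta_pow 1 10 1 q * theta_pow 1 10 3 q = odd_prod q 1 / odd_prod q 5"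
proof -
  have "odd_prod q 1 = theta_pow 1 10 1 q * theta_pow 1 10 3 q * odd_prod q 5"
    using qpochhammer_split[of "q ^ 2" 5 q] nome_power[OF q, of 2]
    by (simp add: odd_prod_def theta_pow_def eval_nat_numeral mult.assoc mult.left_commute mult.commute)
  thus ?thesis using odd_prod_nonzero[of 5] by simp
qed

end

lemma theta_pow_power: "theta_pow s N k (q ^ m) = theta_pow s (m * N) (m * k) q"
  by (simp add: theta_pow_def power_mult diff_mult_distrib2[symmetric])

lemma euler_prod_power: "euler_prod (q ^ m) n = euler_prod q (m * n)"
  by (simp add: euler_prod_def power_mult)

lemma odd_prod_power: "odd_prod (q ^ m) n = odd_prod q (m * n)"
  by (simp add: odd_prod_def power_mult mult.left_commute[of 2])

section \<open>Levels 4, 6, 10 and 20 as relations between eta products\<close>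

definition psi_prod :: "complex \<Rightarrow> nat \<Rightarrow> complex" where
  "psi_prod q n = euler_prod q (2 * n) / odd_prod q n"

text \<open>Field algebra kept apart from the infinite products. In the application \<open>a\<close>
  = (q;q^2), \<open>b\<close> = (q^3;q^6), \<open>E\<close> = (q^6;q^6) and \<open>m * E\<close> =
  (q^2;q^2), so X = \<psi>(q)^4 and Y = q \<psi>(q^3)^4. \<open>R1\<close> evaluates X - Y, and
  \<open>R2\<close> turns this into X - 9 Y.\<close>

lemma level_6_algebra:
  fixes a b m q E X Y :: complex
  assumes nz: "a \<noteq> 0" "b \<noteq> 0"
    and R1: "m ^ 4 * b ^ 4 = a * b ^ 9 + q * a ^ 4"
    and R2: "b ^ 9 = a ^ 8 * b * m ^ 4 + 8 * q * a ^ 3"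
    and X: "X = (m * E / a) ^ 4" and Y: "Y = q * (E / b) ^ 4"
  shows "(X - Y) * (X - 9 * Y) = E ^ 4 * a ^ 6 * b\<^sup>2 * X"
proof -
  have "a ^ 4 * b ^ 4 * (X - Y) = E ^ 4 * (m ^ 4 * b ^ 4 - q * a ^ 4)"
    using nz by (simp add: X Y field_simps)
  also have "\<dots> = a ^ 4 * b ^ 4 * (E ^ 4 * b ^ 5 / a ^ 3)"
    unfolding R1 using nz by (simp add: field_simps eval_nat_numeral)
  finally have XY: "X - Y = E ^ 4 * b ^ 5 / a ^ 3"
    by (simp only: mult_cancel_left) (use nz in simp)
  have aX: "a ^ 4 * X = m ^ 4 * E ^ 4" using nz by (simp add: X field_simps)
  have bY: "b ^ 4 * Y = q * E ^ 4" using nz by (simp add: Y field_simps)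
  have "b ^ 9 * (X - 9 * Y) * a ^ 4 = b ^ 9 * (X - Y) * a ^ 4 - 8 * a ^ 4 * b ^ 5 * (b ^ 4 * Y)"
    by (simp add: algebra_simps flip: power_add)
  also have "b ^ 9 * (X - Y) * a ^ 4 = E ^ 4 * b ^ 14 * a"
    unfolding XY using nz by (simp add: field_simps eval_nat_numeral)
  also have "E ^ 4 * b ^ 14 * a - 8 * a ^ 4 * b ^ 5 * (b ^ 4 * Y) = E ^ 4 * a * b ^ 5 * (b ^ 9 - 8 * q * a ^ 3)"
    unfolding bY by (simp add: algebra_simps eval_nat_numeral)
  also have "b ^ 9 - 8 * q * a ^ 3 = a ^ 8 * b * m ^ 4"
    using R2 by simp
  also have "E ^ 4 * a * b ^ 5 * (a ^ 8 * b * m ^ 4) = a ^ 9 * b ^ 6 * (a ^ 4 * X)"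
    unfolding aX by (simp add: algebra_simps eval_nat_numeral)
  finally have "a ^ 4 * b ^ 6 * (b ^ 3 * (X - 9 * Y)) = a ^ 4 * b ^ 6 * (a ^ 9 * X)"
    by (simp add: algebra_simps flip: power_add)
  hence "b ^ 3 * (X - 9 * Y) = a ^ 9 * X"
    by (simp only: mult_cancel_left) (use nz in simp)
  hence X9: "X - 9 * Y = a ^ 9 * X / b ^ 3" using nz by (simp add: field_simps)
  show ?thesis
    unfolding XY X9 using nz by (simp add: field_simps eval_nat_numeral)
qed

text \<open>The analogue for 5 with squares in place of fourth powers: X = \<psi>(q)^2 and Y = q
  \<psi>(q^5)^2, \<open>R1\<close> evaluates X - Y, and \<open>R2\<close> turns this into X - 5
  Y.\<close>

lemma level_10_algebra:
  fixes u v m q E X Y :: complex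
  assumes nz: "u \<noteq> 0" "v \<noteq> 0"
    and R1: "m\<^sup>2 * v\<^sup>2 = q * u\<^sup>2 + v ^ 5 * u"
    and R2: "v ^ 5 = u ^ 4 * m\<^sup>2 * v + 4 * q * u"
    and X: "X = (m * E / u)\<^sup>2" and Y: "Y = q * (E / v)\<^sup>2"
  shows "X - Y = E\<^sup>2 * v ^ 3 / u" "X - 5 * Y = u ^ 5 * X / v"
proof -
  have "u\<^sup>2 * v\<^sup>2 * (X - Y) = E\<^sup>2 * (m\<^sup>2 * v\<^sup>2 - q * u\<^sup>2)"
    using nz by (simp add: X Y field_simps)
  also have "\<dots> = u\<^sup>2 * v\<^sup>2 * (E\<^sup>2 * v ^ 3 / u)"
    unfolding R1 using nz by (simp add: field_simps eval_nat_numeral)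
  finally show XY: "X - Y = E\<^sup>2 * v ^ 3 / u"
    by (simp only: mult_cancel_left) (use nz in simp)
  have uX: "u\<^sup>2 * X = m\<^sup>2 * E\<^sup>2" using nz by (simp add: X field_simps)
  have vY: "v\<^sup>2 * Y = q * E\<^sup>2" using nz by (simp add: Y field_simps)
  have "u\<^sup>2 * v\<^sup>2 * (X - 5 * Y) = u\<^sup>2 * v\<^sup>2 * (X - Y) - 4 * u\<^sup>2 * (v\<^sup>2 * Y)"
    by (simp add: algebra_simps)
  also have "\<dots> = E\<^sup>2 * u * (v ^ 5 - 4 * q * u)"
    unfolding vY XY using nz by (simp add: field_simps eval_nat_numeral)
  also have "v ^ 5 - 4 * q * u = u ^ 4 * m\<^sup>2 * v" using R2 by simp
  also have "E\<^sup>2 * u * (u ^ 4 * m\<^sup>2 * v) = u ^ 5 * v * (u\<^sup>2 * X)"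
    unfolding uX by (simp add: algebra_simps eval_nat_numeral)
  finally have "u\<^sup>2 * v * (v * (X - 5 * Y)) = u\<^sup>2 * v * (u ^ 5 * X)"
    by (simp add: algebra_simps power2_eq_square)
  hence "v * (X - 5 * Y) = u ^ 5 * X"
    by (simp only: mult_cancel_left) (use nz in simp)
  thus "X - 5 * Y = u ^ 5 * X / v" using nz by (simp add: field_simps)
qed

text \<open>The Lambert combination over odd exponents divided by q: one summand each for the points
  q and q^3, compared with q^5 modulo q^10. In this form it is holomorphic on the disc with value 1
  at q = 0.\<close>

definition level_10_odd :: "complex \<Rightarrow> complex" where
  "level_10_odd q = euler_prod q 10 ^ 4 *
     ((theta_pow 1 10 4 q / (theta_pow 1 10 1 q * theta_pow 1 10 5 q))\<^sup>2
      + q\<^sup>2 * (theta_pow 1 10 2 q / (theta_pow 1 10 3 q * theta_pow 1 10 5 q))\<^sup>2)"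

text \<open>The corresponding sum for -q and -q^2, compared with -1 modulo q^5. The factor 1/4 comes
  from the 2 in \<open>theta_minus_1\<close>; the value at q = 0 is 1/2.\<close>

definition level_10_even :: "complex \<Rightarrow> complex" where
  "level_10_even q = euler_prod q 5 ^ 4 * odd_prod q 5 ^ 4 / 4 *
     ((theta_pow 1 5 1 q / theta_pow (-1) 5 1 q)\<^sup>2 + (theta_pow 1 5 2 q / theta_pow (-1) 5 2 q)\<^sup>2)"

context
  fixes q :: complex
  assumes q: "q \<noteq> 0" "norm q < 1"
begin

lemma psi_prod_nonzero: "n > 0 \<Longrightarrow> psi_prod q n \<noteq> 0"
  using euler_prod_nonzero[OF q] odd_prod_nonzero[OF q] by (simp add: psi_prod_def)

lemma koebe_sum_pow_diff:
  assumes "s = 1 \<or> s = -1" "t = 1 \<or> t = -1" "0 < i" "i < j" "i + j \<le> N"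
  shows "koebe_sum (q ^ N) UNIV (s * q ^ i) - koebe_sum (q ^ N) UNIV (t * q ^ j) =
     euler_prod q N ^ 4 * (s * q ^ i * theta_pow (s * t) N (i + j) q * theta_pow (s * t) N (j - i) q)
       / (theta_pow s N i q * theta_pow t N j q)\<^sup>2"
proof -
  have qN: "q ^ N \<noteq> 0" "norm (q ^ N) < 1" using nome_power[OF q, of N] assms by auto
  have s: "s\<^sup>2 = 1" "t\<^sup>2 = 1" "s \<noteq> 0" "t \<noteq> 0" using assms by auto
  have "theta (q ^ N) (s * q ^ i) = theta_pow s N i q" "theta (q ^ N) (t * q ^ j) = theta_pow t N j q"
    using theta_eq_theta_pow[OF q] assms s by auto
  moreover have "theta_pow s N i q \<noteq> 0" "theta_pow t N j q \<noteq> 0"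
    using theta_pow_nonzero[OF q] assms by auto
  ultimately show ?thesis
    using koebe_sum_diff_theta_form[OF qN, of "s * q ^ i" "t * q ^ j"] q s
      theta_form_pow[OF q assms(1,2,4,5)]
    by (simp add: euler_prod_def)
qed

lemma koebe_sum_pow_diff_minus_1:
  assumes "s = 1 \<or> s = -1" "0 < i" "i < N"
  shows "koebe_sum (q ^ N) UNIV (s * q ^ i) - koebe_sum (q ^ N) UNIV (-1) =
     euler_prod q N ^ 4 * odd_prod q N ^ 4 / 4 * (theta_pow (-s) N i q / theta_pow s N i q)\<^sup>2"
proof -
  have qN: "q ^ N \<noteq> 0" "norm (q ^ N) < 1" using nome_power[OF q, of N] assms by auto
  have s: "s\<^sup>2 = 1" "s \<noteq> 0" using assms by auto
  have 1: "theta (q ^ N) (s * q ^ i) = theta_pow s N i q"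
    using theta_eq_theta_pow[OF q] assms s by auto
  have 2: "theta (q ^ N) (-1) = 2 / (odd_prod q N)\<^sup>2"
    using theta_minus_1[OF q] assms by auto
  have nz: "theta_pow s N i q \<noteq> 0" "odd_prod q N \<noteq> 0"
    using theta_pow_nonzero[OF q] odd_prod_nonzero[OF q] assms by auto
  have "koebe_sum (q ^ N) UNIV (s * q ^ i) - koebe_sum (q ^ N) UNIV (-1) =
     euler_prod q N ^ 4 * (theta_pow (-s) N i q)\<^sup>2 / (theta_pow s N i q * (2 / (odd_prod q N)\<^sup>2))\<^sup>2"
    using koebe_sum_diff_theta_form[OF qN, of "s * q ^ i" "-1"] q s nz 1 2
      theta_form_minus_1[OF q assms]
    by (simp add: euler_prod_def)
  also have "\<dots> = euler_prod q N ^ 4 * odd_prod q N ^ 4 / 4 * (theta_pow (-s) N i q / theta_pow s N i q)\<^sup>2"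
    using nz by (simp add: field_simps eval_nat_numeral)
  finally show ?thesis .
qed

text \<open>Modulo q^2 the points q, -q and -1 are the three half periods, so level 4 rests on the
  classical differences e_i - e_j, which are fourth powers of theta constants up to a
  factor.\<close>

lemma level_4_diff:
  "koebe_sum (q\<^sup>2) UNIV q - koebe_sum (q\<^sup>2) UNIV (-q) = 4 * (q * psi_prod q 2 ^ 4)"
proof -
  have q2: "q\<^sup>2 \<noteq> 0" "norm (q\<^sup>2) < 1" using nome_power[OF q, of 2] by auto
  note nz = odd_prod_nonzero[OF q, of 1] odd_prod_nonzero[OF q, of 2] euler_prod_nonzero[OF q, of 4]
  have 1: "theta (q\<^sup>2) q = (odd_prod q 1)\<^sup>2"
    using theta_eq_theta_pow[OF q, of 1 1 2] theta_pow_half[OF q, of 1] by simp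
  have 2: "theta (q\<^sup>2) (-q) = (odd_prod q 2 / odd_prod q 1)\<^sup>2"
    using theta_eq_theta_pow[OF q, of "-1" 1 2] theta_pow_half_minus[OF q, of 1] by simp
  have 3: "theta (q\<^sup>2) (-1) = 2 / (odd_prod q 2)\<^sup>2"
    using theta_minus_1[OF q, of 2] by simp
  have 4: "theta (q\<^sup>2) (- q\<^sup>2) = 2 / (odd_prod q 2)\<^sup>2"
    using theta_reflect[OF q2, of "-1"] 3 by simp
  have "theta_form (q\<^sup>2) q (-q) = q * (2 / (odd_prod q 2)\<^sup>2) * (2 / (odd_prod q 2)\<^sup>2)"
    using theta_form_pow_minus[OF q, of 1 2 1] 3 4 by simp
  hence "koebe_sum (q\<^sup>2) UNIV q - koebe_sum (q\<^sup>2) UNIV (-q) =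
      euler_prod q 2 ^ 4 * (q * (2 / (odd_prod q 2)\<^sup>2) * (2 / (odd_prod q 2)\<^sup>2)) /
      ((odd_prod q 1)\<^sup>2 * (odd_prod q 2 / odd_prod q 1)\<^sup>2)\<^sup>2"
    using koebe_sum_diff_theta_form[OF q2, of q "-q"] q 1 2 nz by (simp add: euler_prod_def)
  also have "\<dots> = 4 * (q * psi_prod q 2 ^ 4)"
    using nz euler_prod_eq[OF q, of 2] by (simp add: psi_prod_def field_simps eval_nat_numeral)
  finally show ?thesis .
qed

text \<open>\<open>level_4_diff\<close> gives the difference of the values at q and -q, duplication
  gives their sum; eliminating the value at -q leaves Lambert series only.\<close>

lemma level_4_odd:
  "lambert_koebe q - 3 * lambert_koebe (q\<^sup>2) + 2 * lambert_koebe (q ^ 4) = q * psi_prod q 2 ^ 4"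
proof -
  have "koebe_sum (q\<^sup>2) UNIV q = 2 * lambert_koebe q - 2 * lambert_koebe (q\<^sup>2)"
    using koebe_sum_half[OF q, of 1] by simp
  moreover have "koebe_sum (q\<^sup>2) UNIV q + koebe_sum (q\<^sup>2) UNIV (-q) =
      4 * (2 * lambert_koebe (q\<^sup>2) - 2 * lambert_koebe (q ^ 4))"
    using koebe_sum_power_add_uminus[OF q, of 1 2] koebe_sum_half[OF q, of 2] by simp
  ultimately have "4 * (lambert_koebe q - 3 * lambert_koebe (q\<^sup>2) + 2 * lambert_koebe (q ^ 4)) =
      4 * (q * psi_prod q 2 ^ 4)"
    using level_4_diff by algebra
  thus ?thesis by (simp only: mult_cancel_left) simp
qed

text \<open>The quotient is \<phi>(q)^4 for Ramanujan's \<phi>(q) = \<Sum> q^(n^2), in product form,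
  as \<psi>(q)^2 = \<phi>(q) \<psi>(q^2).\<close>

lemma level_4_phi:
  "psi_prod q 1 ^ 8 / psi_prod q 2 ^ 4 = euler_prod q 2 ^ 4 * odd_prod q 2 ^ 8 / odd_prod q 1 ^ 8"
  using euler_prod_eq[OF q, of 2] odd_prod_nonzero[OF q, of 1] odd_prod_nonzero[OF q, of 2]
    euler_prod_nonzero[OF q, of 4]
  by (simp add: psi_prod_def field_simps eval_nat_numeral)

lemma level_4_all:
  "lambert_koebe q - 4 * lambert_koebe (q ^ 4) = 1 / 8 * (psi_prod q 1 ^ 8 / psi_prod q 2 ^ 4 - 1)"
proof -
  have 1: "koebe_sum (q\<^sup>2) UNIV q = 2 * lambert_koebe q - 2 * lambert_koebe (q\<^sup>2)"
    using koebe_sum_half[OF q, of 1] by simp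
  have 2: "koebe_sum (q\<^sup>2) UNIV (-1) = -1/4 + 8 * lambert_koebe (q ^ 4) - 2 * lambert_koebe (q\<^sup>2)"
    using koebe_sum_power_minus_1[OF q, of 2] by simp
  have "koebe_sum (q\<^sup>2) UNIV q - koebe_sum (q\<^sup>2) UNIV (-1) =
      euler_prod q 2 ^ 4 * odd_prod q 2 ^ 4 / 4 * ((odd_prod q 2 / odd_prod q 1)\<^sup>2 / (odd_prod q 1)\<^sup>2)\<^sup>2"
    using koebe_sum_pow_diff_minus_1[of 1 1 2] theta_pow_half[OF q, of 1] theta_pow_half_minus[OF q, of 1] by simp
  also have "\<dots> = (psi_prod q 1 ^ 8 / psi_prod q 2 ^ 4) / 4"
    unfolding level_4_phi using odd_prod_nonzero[OF q, of 1] by (simp add: field_simps eval_nat_numeral)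
  finally have "8 * (lambert_koebe q - 4 * lambert_koebe (q ^ 4)) = psi_prod q 1 ^ 8 / psi_prod q 2 ^ 4 - 1"
    unfolding 1 2 by (simp add: field_simps)
  thus ?thesis by (simp add: field_simps)
qed

text \<open>Jacobi's quartic identity \<phi>(q)^4 - 16 q \<psi>(q^2)^4 = \<phi>(-q)^4, as the
  trivial relation between three half-period differences. Level 20 uses it at q^5.\<close>

lemma level_4_jacobi:
  "psi_prod q 1 ^ 8 / psi_prod q 2 ^ 4 - 16 * q * psi_prod q 2 ^ 4 = odd_prod q 1 ^ 8 * euler_prod q 2 ^ 4"
proof -
  note nz = odd_prod_nonzero[OF q, of 1] odd_prod_nonzero[OF q, of 2]
  have a: "koebe_sum (q\<^sup>2) UNIV q - koebe_sum (q\<^sup>2) UNIV (-1) =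
      euler_prod q 2 ^ 4 * odd_prod q 2 ^ 4 / 4 * ((odd_prod q 2 / odd_prod q 1)\<^sup>2 / (odd_prod q 1)\<^sup>2)\<^sup>2"
    using koebe_sum_pow_diff_minus_1[of 1 1 2] theta_pow_half[OF q, of 1] theta_pow_half_minus[OF q, of 1] by simp
  have b: "koebe_sum (q\<^sup>2) UNIV (-q) - koebe_sum (q\<^sup>2) UNIV (-1) =
      euler_prod q 2 ^ 4 * odd_prod q 2 ^ 4 / 4 * ((odd_prod q 1)\<^sup>2 / (odd_prod q 2 / odd_prod q 1)\<^sup>2)\<^sup>2"
    using koebe_sum_pow_diff_minus_1[of "-1" 1 2] theta_pow_half[OF q, of 1] theta_pow_half_minus[OF q, of 1] by simp
  have "4 * (koebe_sum (q\<^sup>2) UNIV q - koebe_sum (q\<^sup>2) UNIV (-1)) = psi_prod q 1 ^ 8 / psi_prod q 2 ^ 4"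
    unfolding level_4_phi a using nz by (simp add: field_simps eval_nat_numeral)
  moreover have "4 * (koebe_sum (q\<^sup>2) UNIV (-q) - koebe_sum (q\<^sup>2) UNIV (-1)) = odd_prod q 1 ^ 8 * euler_prod q 2 ^ 4"
    unfolding b using nz by (simp add: field_simps eval_nat_numeral)
  ultimately show ?thesis using level_4_diff by algebra
qed

section \<open>Level 6\<close>

lemma level_6_values:
  "theta_pow 1 6 2 q = euler_prod q 2 / euler_prod q 6"
  "theta_pow 1 6 4 q = euler_prod q 2 / euler_prod q 6"
  "theta_pow 1 6 3 q = (odd_prod q 3)\<^sup>2"
  "theta_pow 1 6 5 q = odd_prod q 1 / odd_prod q 3"
proof -
  show t2: "theta_pow 1 6 2 q = euler_prod q 2 / euler_prod q 6"
    using theta_pow_3[of "q ^ 2"] nome_power[OF q, of 2] theta_pow_power[of 1 3 1 q 2]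
      euler_prod_power[of q 2 1] euler_prod_power[of q 2 3] by simp
  show "theta_pow 1 6 4 q = euler_prod q 2 / euler_prod q 6"
    using theta_pow_sym[OF q, of 2 6 1] t2 by simp
  show "theta_pow 1 6 3 q = (odd_prod q 3)\<^sup>2" using theta_pow_half[OF q, of 3] by simp
  show "theta_pow 1 6 5 q = odd_prod q 1 / odd_prod q 3"
    using theta_pow_sym[OF q, of 1 6 1] theta_pow_6[OF q] by simp
qed

text \<open>Subtracting three times the value at q^3 from the sum over the odd classes modulo 6
  leaves twice the single difference p(q) - p(q^3), which is a product.\<close>

lemma level_6_odd:
  "lambert_koebe q - lambert_koebe (q ^ 2) - 3 * lambert_koebe (q ^ 3) + 3 * lambert_koebe (q ^ 6) =
     q * (psi_prod q 1)\<^sup>2 * (psi_prod q 3)\<^sup>2"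
proof -
  note nz = odd_prod_nonzero[OF q, of 1] odd_prod_nonzero[OF q, of 3] euler_prod_nonzero[OF q, of 6]
  note t1 = theta_pow_6[OF q]
  have "koebe_sum (q ^ 6) UNIV q - koebe_sum (q ^ 6) UNIV (q ^ 3) =
     euler_prod q 6 ^ 4 * (q * theta_pow 1 6 4 q * theta_pow 1 6 2 q)
       / (theta_pow 1 6 1 q * theta_pow 1 6 3 q)\<^sup>2"
    using koebe_sum_pow_diff[of 1 1 1 3 6] by simp
  also have "\<dots> = q * (psi_prod q 1)\<^sup>2 * (psi_prod q 3)\<^sup>2"
    unfolding level_6_values t1 using nz by (simp add: psi_prod_def field_simps eval_nat_numeral)
  finally have d: "koebe_sum (q ^ 6) UNIV q - koebe_sum (q ^ 6) UNIV (q ^ 3) = q * (psi_prod q 1)\<^sup>2 * (psi_prod q 3)\<^sup>2" .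
  have "koebe_sum (q ^ 6) UNIV (q ^ 3) = 2 * lambert_koebe (q ^ 3) - 2 * lambert_koebe (q ^ 6)"
    using koebe_sum_half[OF q, of 3] by simp
  hence "2 * (lambert_koebe q - lambert_koebe (q ^ 2) - 3 * lambert_koebe (q ^ 3) + 3 * lambert_koebe (q ^ 6)) =
     2 * (q * (psi_prod q 1)\<^sup>2 * (psi_prod q 3)\<^sup>2)"
    using koebe_sum_sixth[OF q] d by algebra
  thus ?thesis by (simp only: mult_cancel_left) simp
qed

end

context
  fixes q :: complex
  assumes q: "q \<noteq> 0" "norm q < 1"
begin

text \<open>Two instances of the three-term relation, at q, q^2, q^3 modulo q^6 and at q, -q, -1
  modulo q^3. All theta values there are eta quotients, so both become polynomial relations.\<close>

lemma level_6_relations: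
  defines "a \<equiv> odd_prod q 1" and "b \<equiv> odd_prod q 3" and "m \<equiv> euler_prod q 2 / euler_prod q 6"
  shows "m ^ 4 * b ^ 4 = a * b ^ 9 + q * a ^ 4" "b ^ 9 = a ^ 8 * b * m ^ 4 + 8 * q * a ^ 3"
proof -
  have nz: "a \<noteq> 0" "b \<noteq> 0" "euler_prod q 6 \<noteq> 0"
    using odd_prod_nonzero[OF q, of 1] odd_prod_nonzero[OF q, of 3] euler_prod_nonzero[OF q, of 6]
    by (auto simp: a_def b_def)
  have q6: "q ^ 6 \<noteq> 0" "norm (q ^ 6) < 1" using nome_power[OF q, of 6] by auto
  have a': "odd_prod q (Suc 0) = a" by (simp add: a_def)
  have t1: "theta_pow 1 6 1 q = a / b" using theta_pow_6[OF q] by (simp add: a_def b_def)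
  have th: "theta (q ^ 6) (q ^ k) = theta_pow 1 6 k q" if "k \<le> 6" for k
    using theta_eq_theta_pow[OF q, of 1 k 6] that by simp
  have thnz: "theta (q ^ 6) (q ^ k) \<noteq> 0" if "0 < k" "k < 6" for k
    using theta_power_nonzero[OF q, of k 6 1] that by simp
  have form: "theta_form (q ^ 6) (q ^ i) (q ^ j) = q ^ i * theta_pow 1 6 (i + j) q * theta_pow 1 6 (j - i) q"
    if "i < j" "i + j \<le> 6" for i j
    using theta_form_pow[OF q, of 1 1 i j 6] that by simp
  have "theta_form (q ^ 6) (q ^ 1) (q ^ 2) * (theta (q ^ 6) (q ^ 3))\<^sup>2 +
        theta_form (q ^ 6) (q ^ 2) (q ^ 3) * (theta (q ^ 6) (q ^ 1))\<^sup>2 =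
        theta_form (q ^ 6) (q ^ 1) (q ^ 3) * (theta (q ^ 6) (q ^ 2))\<^sup>2"
    by (rule theta_three_term[OF q6]; (rule thnz)?) (use q in auto)
  hence "q * (b\<^sup>2 * (a / b)) * (b\<^sup>2)\<^sup>2 + q\<^sup>2 * ((a / b) * (a / b)) * (a / b)\<^sup>2 = q * (m * m) * m\<^sup>2"
    using form[of 1 2] form[of 2 3] form[of 1 3] th[of 1] th[of 2] th[of 3] t1 level_6_values[OF q]
    by (simp add: a' b_def[symmetric] m_def[symmetric] mult.assoc numeral_3_eq_3[symmetric])
  hence "q * (m ^ 4 * b ^ 4) = q * (a * b ^ 9 + q * a ^ 4)"
    using nz by (simp add: field_simps eval_nat_numeral)
  thus R1: "m ^ 4 * b ^ 4 = a * b ^ 9 + q * a ^ 4"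
    by (simp only: mult_cancel_left) (use q in simp)
  have q3: "q ^ 3 \<noteq> 0" "norm (q ^ 3) < 1" using nome_power[OF q, of 3] by auto
  have s1: "theta (q ^ 3) q = a * m / b"
    using theta_eq_theta_pow[OF q, of 1 1 3] theta_pow_3[OF q] euler_prod_eq[OF q, of 1] euler_prod_eq[OF q, of 3] nz
    by (simp add: a_def b_def m_def)
  have s1': "theta_pow 1 3 1 q = a * m / b"
    using theta_eq_theta_pow[OF q, of 1 1 3] s1 by simp
  have u1: "theta (q ^ 3) (-q) = b / a" "theta_pow (-1) 3 1 q = b / a"
    using theta_eq_theta_pow[OF q, of "-1" 1 3] theta_pow_3_minus[OF q] by (simp_all add: a_def b_def)
  have u0: "theta (q ^ 3) (-1) = 2 / b\<^sup>2"
    using theta_minus_1[OF q, of 3] by (simp add: b_def)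
  have u2: "theta (q ^ 3) (- q\<^sup>2) = b / a"
    using theta_eq_theta_pow[OF q, of "-1" 2 3] theta_pow_sym[OF q, of 1 3 "-1"] u1 by simp
  have "m \<noteq> 0"
    using euler_prod_nonzero[OF q, of 2] nz by (simp add: m_def)
  hence "theta_form (q ^ 3) q (-q) * (theta (q ^ 3) (-1))\<^sup>2 +
        theta_form (q ^ 3) (-q) (-1) * (theta (q ^ 3) q)\<^sup>2 =
        theta_form (q ^ 3) q (-1) * (theta (q ^ 3) (-q))\<^sup>2"
    using q nz by (intro theta_three_term[OF q3]) (auto simp: s1 u1 u0)
  moreover have "theta_form (q ^ 3) q (-q) = q * (b / a) * (2 / b\<^sup>2)"
    using theta_form_pow_minus[OF q, of 1 3 1] u2 u0 by simp
  moreover have "theta_form (q ^ 3) (-q) (-1) = (a * m / b)\<^sup>2"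
    using theta_form_minus_1[OF q, of "-1" 1 3] s1' by simp
  moreover have "theta_form (q ^ 3) q (-1) = (b / a)\<^sup>2"
    using theta_form_minus_1[OF q, of "1" 1 3] u1 by simp
  ultimately have "q * (b / a) * (2 / b\<^sup>2) * (2 / b\<^sup>2)\<^sup>2 + (a * m / b)\<^sup>2 * (a * m / b)\<^sup>2 = (b / a)\<^sup>2 * (b / a)\<^sup>2"
    by (simp only: s1 u1 u0)
  hence "a ^ 4 * b ^ 5 * (q * (b / a) * (2 / b\<^sup>2) * (2 / b\<^sup>2)\<^sup>2 + (a * m / b)\<^sup>2 * (a * m / b)\<^sup>2) =
    a ^ 4 * b ^ 5 * ((b / a)\<^sup>2 * (b / a)\<^sup>2)"
    by simp
  moreover have "a ^ 4 * b ^ 5 * (q * (b / a) * (2 / b\<^sup>2) * (2 / b\<^sup>2)\<^sup>2 + (a * m / b)\<^sup>2 * (a * m / b)\<^sup>2) =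
      a ^ 8 * b * m ^ 4 + 8 * q * a ^ 3"
    using nz by (simp add: field_simps eval_nat_numeral)
  moreover have "a ^ 4 * b ^ 5 * ((b / a)\<^sup>2 * (b / a)\<^sup>2) = b ^ 9"
    using nz by (simp add: field_simps eval_nat_numeral)
  ultimately show "b ^ 9 = a ^ 8 * b * m ^ 4 + 8 * q * a ^ 3"
    by metis
qed

lemma level_6_factors:
  "(psi_prod q 1 ^ 4 - q * psi_prod q 3 ^ 4) * (psi_prod q 1 ^ 4 - 9 * (q * psi_prod q 3 ^ 4)) =
     euler_prod q 6 ^ 4 * odd_prod q 1 ^ 6 * (odd_prod q 3)\<^sup>2 * psi_prod q 1 ^ 4"
proof (rule level_6_algebra[OF _ _ level_6_relations])
  show "psi_prod q 1 ^ 4 = (euler_prod q 2 / euler_prod q 6 * euler_prod q 6 / odd_prod q 1) ^ 4"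
    using euler_prod_nonzero[OF q, of 6] by (simp add: psi_prod_def)
  show "q * psi_prod q 3 ^ 4 = q * (euler_prod q 6 / odd_prod q 3) ^ 4"
    by (simp add: psi_prod_def)
qed (use odd_prod_nonzero[OF q] in auto)

text \<open>One factor of \<open>level_6_factors\<close> by itself. With q^3 in place of q it meets
  the 3-dissection of \<psi> at level 18.\<close>

lemma level_6_cube:
  "psi_prod q 1 ^ 4 - q * psi_prod q 3 ^ 4 = euler_prod q 6 ^ 4 * odd_prod q 3 ^ 5 / odd_prod q 1 ^ 3"
proof -
  note nz = odd_prod_nonzero[OF q, of 1] odd_prod_nonzero[OF q, of 3] euler_prod_nonzero[OF q, of 6]
  define a b m E where abm: "a = odd_prod q 1" "b = odd_prod q 3" "m = euler_prod q 2 / euler_prod q 6" "E = euler_prod q 6"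
  have nz: "a \<noteq> 0" "b \<noteq> 0" "E \<noteq> 0"
    using nz by (auto simp: abm)
  have R1: "m ^ 4 * b ^ 4 = a * b ^ 9 + q * a ^ 4"
    using level_6_relations(1) unfolding abm .
  have psi: "psi_prod q 1 = m * E / a" "psi_prod q 3 = E / b"
    using nz by (simp_all add: psi_prod_def abm)
  have "a ^ 4 * b ^ 4 * (psi_prod q 1 ^ 4 - q * psi_prod q 3 ^ 4) = E ^ 4 * (m ^ 4 * b ^ 4 - q * a ^ 4)"
    unfolding psi using nz by (simp add: field_simps)
  also have "\<dots> = a ^ 4 * b ^ 4 * (E ^ 4 * b ^ 5 / a ^ 3)"
    unfolding R1 using nz by (simp add: field_simps eval_nat_numeral)
  finally show ?thesis
    by (simp only: mult_cancel_left) (use nz in \<open>simp add: abm\<close>)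
qed

text \<open>The point -1 modulo q^3 brings in the constant 1/12. The factor q in numerator and
  denominator anticipates the powers q^(1/4) and q^(3/4) carried by \<open>Pi_q 1\<close> and
  \<open>Pi_q 3\<close>.\<close>

lemma level_6_all:
  "lambert_koebe q - 3 * lambert_koebe (q ^ 3) =
     (psi_prod q 1 ^ 4 + 3 * q * psi_prod q 3 ^ 4)\<^sup>2 / (12 * (psi_prod q 1)\<^sup>2 * (psi_prod q 3)\<^sup>2 * q) * q - 1 / 12"
proof -
  define X Y where XY: "X = psi_prod q 1 ^ 4" "Y = q * psi_prod q 3 ^ 4"
  define F where "F = euler_prod q 3 ^ 4 * odd_prod q 3 ^ 4 / 4 * (theta_pow 1 3 1 q / theta_pow (-1) 3 1 q)\<^sup>2"
  define Z where "Z = (psi_prod q 1)\<^sup>2 * (psi_prod q 3)\<^sup>2"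
  note nz = odd_prod_nonzero[OF q, of 1] odd_prod_nonzero[OF q, of 3] euler_prod_nonzero[OF q, of 6]
    euler_prod_nonzero[OF q, of 2]
  have Z0: "Z \<noteq> 0" using psi_prod_nonzero[OF q] by (simp add: Z_def)
  have XYZ: "X * Y = q * Z\<^sup>2" by (simp add: XY Z_def eval_nat_numeral)
  have F: "F = euler_prod q 6 ^ 4 * (euler_prod q 2)\<^sup>2 / (euler_prod q 6)\<^sup>2 * odd_prod q 1 ^ 4 * odd_prod q 3 ^ 4 / 4"
    unfolding F_def theta_pow_3[OF q] theta_pow_3_minus[OF q]
    using nz euler_prod_eq[OF q, of 1] euler_prod_eq[OF q, of 3]
    by (simp add: field_simps eval_nat_numeral)
  have "(X - Y) * (X - 9 * Y) = euler_prod q 6 ^ 4 * odd_prod q 1 ^ 6 * (odd_prod q 3)\<^sup>2 * X"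
    using level_6_factors by (simp add: XY)
  also have "\<dots> = 4 * Z * F"
    unfolding F XY Z_def using nz by (simp add: psi_prod_def field_simps eval_nat_numeral)
  finally have ZF: "(X - Y) * (X - 9 * Y) = 4 * Z * F" .
  have 1: "koebe_sum (q ^ 3) UNIV q = lambert_koebe q - lambert_koebe (q ^ 3)"
    using koebe_sum_third[OF q, of 1] by simp
  have 2: "koebe_sum (q ^ 3) UNIV q + koebe_sum (q ^ 3) UNIV (-q) = 4 * koebe_sum (q ^ 6) UNIV (q ^ 2)"
    using koebe_sum_power_add_uminus[OF q, of 1 3] by simp
  have 3: "koebe_sum (q ^ 6) UNIV (q ^ 2) = lambert_koebe (q ^ 2) - lambert_koebe (q ^ 6)"
    using koebe_sum_third[OF q, of 2] by simp
  have 4: "koebe_sum (q ^ 3) UNIV (-1) = -1/4 + 8 * lambert_koebe (q ^ 6) - 2 * lambert_koebe (q ^ 3)"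
    using koebe_sum_power_minus_1[OF q, of 3] by simp
  have 5: "koebe_sum (q ^ 3) UNIV (-q) - koebe_sum (q ^ 3) UNIV (-1) = F"
    using koebe_sum_pow_diff_minus_1[OF q, of "-1" 1 3] by (simp add: F_def)
  have "12 * (lambert_koebe q - 3 * lambert_koebe (q ^ 3)) + 1 = 16 * (q * Z) + 4 * F"
  proof -
    have "lambert_koebe q - lambert_koebe (q ^ 2) - 3 * lambert_koebe (q ^ 3) + 3 * lambert_koebe (q ^ 6) = q * Z"
      using level_6_odd[OF q] by (simp add: Z_def)
    moreover have "4 * koebe_sum (q ^ 3) UNIV (-1) = -1 + 32 * lambert_koebe (q ^ 6) - 8 * lambert_koebe (q ^ 3)"
      unfolding 4 by simp
    ultimately show ?thesis using 1 2 3 5 by algebra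
  qed
  \<comment> \<open>With \<open>XYZ\<close> and \<open>ZF\<close> the right side becomes the perfect
    square (X - Y) (X - 9 Y) + 16 X Y = (X + 3 Y)^2.\<close>
  hence "Z * (12 * (lambert_koebe q - 3 * lambert_koebe (q ^ 3)) + 1) = (X + 3 * Y)\<^sup>2"
    using ZF XYZ by algebra
  hence "12 * (lambert_koebe q - 3 * lambert_koebe (q ^ 3)) + 1 = (X + 3 * Y)\<^sup>2 / Z"
    using Z0 by (simp add: field_simps)
  thus ?thesis
    using q by (simp add: XY Z_def field_simps)
qed

text \<open>The four-term relation is used because here it involves only products over conjugate
  pairs, while the three-term relation contains squares of single values. The points are q, q^2,
  q^3, q^4 modulo q^10 for the first relation and q, q^2, -q, -q^2 modulo q^5 for the
  second.\<close>

lemma level_10_relations: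
  defines "u \<equiv> odd_prod q 1" and "v \<equiv> odd_prod q 5" and "m \<equiv> euler_prod q 2 / euler_prod q 10"
  shows "m\<^sup>2 * v\<^sup>2 = q * u\<^sup>2 + v ^ 5 * u" "v ^ 5 = u ^ 4 * m\<^sup>2 * v + 4 * q * u"
    "theta_pow 1 10 1 q * theta_pow 1 10 3 q = u / v"
    "theta_pow 1 10 2 q * theta_pow 1 10 4 q = m"
    "theta_pow 1 10 5 q = v\<^sup>2"
    "theta_pow 1 5 1 q * theta_pow 1 5 2 q = u * m / v"
    "theta_pow (-1) 5 1 q * theta_pow (-1) 5 2 q = v / u"
proof -
  have nz: "u \<noteq> 0" "v \<noteq> 0" "euler_prod q 10 \<noteq> 0"
    using odd_prod_nonzero[OF q, of 1] odd_prod_nonzero[OF q, of 5] euler_prod_nonzero[OF q, of 10]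
    by (auto simp: u_def v_def)
  define t where "t k = theta_pow 1 10 k q" for k
  define s where "s k = theta_pow 1 5 k q" for k
  define r where "r k = theta_pow (-1) 5 k q" for k
  have tsym: "t 6 = t 4" "t 7 = t 3"
    using theta_pow_sym[OF q, of 4 10 1] theta_pow_sym[OF q, of 3 10 1] by (simp_all add: t_def)
  have ssym: "s 3 = s 2" "r 3 = r 2" "r 4 = r 1"
    using theta_pow_sym[OF q, of 2 5 1] theta_pow_sym[OF q, of 2 5 "-1"] theta_pow_sym[OF q, of 1 5 "-1"]
    by (simp_all add: s_def r_def)
  have t13: "t 1 * t 3 = u / v"
    using theta_pow_10[OF q] by (simp add: t_def u_def v_def)
  thus "theta_pow 1 10 1 q * theta_pow 1 10 3 q = u / v" by (simp add: t_def)
  have t24: "t 2 * t 4 = m"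
    using theta_pow_5[of "q ^ 2"] nome_power[OF q, of 2] theta_pow_power[of 1 5 1 q 2] theta_pow_power[of 1 5 2 q 2]
      euler_prod_power[of q 2 1] euler_prod_power[of q 2 5] by (simp add: t_def m_def)
  thus "theta_pow 1 10 2 q * theta_pow 1 10 4 q = m" by (simp add: t_def)
  have t5: "t 5 = v\<^sup>2" using theta_pow_half[OF q, of 5] by (simp add: t_def v_def)
  thus "theta_pow 1 10 5 q = v\<^sup>2" by (simp add: t_def)
  have s12: "s 1 * s 2 = u * m / v"
    using theta_pow_5[OF q] euler_prod_eq[OF q, of 1] euler_prod_eq[OF q, of 5] nz
    by (simp add: s_def u_def v_def m_def)
  thus "theta_pow 1 5 1 q * theta_pow 1 5 2 q = u * m / v" by (simp add: s_def)
  have r12: "r 1 * r 2 = v / u"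
    using theta_pow_5_minus[OF q] by (simp add: r_def u_def v_def)
  thus "theta_pow (-1) 5 1 q * theta_pow (-1) 5 2 q = v / u" by (simp add: r_def)
  have q10: "q ^ 10 \<noteq> 0" "norm (q ^ 10) < 1" and q5: "q ^ 5 \<noteq> 0" "norm (q ^ 5) < 1"
    using nome_power[OF q, of 10] nome_power[OF q, of 5] by auto
  have thnz: "theta (q ^ 10) (q ^ k) \<noteq> 0" if "0 < k" "k < 10" for k
    using theta_power_nonzero[OF q, of k 10 1] that by simp
  have form: "theta_form (q ^ 10) (q ^ i) (q ^ j) = q ^ i * (t (i + j) * t (j - i))"
    if "i < j" "i + j \<le> 10" for i j
    using theta_form_pow[OF q, of 1 1 i j 10] that by (simp add: t_def)
  have "theta_form (q ^ 10) (q ^ 1) (q ^ 2) * theta_form (q ^ 10) (q ^ 3) (q ^ 4) +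
        theta_form (q ^ 10) (q ^ 1) (q ^ 4) * theta_form (q ^ 10) (q ^ 2) (q ^ 3) =
        theta_form (q ^ 10) (q ^ 1) (q ^ 3) * theta_form (q ^ 10) (q ^ 2) (q ^ 4)"
    by (rule theta_four_term[OF q10]; (rule thnz)?) (use q in auto)
  hence "q * (t 3 * t 1) * (q ^ 3 * (t 3 * t 1)) + q * (t 5 * t 3) * (q\<^sup>2 * (t 5 * t 1)) =
      q * (t 4 * t 2) * (q\<^sup>2 * (t 4 * t 2))"
    using form[of 1 2] form[of 3 4] form[of 1 4] form[of 2 3] form[of 1 3] form[of 2 4] tsym by (simp add: numeral_3_eq_3[symmetric])
  hence "q ^ 3 * (q * (t 1 * t 3)\<^sup>2 + t 5 ^ 2 * (t 1 * t 3)) = q ^ 3 * (t 2 * t 4)\<^sup>2"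
    by algebra
  hence "q * (t 1 * t 3)\<^sup>2 + t 5 ^ 2 * (t 1 * t 3) = (t 2 * t 4)\<^sup>2"
    by (simp only: mult_cancel_left) (use q in simp)
  hence "m\<^sup>2 = q * (u / v)\<^sup>2 + v ^ 4 * (u / v)"
    unfolding t13 t24 t5 by (simp add: power_mult[symmetric])
  thus "m\<^sup>2 * v\<^sup>2 = q * u\<^sup>2 + v ^ 5 * u"
    using nz by (simp add: field_simps eval_nat_numeral)
  have th5: "theta (q ^ 5) (c * q ^ k) = theta_pow c 5 k q" if "c = 1 \<or> c = -1" "k \<le> 5" for c k
    using theta_eq_theta_pow[OF q, of c k 5] that by auto
  have thnz5: "theta (q ^ 5) (c * q ^ k) \<noteq> 0" if "c = 1 \<or> c = -1" "0 < k" "k < 5" for c k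
    using theta_power_nonzero[OF q, of k 5 c] that by auto
  have u0: "theta (q ^ 5) (-1) = 2 / v\<^sup>2"
    using theta_minus_1[OF q, of 5] by (simp add: v_def)
  have "theta_form (q ^ 5) (1 * q ^ 1) (1 * q ^ 2) * theta_form (q ^ 5) (-1 * q ^ 1) (-1 * q ^ 2) +
        theta_form (q ^ 5) (1 * q ^ 1) (-1 * q ^ 2) * theta_form (q ^ 5) (1 * q ^ 2) (-1 * q ^ 1) =
        theta_form (q ^ 5) (1 * q ^ 1) (-1 * q ^ 1) * theta_form (q ^ 5) (1 * q ^ 2) (-1 * q ^ 2)"
    by (rule theta_four_term[OF q5]; (rule thnz5)?) (use q in auto)
  moreover have "theta_form (q ^ 5) (1 * q ^ 1) (1 * q ^ 2) = q * s 3 * s 1"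
    using theta_form_pow[OF q, of 1 1 1 2 5] by (simp add: s_def numeral_3_eq_3[symmetric])
  moreover have "theta_form (q ^ 5) (-1 * q ^ 1) (-1 * q ^ 2) = - q * s 3 * s 1"
    using theta_form_pow[OF q, of "-1" "-1" 1 2 5] by (simp add: s_def numeral_3_eq_3[symmetric])
  moreover have "theta_form (q ^ 5) (1 * q ^ 1) (-1 * q ^ 2) = q * r 3 * r 1"
    using theta_form_pow[OF q, of 1 "-1" 1 2 5] by (simp add: r_def numeral_3_eq_3[symmetric])
  \<comment> \<open>\<open>theta_form_pow\<close> wants increasing exponents; the sign of
    antisymmetry cancels against that of the point -q.\<close>
  moreover have "theta_form (q ^ 5) (1 * q ^ 2) (-1 * q ^ 1) = q * r 3 * r 1"
    using theta_form_pow[OF q, of "-1" 1 1 2 5] theta_form_antisym[OF q5, of "q ^ 2" "-q"] q by (simp add: r_def numeral_3_eq_3[symmetric])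
  moreover have "theta_form (q ^ 5) (1 * q ^ 1) (-1 * q ^ 1) = q * r 2 * (2 / v\<^sup>2)"
    using theta_form_pow_minus[OF q, of 1 5 1] th5[of "-1" 2] u0 by (simp add: r_def numeral_3_eq_3[symmetric])
  moreover have "theta_form (q ^ 5) (1 * q ^ 2) (-1 * q ^ 2) = q\<^sup>2 * r 4 * (2 / v\<^sup>2)"
    using theta_form_pow_minus[OF q, of 1 5 2] th5[of "-1" 4] u0 by (simp add: r_def)
  ultimately have "q * s 2 * s 1 * (- q * s 2 * s 1) + q * r 2 * r 1 * (q * r 2 * r 1) =
      q * r 2 * (2 / v\<^sup>2) * (q\<^sup>2 * r 1 * (2 / v\<^sup>2))"
    by (simp only: ssym)
  hence "q ^ 2 * ((r 1 * r 2)\<^sup>2 - (s 1 * s 2)\<^sup>2) = q ^ 2 * (q * (r 1 * r 2) * (2 / v\<^sup>2)\<^sup>2)"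
    by algebra
  hence "(r 1 * r 2)\<^sup>2 - (s 1 * s 2)\<^sup>2 = q * (r 1 * r 2) * (2 / v\<^sup>2)\<^sup>2"
    by (simp only: mult_cancel_left) (use q in simp)
  hence "(v / u)\<^sup>2 - (u * m / v)\<^sup>2 = q * (v / u) * (2 / v\<^sup>2)\<^sup>2"
    unfolding r12 s12 .
  hence "u\<^sup>2 * v ^ 3 * ((v / u)\<^sup>2 - (u * m / v)\<^sup>2) = u\<^sup>2 * v ^ 3 * (q * (v / u) * (2 / v\<^sup>2)\<^sup>2)"
    by simp
  moreover have "u\<^sup>2 * v ^ 3 * ((v / u)\<^sup>2 - (u * m / v)\<^sup>2) = v ^ 5 - u ^ 4 * m\<^sup>2 * v"
    using nz by (simp add: field_simps eval_nat_numeral)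
  moreover have "u\<^sup>2 * v ^ 3 * (q * (v / u) * (2 / v\<^sup>2)\<^sup>2) = 4 * q * u"
    using nz by (simp add: field_simps eval_nat_numeral)
  ultimately show "v ^ 5 = u ^ 4 * m\<^sup>2 * v + 4 * q * u"
    by (simp add: algebra_simps)
qed

lemma level_10_diffs:
  "(psi_prod q 1)\<^sup>2 - q * (psi_prod q 5)\<^sup>2 = (euler_prod q 10)\<^sup>2 * odd_prod q 5 ^ 3 / odd_prod q 1"
  "(psi_prod q 1)\<^sup>2 - 5 * (q * (psi_prod q 5)\<^sup>2) = odd_prod q 1 ^ 5 * (psi_prod q 1)\<^sup>2 / odd_prod q 5"
proof -
  have X: "(psi_prod q 1)\<^sup>2 = (euler_prod q 2 / euler_prod q 10 * euler_prod q 10 / odd_prod q 1)\<^sup>2"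
    using euler_prod_nonzero[OF q, of 10] by (simp add: psi_prod_def)
  have Y: "q * (psi_prod q 5)\<^sup>2 = q * (euler_prod q 10 / odd_prod q 5)\<^sup>2"
    by (simp add: psi_prod_def)
  have nz: "odd_prod q 1 \<noteq> 0" "odd_prod q 5 \<noteq> 0" using odd_prod_nonzero[OF q] by auto
  show "(psi_prod q 1)\<^sup>2 - q * (psi_prod q 5)\<^sup>2 = (euler_prod q 10)\<^sup>2 * odd_prod q 5 ^ 3 / odd_prod q 1"
    by (rule level_10_algebra(1)[OF nz level_10_relations(1,2) X Y])
  show "(psi_prod q 1)\<^sup>2 - 5 * (q * (psi_prod q 5)\<^sup>2) = odd_prod q 1 ^ 5 * (psi_prod q 1)\<^sup>2 / odd_prod q 5"
    by (rule level_10_algebra(2)[OF nz level_10_relations(1,2) X Y])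
qed

end

section \<open>Levels 10 and 20: the squares of both sides\<close>

context
  fixes q :: complex
  assumes q: "q \<noteq> 0" "norm q < 1"
begin

lemma level_10_odd_eq:
  "lambert_koebe q - lambert_koebe (q ^ 2) - 5 * lambert_koebe (q ^ 5) + 5 * lambert_koebe (q ^ 10) =
     q * level_10_odd q"
proof -
  have sym: "theta_pow 1 10 6 q = theta_pow 1 10 4 q" "theta_pow 1 10 8 q = theta_pow 1 10 2 q"
    using theta_pow_sym[OF q, of 4 10 1] theta_pow_sym[OF q, of 2 10 1] by simp_all
  have A: "koebe_sum (q ^ 10) UNIV q - koebe_sum (q ^ 10) UNIV (q ^ 5) =
      q * (euler_prod q 10 ^ 4 * (theta_pow 1 10 4 q / (theta_pow 1 10 1 q * theta_pow 1 10 5 q))\<^sup>2)"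
    using koebe_sum_pow_diff[OF q, of 1 1 1 5 10] sym by (simp add: power_divide power2_eq_square mult_ac)
  have B: "koebe_sum (q ^ 10) UNIV (q ^ 3) - koebe_sum (q ^ 10) UNIV (q ^ 5) =
      q ^ 3 * (euler_prod q 10 ^ 4 * (theta_pow 1 10 2 q / (theta_pow 1 10 3 q * theta_pow 1 10 5 q))\<^sup>2)"
    using koebe_sum_pow_diff[OF q, of 1 1 3 5 10] sym by (simp add: power_divide power2_eq_square mult_ac)
  have K5: "koebe_sum (q ^ 10) UNIV (q ^ 5) = 2 * lambert_koebe (q ^ 5) - 2 * lambert_koebe (q ^ 10)"
    using koebe_sum_half[OF q, of 5] by simp
  have "q * level_10_odd q = (koebe_sum (q ^ 10) UNIV q - koebe_sum (q ^ 10) UNIV (q ^ 5)) +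
      (koebe_sum (q ^ 10) UNIV (q ^ 3) - koebe_sum (q ^ 10) UNIV (q ^ 5))"
    unfolding A B level_10_odd_def by (simp add: algebra_simps power3_eq_cube power2_eq_square)
  hence "2 * (lambert_koebe q - lambert_koebe (q ^ 2) - 5 * lambert_koebe (q ^ 5) + 5 * lambert_koebe (q ^ 10)) =
     2 * (q * level_10_odd q)"
    using K5 koebe_sum_tenth[OF q] by algebra
  thus ?thesis by (simp only: mult_cancel_left) simp
qed

text \<open>Duplication yields the values at -q and -q^2 from those at q, q^2 modulo q^5 and at q^2,
  q^4 modulo q^10; subtracting p(-1) twice produces the 1/2.\<close>

lemma level_10_even_eq:
  "4 * lambert_koebe (q ^ 2) - lambert_koebe q - 20 * lambert_koebe (q ^ 10) + 5 * lambert_koebe (q ^ 5) + 1 / 2 =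
     level_10_even q"
proof -
  have C: "koebe_sum (q ^ 5) UNIV (-q) - koebe_sum (q ^ 5) UNIV (-1) =
     euler_prod q 5 ^ 4 * odd_prod q 5 ^ 4 / 4 * (theta_pow 1 5 1 q / theta_pow (-1) 5 1 q)\<^sup>2"
    using koebe_sum_pow_diff_minus_1[OF q, of "-1" 1 5] by simp
  have D: "koebe_sum (q ^ 5) UNIV (- q\<^sup>2) - koebe_sum (q ^ 5) UNIV (-1) =
     euler_prod q 5 ^ 4 * odd_prod q 5 ^ 4 / 4 * (theta_pow 1 5 2 q / theta_pow (-1) 5 2 q)\<^sup>2"
    using koebe_sum_pow_diff_minus_1[OF q, of "-1" 2 5] by simp
  have 1: "koebe_sum (q ^ 5) UNIV q + koebe_sum (q ^ 5) UNIV (-q) = 4 * koebe_sum (q ^ 10) UNIV (q ^ 2)"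
    using koebe_sum_power_add_uminus[OF q, of 1 5] by simp
  have 2: "koebe_sum (q ^ 5) UNIV (q ^ 2) + koebe_sum (q ^ 5) UNIV (- q\<^sup>2) = 4 * koebe_sum (q ^ 10) UNIV (q ^ 4)"
    using koebe_sum_power_add_uminus[OF q, of 2 5] by simp
  have 3: "koebe_sum (q ^ 10) UNIV (q ^ 2) + koebe_sum (q ^ 10) UNIV (q ^ 4) = lambert_koebe (q ^ 2) - lambert_koebe (q ^ 10)"
    using koebe_sum_fifth[of "q ^ 2"] nome_power[OF q, of 2] by (simp add: power_mult[symmetric])
  have 4: "koebe_sum (q ^ 5) UNIV (-1) = -1/4 + 8 * lambert_koebe (q ^ 10) - 2 * lambert_koebe (q ^ 5)"
    using koebe_sum_power_minus_1[OF q, of 5] by simp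
  have "level_10_even q = (koebe_sum (q ^ 5) UNIV (-q) - koebe_sum (q ^ 5) UNIV (-1)) +
      (koebe_sum (q ^ 5) UNIV (- q\<^sup>2) - koebe_sum (q ^ 5) UNIV (-1))"
    unfolding C D level_10_even_def by (simp only: distrib_left)
  also have "\<dots> = 4 * lambert_koebe (q ^ 2) - lambert_koebe q - 12 * lambert_koebe (q ^ 10) + lambert_koebe (q ^ 5)
      - 8 * lambert_koebe (q ^ 10) - (-4) * lambert_koebe (q ^ 5) + (1 / 2)"
  proof -
    have "2 * koebe_sum (q ^ 5) UNIV (-1) + 1 / 2 = 16 * lambert_koebe (q ^ 10) - 4 * lambert_koebe (q ^ 5)"
      unfolding 4 by simp
    thus ?thesis using 1 2 3 koebe_sum_fifth[OF q] by algebra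
  qed
  finally show ?thesis by simp
qed

text \<open>Neither \<alpha> nor \<beta> is available alone, but \<alpha> \<beta> is, by
  \<open>level_10_relations\<close>, and \<alpha>^2 - q^2 \<beta>^2 is p(q) - p(q^3) up to a factor.
  These determine the square of \<alpha>^2 + q^2 \<beta>^2.\<close>

lemma level_10_odd_square:
  "q * (level_10_odd q)\<^sup>2 =
     (psi_prod q 1)\<^sup>2 * (q * (psi_prod q 5)\<^sup>2) *
     (((psi_prod q 1)\<^sup>2 - q * (psi_prod q 5)\<^sup>2)\<^sup>2 + 4 * (q * (psi_prod q 5)\<^sup>2)\<^sup>2)"
proof -
  define u v m E where uvm: "u = odd_prod q 1" "v = odd_prod q 5" "m = euler_prod q 2 / euler_prod q 10" "E = euler_prod q 10"
  have nz: "u \<noteq> 0" "v \<noteq> 0" "E \<noteq> 0"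
    using odd_prod_nonzero[OF q] euler_prod_nonzero[OF q] by (auto simp: uvm)
  define \<alpha> \<beta> where ab: "\<alpha> = theta_pow 1 10 4 q / (theta_pow 1 10 1 q * theta_pow 1 10 5 q)"
    "\<beta> = theta_pow 1 10 2 q / (theta_pow 1 10 3 q * theta_pow 1 10 5 q)"
  note rel = level_10_relations[OF q, folded uvm]
  have "\<alpha> * \<beta> = (theta_pow 1 10 2 q * theta_pow 1 10 4 q) /
      ((theta_pow 1 10 1 q * theta_pow 1 10 3 q) * (theta_pow 1 10 5 q)\<^sup>2)"
    by (simp add: ab power2_eq_square mult_ac)
  hence prod: "\<alpha> * \<beta> = m / (u * v ^ 3)"
    unfolding rel using nz by (simp add: field_simps eval_nat_numeral)
  have sym: "theta_pow 1 10 6 q = theta_pow 1 10 4 q" "theta_pow 1 10 8 q = theta_pow 1 10 2 q"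
    using theta_pow_sym[OF q, of 4 10 1] theta_pow_sym[OF q, of 2 10 1] by simp_all
  have A: "koebe_sum (q ^ 10) UNIV q - koebe_sum (q ^ 10) UNIV (q ^ 5) = q * E ^ 4 * \<alpha>\<^sup>2"
    using koebe_sum_pow_diff[OF q, of 1 1 1 5 10] sym by (simp add: ab uvm power_divide power2_eq_square mult_ac)
  have B: "koebe_sum (q ^ 10) UNIV (q ^ 3) - koebe_sum (q ^ 10) UNIV (q ^ 5) = q ^ 3 * E ^ 4 * \<beta>\<^sup>2"
    using koebe_sum_pow_diff[OF q, of 1 1 3 5 10] sym by (simp add: ab uvm power_divide power2_eq_square mult_ac)
  have "koebe_sum (q ^ 10) UNIV q - koebe_sum (q ^ 10) UNIV (q ^ 3) =
      q * E ^ 4 * (theta_pow 1 10 2 q * theta_pow 1 10 4 q) / (theta_pow 1 10 1 q * theta_pow 1 10 3 q)\<^sup>2"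
    using koebe_sum_pow_diff[OF q, of 1 1 1 3 10] by (simp add: uvm mult_ac)
  also have "\<dots> = q * E ^ 4 * (m * v\<^sup>2 / u\<^sup>2)"
    unfolding rel using nz by (simp add: field_simps)
  finally have "q * E ^ 4 * (\<alpha>\<^sup>2 - q\<^sup>2 * \<beta>\<^sup>2) = q * E ^ 4 * (m * v\<^sup>2 / u\<^sup>2)"
    using A B by algebra
  hence diff: "\<alpha>\<^sup>2 - q\<^sup>2 * \<beta>\<^sup>2 = m * v\<^sup>2 / u\<^sup>2"
    by (simp only: mult_cancel_left) (use nz q in simp)
  have "level_10_odd q = E ^ 4 * (\<alpha>\<^sup>2 + q\<^sup>2 * \<beta>\<^sup>2)"
    by (simp add: level_10_odd_def ab uvm)
  hence "(level_10_odd q)\<^sup>2 = E ^ 8 * ((\<alpha>\<^sup>2 - q\<^sup>2 * \<beta>\<^sup>2)\<^sup>2 + 4 * q\<^sup>2 * (\<alpha> * \<beta>)\<^sup>2)"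
    by algebra
  hence sq: "(level_10_odd q)\<^sup>2 = E ^ 8 * ((m * v\<^sup>2 / u\<^sup>2)\<^sup>2 + 4 * q\<^sup>2 * (m / (u * v ^ 3))\<^sup>2)"
    unfolding diff prod .
  have psi: "(psi_prod q 1)\<^sup>2 = (m * E / u)\<^sup>2" "(psi_prod q 5)\<^sup>2 = (E / v)\<^sup>2"
    using nz by (simp_all add: psi_prod_def uvm)
  have d: "(m * E / u)\<^sup>2 - q * (E / v)\<^sup>2 = E\<^sup>2 * v ^ 3 / u"
    using level_10_diffs(1)[OF q] unfolding psi by (simp add: uvm)
  show ?thesis
    unfolding psi d sq using nz by (simp add: field_simps eval_nat_numeral)
qed

text \<open>The same device with \<gamma> and \<delta> for the points -q and -q^2 modulo q^5. By
  \<open>level_10_diffs\<close> the other factors on the right are eta quotients too, so the squares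
  can be compared.\<close>

lemma level_10_even_square:
  "(2 * level_10_even q * (psi_prod q 1)\<^sup>2 * (psi_prod q 5)\<^sup>2)\<^sup>2 =
   (level_10_odd q * ((psi_prod q 1)\<^sup>2 - q * (psi_prod q 5)\<^sup>2) * ((psi_prod q 1)\<^sup>2 - 5 * (q * (psi_prod q 5)\<^sup>2)))\<^sup>2"
proof -
  define u v m E where uvm: "u = odd_prod q 1" "v = odd_prod q 5" "m = euler_prod q 2 / euler_prod q 10" "E = euler_prod q 10"
  have nz: "u \<noteq> 0" "v \<noteq> 0" "E \<noteq> 0"
    using odd_prod_nonzero[OF q] euler_prod_nonzero[OF q] by (auto simp: uvm)
  define \<gamma> \<delta> where cd: "\<gamma> = theta_pow 1 5 1 q / theta_pow (-1) 5 1 q" "\<delta> = theta_pow 1 5 2 q / theta_pow (-1) 5 2 q"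
  note rel = level_10_relations[OF q, folded uvm]
  have "\<gamma> * \<delta> = (theta_pow 1 5 1 q * theta_pow 1 5 2 q) / (theta_pow (-1) 5 1 q * theta_pow (-1) 5 2 q)"
    by (simp add: cd)
  hence prod: "\<gamma> * \<delta> = u\<^sup>2 * m / v\<^sup>2"
    unfolding rel using nz by (simp add: field_simps power2_eq_square)
  have E5: "euler_prod q 5 = v * E"
    using euler_prod_eq[OF q, of 5] by (simp add: uvm)
  have C: "koebe_sum (q ^ 5) UNIV (-q) - koebe_sum (q ^ 5) UNIV (-1) = v ^ 8 * E ^ 4 / 4 * \<gamma>\<^sup>2"
    using koebe_sum_pow_diff_minus_1[OF q, of "-1" 1 5] E5
    by (simp add: cd uvm power_mult_distrib flip: power_add mult.assoc) (simp add: mult_ac flip: power_add)?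
  have D: "koebe_sum (q ^ 5) UNIV (- q\<^sup>2) - koebe_sum (q ^ 5) UNIV (-1) = v ^ 8 * E ^ 4 / 4 * \<delta>\<^sup>2"
    using koebe_sum_pow_diff_minus_1[OF q, of "-1" 2 5] E5
    by (simp add: cd uvm power_mult_distrib flip: power_add mult.assoc) (simp add: mult_ac flip: power_add)?
  have sym: "theta_pow 1 5 3 q = theta_pow 1 5 2 q"
    using theta_pow_sym[OF q, of 2 5 1] by simp
  have "koebe_sum (q ^ 5) UNIV (-q) - koebe_sum (q ^ 5) UNIV (- q\<^sup>2) =
      - q * (v * E) ^ 4 * (theta_pow 1 5 1 q * theta_pow 1 5 2 q) / (theta_pow (-1) 5 1 q * theta_pow (-1) 5 2 q)\<^sup>2"
    using koebe_sum_pow_diff[OF q, of "-1" "-1" 1 2 5] sym E5 by (simp add: mult_ac numeral_3_eq_3[symmetric])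
  also have "\<dots> = v ^ 8 * E ^ 4 / 4 * (- 4 * q * u ^ 3 * m / v ^ 7)"
    unfolding rel using nz by (simp add: field_simps eval_nat_numeral)
  finally have "(koebe_sum (q ^ 5) UNIV (-q) - koebe_sum (q ^ 5) UNIV (-1)) -
      (koebe_sum (q ^ 5) UNIV (- q\<^sup>2) - koebe_sum (q ^ 5) UNIV (-1)) =
      v ^ 8 * E ^ 4 / 4 * (- 4 * q * u ^ 3 * m / v ^ 7)"
    by simp
  hence "v ^ 8 * E ^ 4 / 4 * (\<gamma>\<^sup>2 - \<delta>\<^sup>2) = v ^ 8 * E ^ 4 / 4 * (- 4 * q * u ^ 3 * m / v ^ 7)"
    unfolding C D by (simp only: right_diff_distrib)
  hence diff: "\<gamma>\<^sup>2 - \<delta>\<^sup>2 = - 4 * q * u ^ 3 * m / v ^ 7"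
    by (simp only: mult_cancel_left) (use nz in simp)
  have "4 * level_10_even q = v ^ 8 * E ^ 4 * (\<gamma>\<^sup>2 + \<delta>\<^sup>2)"
  proof -
    have "level_10_even q = (v * E) ^ 4 * v ^ 4 / 4 * (\<gamma>\<^sup>2 + \<delta>\<^sup>2)"
      unfolding level_10_even_def E5 cd uvm(2) ..
    also have "(v * E) ^ 4 * v ^ 4 = v ^ 8 * E ^ 4"
      by (simp add: eval_nat_numeral)
    finally show ?thesis by (simp add: field_simps)
  qed
  hence "16 * (level_10_even q)\<^sup>2 = v ^ 16 * E ^ 8 * ((\<gamma>\<^sup>2 - \<delta>\<^sup>2)\<^sup>2 + 4 * (\<gamma> * \<delta>)\<^sup>2)"
    by algebra
  hence "16 * (level_10_even q)\<^sup>2 = v ^ 16 * E ^ 8 * ((- 4 * q * u ^ 3 * m / v ^ 7)\<^sup>2 + 4 * (u\<^sup>2 * m / v\<^sup>2)\<^sup>2)"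
    unfolding diff prod .
  also have "\<dots> = 16 * (E ^ 8 * m\<^sup>2 * u ^ 4 * (q\<^sup>2 * u\<^sup>2 * v\<^sup>2 + v ^ 12 / 4))"
    using nz by (simp add: field_simps eval_nat_numeral)
  finally have ev: "(level_10_even q)\<^sup>2 = E ^ 8 * m\<^sup>2 * u ^ 4 * (q\<^sup>2 * u\<^sup>2 * v\<^sup>2 + v ^ 12 / 4)"
    by simp
  have psi: "(psi_prod q 1)\<^sup>2 = (m * E / u)\<^sup>2" "(psi_prod q 5)\<^sup>2 = (E / v)\<^sup>2"
    using nz by (simp_all add: psi_prod_def uvm)
  have d1: "(m * E / u)\<^sup>2 - q * (E / v)\<^sup>2 = E\<^sup>2 * v ^ 3 / u"
    using level_10_diffs(1)[OF q] unfolding psi by (simp add: uvm)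
  have d5: "(m * E / u)\<^sup>2 - 5 * (q * (E / v)\<^sup>2) = u ^ 5 * (m * E / u)\<^sup>2 / v"
    using level_10_diffs(2)[OF q] unfolding psi by (simp add: uvm)
  have "q * (level_10_odd q)\<^sup>2 = q * (E ^ 8 * m\<^sup>2 * (v ^ 4 / u ^ 4 + 4 * q\<^sup>2 / (u\<^sup>2 * v ^ 6)))"
    unfolding level_10_odd_square psi d1 using nz by (simp add: field_simps eval_nat_numeral)
  hence od: "(level_10_odd q)\<^sup>2 = E ^ 8 * m\<^sup>2 * (v ^ 4 / u ^ 4 + 4 * q\<^sup>2 / (u\<^sup>2 * v ^ 6))"
    by (simp only: mult_cancel_left) (use q in simp)
  show ?thesis
    unfolding power_mult_distrib od ev psi d1 d5 using nz by (simp add: field_simps eval_nat_numeral)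
qed

text \<open>The factor \<open>R\<close> is \<phi>(q^5)^4 + 16 q^5 \<psi>(q^10)^4. Jacobi's identity
  evaluates the corresponding difference, and the product of the two terms is explicit, so the
  square of \<open>R\<close> follows.\<close>

lemma level_20_square:
  "(level_10_odd q * (psi_prod q 1 ^ 4 - 4 * q * (psi_prod q 1)\<^sup>2 * (psi_prod q 5)\<^sup>2 - q\<^sup>2 * psi_prod q 5 ^ 4))\<^sup>2 =
   ((psi_prod q 1)\<^sup>2 * (psi_prod q 5)\<^sup>2 * (psi_prod q 5 ^ 8 / psi_prod q 10 ^ 4 + 16 * q ^ 5 * psi_prod q 10 ^ 4))\<^sup>2"
proof -
  define X S Y R where XY: "X = (psi_prod q 1)\<^sup>2" "S = (psi_prod q 5)\<^sup>2" "Y = q * (psi_prod q 5)\<^sup>2"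
    "R = psi_prod q 5 ^ 8 / psi_prod q 10 ^ 4 + 16 * q ^ 5 * psi_prod q 10 ^ 4"
  define u v E where uv: "u = odd_prod q 1" "v = odd_prod q 5" "E = euler_prod q 10"
  have nz: "u \<noteq> 0" "v \<noteq> 0" "E \<noteq> 0" "psi_prod q 10 \<noteq> 0"
    using odd_prod_nonzero[OF q] euler_prod_nonzero[OF q] psi_prod_nonzero[OF q] by (auto simp: uv)
  have S: "S = E\<^sup>2 / v\<^sup>2" by (simp add: XY uv psi_prod_def power_divide)
  have q5: "q ^ 5 \<noteq> 0" "norm (q ^ 5) < 1" using nome_power[OF q, of 5] by auto
  have "psi_prod (q ^ 5) 1 = psi_prod q 5" "psi_prod (q ^ 5) 2 = psi_prod q 10"
    by (simp_all add: psi_prod_def euler_prod_power odd_prod_power)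
  hence J: "psi_prod q 5 ^ 8 / psi_prod q 10 ^ 4 - 16 * q ^ 5 * psi_prod q 10 ^ 4 = v ^ 8 * E ^ 4"
    using level_4_jacobi[OF q5] by (simp add: euler_prod_power odd_prod_power uv)
  have YS: "Y = q * S" by (simp add: XY)
  have sumsq: "(a + b)\<^sup>2 = (a - b)\<^sup>2 + 4 * (a * b)" for a b :: complex
    by (simp add: power2_eq_square algebra_simps)
  have "R\<^sup>2 = (psi_prod q 5 ^ 8 / psi_prod q 10 ^ 4 - 16 * q ^ 5 * psi_prod q 10 ^ 4)\<^sup>2 +
      4 * (psi_prod q 5 ^ 8 / psi_prod q 10 ^ 4 * (16 * q ^ 5 * psi_prod q 10 ^ 4))"
    unfolding XY(4) by (rule sumsq)
  also have "psi_prod q 5 ^ 8 / psi_prod q 10 ^ 4 * (16 * q ^ 5 * psi_prod q 10 ^ 4) = 16 * q * Y ^ 4"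
  proof -
    have "q ^ 5 = q * q ^ 4" by (simp add: eval_nat_numeral)
    moreover have "Y ^ 4 = q ^ 4 * psi_prod q 5 ^ 8"
      by (simp add: XY(3) power_mult_distrib flip: power_mult)
    ultimately show ?thesis using nz by (simp add: mult.assoc)
  qed
  finally have R: "R\<^sup>2 = E ^ 8 * v ^ 16 + 64 * q * Y ^ 4"
    unfolding J by (simp add: power_mult_distrib flip: power_mult) 
  have d1: "X - Y = E\<^sup>2 * v ^ 3 / u" and d5: "X - 5 * Y = u ^ 5 * X / v"
    using level_10_diffs[OF q] by (simp_all add: XY uv)
  have Y: "Y = q * E\<^sup>2 / v\<^sup>2" using S by (simp add: XY)
  have P: "q * ((X - Y) ^ 5 * (X - 5 * Y)) = X * Y * (E ^ 8 * v ^ 16)"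
  proof -
    have "q * ((E\<^sup>2 * v ^ 3 / u) ^ 5 * (u ^ 5 * X / v)) = X * (q * E\<^sup>2 / v\<^sup>2) * (E ^ 8 * v ^ 16)"
      using nz by (simp add: field_simps eval_nat_numeral)
    thus ?thesis by (simp only: d1 d5 Y[symmetric])
  qed
  have l: "q * (level_10_odd q)\<^sup>2 = X * Y * ((X - Y)\<^sup>2 + 4 * Y\<^sup>2)"
    unfolding level_10_odd_square XY ..
  have "q ^ 2 * (level_10_odd q * (X\<^sup>2 - 4 * X * Y - Y\<^sup>2))\<^sup>2 =
      q * (q * (level_10_odd q)\<^sup>2 * (X\<^sup>2 - 4 * X * Y - Y\<^sup>2)\<^sup>2)"
    by (simp add: power_mult_distrib power2_eq_square)
  \<comment> \<open>The polynomial identity behind level 20: ((X - Y)^2 + 4 Y^2) (X^2 - 4 X Y -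
    Y^2)^2 = (X - Y)^5 (X - 5 Y) + 64 X Y^5.\<close>
  also have "\<dots> = X * Y * (q * ((X - Y) ^ 5 * (X - 5 * Y)) + 64 * q * X * Y ^ 5)"
    unfolding l by algebra
  also have "\<dots> = (X * Y)\<^sup>2 * R\<^sup>2"
    unfolding P R by algebra
  also have "\<dots> = q ^ 2 * (X * S * R)\<^sup>2"
    unfolding YS by (simp add: power_mult_distrib)
  finally have "(level_10_odd q * (X\<^sup>2 - 4 * X * Y - Y\<^sup>2))\<^sup>2 = (X * S * R)\<^sup>2"
    by (simp only: mult_cancel_left) (use q in simp)
  moreover have "psi_prod q 1 ^ 4 - 4 * q * (psi_prod q 1)\<^sup>2 * (psi_prod q 5)\<^sup>2 - q\<^sup>2 * psi_prod q 5 ^ 4 =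
      X\<^sup>2 - 4 * X * Y - Y\<^sup>2"
    unfolding YS XY(1,2) by (simp add: power_mult_distrib flip: power_mult)
  ultimately show ?thesis by (simp only: XY)
qed

end

text \<open>A sign fixed at one point is fixed on the whole disc.\<close>
lemma holomorphic_squares_eq:
  assumes f: "f holomorphic_on ball 0 1" and g: "g holomorphic_on ball 0 1"
    and sq: "\<And>x. x \<noteq> 0 \<Longrightarrow> norm x < 1 \<Longrightarrow> (f x)\<^sup>2 = (g x)\<^sup>2"
    and 0: "f 0 = g 0" "f 0 \<noteq> (0::complex)"
    and x: "norm x < 1"
  shows "f x = g x"
proof -
  have cont: "isCont (\<lambda>x. f x + g x) 0"
    using holomorphic_on_imp_continuous_on[OF f] holomorphic_on_imp_continuous_on[OF g]
    by (auto simp: continuous_on_eq_continuous_at intro!: continuous_intros)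
  moreover have "f 0 + g 0 \<noteq> 0" using 0 by simp
  ultimately obtain e where e: "e > 0" "\<And>x. dist 0 x < e \<Longrightarrow> f x + g x \<noteq> 0"
    using continuous_at_avoid[of 0 "\<lambda>x. f x + g x" 0] by auto
  define d where "d = min e 1"
  have eq: "f x = g x" if "x \<in> ball 0 d" for x
  proof (cases "x = 0")
    case False
    have "(f x - g x) * (f x + g x) = 0"
      using sq[of x] that False by (simp add: d_def power2_eq_square algebra_simps)
    moreover have "f x + g x \<noteq> 0" using e(2)[of x] that by (simp add: d_def)
    ultimately show ?thesis by simp
  qed (use 0 in simp)
  show ?thesis
  proof (rule analytic_continuation_open[of "ball 0 d" "ball 0 1" f g])
    show "ball (0::complex) d \<noteq> {}" using e(1) by (simp add: d_def)
  qed (use f g eq x in \<open>auto simp: d_def\<close>)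
qed

section \<open>Behaviour at q = 0, and the signs at levels 10 and 20\<close>

lemma euler_prod_holomorphic [holomorphic_intros]:
  "n > 0 \<Longrightarrow> (\<lambda>q. euler_prod q n) holomorphic_on ball 0 1"
  unfolding euler_prod_def by (intro holomorphic_intros) (auto simp: norm_power power_less_one_iff)

lemma odd_prod_holomorphic [holomorphic_intros]:
  "n > 0 \<Longrightarrow> (\<lambda>q. odd_prod q n) holomorphic_on ball 0 1"
  unfolding odd_prod_def by (intro holomorphic_intros) (auto simp: norm_power power_less_one_iff)

lemma theta_pow_holomorphic [holomorphic_intros]:
  "N > 0 \<Longrightarrow> (\<lambda>q. theta_pow s N k q) holomorphic_on ball 0 1"
  unfolding theta_pow_def by (intro holomorphic_intros) (auto simp: norm_power power_less_one_iff)

lemma euler_prod_0 [simp]: "n > 0 \<Longrightarrow> euler_prod 0 n = 1"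
  and odd_prod_0 [simp]: "n > 0 \<Longrightarrow> odd_prod 0 n = 1"
  and theta_pow_0 [simp]: "0 < k \<Longrightarrow> k < N \<Longrightarrow> theta_pow s N k 0 = 1"
  by (simp_all add: euler_prod_def odd_prod_def theta_pow_def power_0_left)

lemma psi_prod_0 [simp]: "n > 0 \<Longrightarrow> psi_prod 0 n = 1"
  by (simp add: psi_prod_def)

lemma nonzero_in_disc:
  assumes "norm q < 1"
  shows "n > 0 \<Longrightarrow> euler_prod q n \<noteq> 0" "n > 0 \<Longrightarrow> odd_prod q n \<noteq> 0" "n > 0 \<Longrightarrow> psi_prod q n \<noteq> 0"
    "0 < k \<Longrightarrow> k < N \<Longrightarrow> s = 1 \<or> s = -1 \<Longrightarrow> theta_pow s N k q \<noteq> 0"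
  using assms euler_prod_nonzero[of q] odd_prod_nonzero[of q] psi_prod_nonzero[of q] theta_pow_nonzero[of q]
  by (cases "q = 0"; force)+

lemma psi_prod_holomorphic [holomorphic_intros]:
  "n > 0 \<Longrightarrow> (\<lambda>q. psi_prod q n) holomorphic_on ball 0 1"
  unfolding psi_prod_def by (intro holomorphic_intros) (auto simp: nonzero_in_disc)

lemma level_10_odd_holomorphic [holomorphic_intros]: "level_10_odd holomorphic_on ball 0 1"
  unfolding level_10_odd_def[abs_def] by (intro holomorphic_intros) (auto simp: nonzero_in_disc)

lemma level_10_even_holomorphic [holomorphic_intros]: "level_10_even holomorphic_on ball 0 1"
  unfolding level_10_even_def[abs_def] by (intro holomorphic_intros) (auto simp: nonzero_in_disc)

text \<open>The theta relations give only the squares, and only for nonzero q. Both sides extend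
  holomorphically to q = 0 with the value 1, which selects the sign.\<close>

lemma level_10_even_odd:
  assumes "norm q < 1"
  shows "2 * level_10_even q * (psi_prod q 1)\<^sup>2 * (psi_prod q 5)\<^sup>2 =
   level_10_odd q * ((psi_prod q 1)\<^sup>2 - q * (psi_prod q 5)\<^sup>2) * ((psi_prod q 1)\<^sup>2 - 5 * (q * (psi_prod q 5)\<^sup>2))"
  by (rule holomorphic_squares_eq[OF _ _ level_10_even_square _ _ assms];
      (intro holomorphic_intros)?)
     (auto simp: level_10_odd_def level_10_even_def)

lemma level_20:
  assumes "norm q < 1"
  shows "level_10_odd q * (psi_prod q 1 ^ 4 - 4 * q * (psi_prod q 1)\<^sup>2 * (psi_prod q 5)\<^sup>2 - q\<^sup>2 * psi_prod q 5 ^ 4) =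
   (psi_prod q 1)\<^sup>2 * (psi_prod q 5)\<^sup>2 * (psi_prod q 5 ^ 8 / psi_prod q 10 ^ 4 + 16 * q ^ 5 * psi_prod q 10 ^ 4)"
  by (rule holomorphic_squares_eq[OF _ _ level_20_square _ _ assms];
      (intro holomorphic_intros)?)
     (auto simp: level_10_odd_def nonzero_in_disc)

section \<open>The Jacobi triple product\<close>

definition triangle :: "int \<Rightarrow> nat" where
  "triangle n = nat (n * (n - 1) div 2)"

lemma triangle_eq: "2 * int (triangle n) = n * (n - 1)"
proof -
  have "0 \<le> n * (n - 1)"
    by (cases "n \<ge> 1") (auto intro: mult_nonneg_nonneg mult_nonpos_nonpos)
  moreover have "even (n * (n - 1))" by auto
  ultimately show ?thesis by (simp add: triangle_def)
qed

lemma triangle_eqI: "2 * int k = n * (n - 1) \<Longrightarrow> triangle n = k"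
  using triangle_eq[of n] by linarith

lemma triangle_Suc: "int (triangle (n + 1)) = int (triangle n) + n"
  using triangle_eq[of n] triangle_eq[of "n + 1"] by (simp add: algebra_simps)

lemma triangle_one_minus: "triangle (1 - n) = triangle n"
  using triangle_eq[of n] triangle_eq[of "1 - n"] by (simp add: algebra_simps)

text \<open>The series carries no signs, so the triple product expresses it through
  \<open>theta Q (-y)\<close>, and it vanishes at y = -1.\<close>

definition jacobi_sum :: "complex \<Rightarrow> complex \<Rightarrow> complex" where
  "jacobi_sum Q y = (\<Sum>\<^sub>\<infinity>n\<in>UNIV. y powi n * Q ^ triangle n)"

text \<open>The inequality n <= n (n + 1) / 2 gives a geometric majorant. The quantitative second
  part yields \<psi>(q) -> 1 as q -> 0, which normalises the triple product.\<close>

lemma ramanujan_psi_has_sum: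
  assumes "norm q < 1"
  shows "((\<lambda>n. q ^ (n * (n + 1) div 2)) has_sum ramanujan_psi q) UNIV"
    and "norm (ramanujan_psi q - 1) \<le> norm q / (1 - norm q)"
proof -
  have le: "norm (q ^ (n * (n + 1) div 2)) \<le> norm q ^ n" for n
  proof -
    have "2 * n div 2 \<le> n * (n + 1) div 2"
      by (rule div_le_mono) (cases n, auto)
    hence "n \<le> n * (n + 1) div 2" by simp
    thus ?thesis unfolding norm_power by (rule power_decreasing) (use assms in auto)
  qed
  have sum: "summable (\<lambda>n. norm (q ^ (n * (n + 1) div 2)))"
  proof (rule summable_comparison_test')
    show "summable (\<lambda>n. norm q ^ n)" using assms by (intro summable_geometric) auto
    show "norm (norm (q ^ (n * (n + 1) div 2))) \<le> norm q ^ n" if "n \<ge> 0" for n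
      using le[of n] by (simp only: real_norm_def abs_norm_cancel)
  qed
  show "((\<lambda>n. q ^ (n * (n + 1) div 2)) has_sum ramanujan_psi q) UNIV"
    unfolding ramanujan_psi_def
    by (rule norm_summable_imp_has_sum[OF sum summable_sums[OF summable_norm_cancel[OF sum]]])
  have eq: "ramanujan_psi q - 1 = (\<Sum>n. q ^ (Suc n * (Suc n + 1) div 2))"
    unfolding ramanujan_psi_def suminf_split_head[OF summable_norm_cancel[OF sum]] by simp
  have geo: "(\<lambda>n. norm q ^ Suc n) sums (norm q * (1 / (1 - norm q)))"
    unfolding power_Suc using assms by (intro sums_mult geometric_sums) auto
  have "norm (\<Sum>n. q ^ (Suc n * (Suc n + 1) div 2)) \<le> (\<Sum>n. norm q ^ Suc n)"
    by (rule norm_suminf_le[OF le sums_summable[OF geo]])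
  also have "\<dots> = norm q / (1 - norm q)"
    using sums_unique[OF geo] by simp
  finally show "norm (ramanujan_psi q - 1) \<le> norm q / (1 - norm q)"
    unfolding eq .
qed

context
  fixes Q :: complex
  assumes Q: "Q \<noteq> 0" "norm Q < 1"
begin

text \<open>With s = sqrt |Q| and k = |n| the exponent satisfies 2 \<open>triangle n\<close> >= k (k
  - 1), so the term is at most (C s^(k - 1))^k. The base is below 1/2 once k - 1 >= N, whence the
  threshold \<open>Suc N\<close>.\<close>

lemma jacobi_term_bound:
  assumes "0 < a" "0 < b"
  shows "\<exists>N. \<forall>y n. a \<le> norm y \<longrightarrow> norm y \<le> b \<longrightarrow> \<bar>n\<bar> \<ge> int N \<longrightarrow>
           norm (y powi n * Q ^ triangle n) \<le> (1 / 2) ^ nat \<bar>n\<bar>"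
proof -
  define C where "C = max b (1 / a)"
  have C: "b \<le> C" "1 / a \<le> C" "C > 0" using assms by (auto simp: C_def)
  define s where "s = sqrt (norm Q)"
  have s: "0 < s" "s < 1" "s\<^sup>2 = norm Q" using Q by (auto simp: s_def)
  have "(\<lambda>n. C * s ^ n) \<longlonglongrightarrow> C * 0"
    using s by (intro tendsto_intros LIMSEQ_power_zero) auto
  hence "eventually (\<lambda>n. C * s ^ n < 1 / 2) sequentially"
    by (rule order_tendstoD) auto
  then obtain N where N: "\<And>n. n \<ge> N \<Longrightarrow> C * s ^ n < 1 / 2"
    by (auto simp: eventually_at_top_linorder)
  show ?thesis
  proof (rule exI[of _ "Suc N"], intro allI impI)
    fix y :: complex and n :: int
    assume y: "a \<le> norm y" "norm y \<le> b" and n: "\<bar>n\<bar> \<ge> int (Suc N)"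
    define k where "k = nat \<bar>n\<bar>"
    have k: "k \<ge> Suc N" using n by (simp add: k_def)
    have y0: "norm y > 0" using y assms by linarith
    have 1: "norm (y powi n) \<le> C ^ k"
    proof (cases "n \<ge> 0")
      case True
      thus ?thesis using y C by (auto simp: k_def power_int_def norm_power intro!: power_mono)
    next
      case False
      have "inverse (norm y) \<le> 1 / a" using y y0 assms by (simp add: field_simps)
      hence "inverse (norm y) \<le> C" using C by linarith
      thus ?thesis using False y0
        by (auto simp: k_def power_int_def norm_power norm_inverse intro!: power_mono)
    qed
    have "k * (k - 1) \<le> 2 * triangle n"
    proof -
      have "int (k * (k - 1)) = \<bar>n\<bar> * (\<bar>n\<bar> - 1)"
        using k by (simp add: k_def of_nat_diff)
      also have "\<dots> \<le> n * (n - 1)" by (cases "n \<ge> 0") (auto simp: algebra_simps)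
      finally show ?thesis using triangle_eq[of n] by linarith
    qed
    hence "s ^ (2 * triangle n) \<le> s ^ (k * (k - 1))"
      using s by (intro power_decreasing) auto
    hence 2: "norm (Q ^ triangle n) \<le> (s ^ (k - 1)) ^ k"
      by (simp add: norm_power s(3)[symmetric] power_mult[symmetric] mult.commute)
    have "norm (y powi n * Q ^ triangle n) \<le> C ^ k * (s ^ (k - 1)) ^ k"
      unfolding norm_mult using 1 2 C s by (intro mult_mono) auto
    also have "\<dots> = (C * s ^ (k - 1)) ^ k" by (simp add: power_mult_distrib)
    also have "\<dots> \<le> (1 / 2) ^ k"
    proof (rule power_mono)
      have "N \<le> k - 1" using k by simp
      thus "C * s ^ (k - 1) \<le> 1 / 2" using N by (simp add: less_imp_le)
    qed (use C s in auto)
    finally show "norm (y powi n * Q ^ triangle n) \<le> (1 / 2) ^ nat \<bar>n\<bar>" by (simp add: k_def)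
  qed
qed

lemma jacobi_summable:
  assumes "y \<noteq> 0"
  shows "(\<lambda>n. y powi n * Q ^ triangle n) summable_on S"
proof -
  have y: "norm y > 0" using assms by simp
  obtain N where N: "\<And>x n. norm y \<le> norm x \<Longrightarrow> norm x \<le> norm y \<Longrightarrow> \<bar>n\<bar> \<ge> int N \<Longrightarrow>
      norm (x powi n * Q ^ triangle n) \<le> (1 / 2) ^ nat \<bar>n\<bar>"
    using jacobi_term_bound[OF y y] by blast
  have "(\<lambda>n. norm (y powi n * Q ^ triangle n)) summable_on (- {-int N..int N})"
  proof (rule Infinite_Sum.abs_summable_on_comparison_test')
    show "(\<lambda>n. (1 / 2 :: real) ^ nat \<bar>n\<bar>) summable_on (- {-int N..int N})"
      by (rule summable_on_int_geometric) auto
    fix n assume "n \<in> - {-int N..int N}"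
    hence "\<bar>n\<bar> \<ge> int N" by (auto simp: abs_if)
    thus "norm (y powi n * Q ^ triangle n) \<le> (1 / 2) ^ nat \<bar>n\<bar>" by (rule N[OF order_refl order_refl])
  qed
  hence "(\<lambda>n. y powi n * Q ^ triangle n) summable_on (- {-int N..int N})"
    by (rule Infinite_Sum.abs_summable_summable)
  moreover have "(\<lambda>n. y powi n * Q ^ triangle n) summable_on {-int N..int N}"
    by (rule summable_on_finite) (rule finite_atLeastAtMost_int)
  ultimately have "(\<lambda>n. y powi n * Q ^ triangle n) summable_on (- {-int N..int N} \<union> {-int N..int N})"
    by (rule summable_on_union)
  thus ?thesis by (rule summable_on_subset) auto
qed

lemma jacobi_sum_holomorphic: "jacobi_sum Q holomorphic_on -{0}"
proof -
  have "(\<lambda>y. \<Sum>\<^sub>\<infinity>n\<in>UNIV. y powi n * Q ^ triangle n) holomorphic_on -{0}"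
  proof (rule holomorphic_on_infsum)
    fix n :: int
    show "(\<lambda>y. y powi n * Q ^ triangle n) holomorphic_on -{0}"
      by (intro holomorphic_intros) auto
  next
    fix z :: complex assume "z \<in> -{0}"
    hence z: "z \<noteq> 0" by auto
    have pos: "norm z / 2 > 0" "2 * norm z > 0" using z by simp_all
    obtain N where N: "\<And>x n. norm z / 2 \<le> norm x \<Longrightarrow> norm x \<le> 2 * norm z \<Longrightarrow> \<bar>n\<bar> \<ge> int N \<Longrightarrow>
        norm (x powi n * Q ^ triangle n) \<le> (1 / 2) ^ nat \<bar>n\<bar>"
      using jacobi_term_bound[OF pos] by blast
    have "norm (x powi n * Q ^ triangle n) \<le> (1 / 2) ^ nat \<bar>n\<bar>"
      if "n \<in> UNIV - {-int N..int N}" "x \<in> cball z (norm z / 2)" for n x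
    proof (rule N)
      have "norm (z - x) \<le> norm z / 2"
        using that(2) by (simp add: dist_norm)
      thus "norm z / 2 \<le> norm x" "norm x \<le> 2 * norm z"
        using norm_triangle_ineq2[of z x] norm_triangle_ineq2[of x z] norm_minus_commute[of x z]
          norm_ge_zero[of z]
        by linarith+
      show "\<bar>n\<bar> \<ge> int N"
        using that(1) by (auto simp: abs_if)
    qed
    moreover have "(\<lambda>n. (1 / 2 :: real) ^ nat \<bar>n\<bar>) summable_on UNIV"
      by (rule summable_on_int_geometric) auto
    ultimately show "\<exists>r>0. \<exists>M F. M summable_on UNIV \<and> finite F \<and>
       (\<forall>n\<in>UNIV - F. \<forall>x\<in>cball z r. norm (x powi n * Q ^ triangle n) \<le> M n)"
      using z
      by (intro exI[of _ "norm z / 2"] exI[of _ "\<lambda>n. (1 / 2) ^ nat \<bar>n\<bar>"] exI[of _ "{-int N..int N}"]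
          conjI ballI) simp_all
  qed auto
  thus ?thesis by (simp add: jacobi_sum_def[abs_def])
qed

lemma power_triangle_shift: "Q ^ triangle n * Q powi n = Q ^ triangle (n + 1)"
proof -
  have "Q ^ triangle n * Q powi n = Q powi (int (triangle n) + n)"
    using Q by (simp add: power_int_add)
  also have "\<dots> = Q powi int (triangle (n + 1))" by (simp only: triangle_Suc)
  finally show ?thesis by simp
qed

lemma jacobi_sum_shift:
  assumes "y \<noteq> 0"
  shows "jacobi_sum Q (y * Q) = jacobi_sum Q y / y"
proof -
  have "jacobi_sum Q (y * Q) = (\<Sum>\<^sub>\<infinity>n\<in>UNIV. (y powi n * Q ^ triangle n) * inverse y)"
    unfolding jacobi_sum_def
  proof (rule infsum_reindex_bij_witness[of _ "\<lambda>n. n - 1" "\<lambda>n. n + 1"])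
    fix n :: int
    have "y powi (n + 1) * inverse y = y powi n" using assms by (simp add: power_int_add)
    thus "y powi (n + 1) * Q ^ triangle (n + 1) * inverse y = (y * Q) powi n * Q ^ triangle n"
      unfolding power_triangle_shift[symmetric] power_int_mult_distrib by (simp add: mult_ac)
  qed auto
  thus ?thesis by (simp add: jacobi_sum_def infsum_cmult_left' divide_inverse)
qed

text \<open>The reflection n -> 1 - n keeps the exponent of Q and reverses the sign of the
  term.\<close>

lemma jacobi_sum_minus_1: "jacobi_sum Q (-1) = 0"
proof -
  have "jacobi_sum Q (-1) = (\<Sum>\<^sub>\<infinity>n\<in>UNIV. - ((-1) powi n * Q ^ triangle n))"
    unfolding jacobi_sum_def
    by (rule infsum_reindex_bij_witness[of _ "\<lambda>n. 1 - n" "\<lambda>n. 1 - n"])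
       (auto simp: triangle_one_minus power_int_diff power_int_minus_left)
  also have "\<dots> = - jacobi_sum Q (-1)" by (simp add: jacobi_sum_def infsum_uminus)
  finally show ?thesis by (simp add: eq_neg_iff_add_eq_0)
qed

lemma jacobi_sum_1: "jacobi_sum Q 1 = 2 * ramanujan_psi Q"
proof -
  have tri: "triangle (int n + 1) = n * (n + 1) div 2" for n
  proof (rule triangle_eqI)
    have "2 * (n * (n + 1) div 2) = n * (n + 1)" by simp
    hence "2 * int (n * (n + 1) div 2) = int (n * (n + 1))" by linarith
    thus "2 * int (n * (n + 1) div 2) = (int n + 1) * (int n + 1 - 1)" by (simp add: algebra_simps)
  qed
  have psi: "ramanujan_psi Q = (\<Sum>\<^sub>\<infinity>n\<in>UNIV. Q ^ (n * (n + 1) div 2))"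
    using ramanujan_psi_has_sum(1)[OF Q(2)] by (simp add: infsumI)
  have pos: "(\<Sum>\<^sub>\<infinity>n\<in>{1..}. 1 powi n * Q ^ triangle n) = ramanujan_psi Q"
    unfolding psi
  proof (rule infsum_reindex_bij_witness[of _ "\<lambda>n. int n + 1" "\<lambda>n. nat (n - 1)"])
    fix n :: int assume "n \<in> {1..}"
    hence "triangle n = nat (n - 1) * (nat (n - 1) + 1) div 2"
      using tri[of "nat (n - 1)"] by simp
    thus "Q ^ (nat (n - 1) * (nat (n - 1) + 1) div 2) = 1 powi n * Q ^ triangle n" by simp
  qed auto
  have neg: "(\<Sum>\<^sub>\<infinity>n\<in>{..0}. 1 powi n * Q ^ triangle n) = ramanujan_psi Q"
    unfolding psi
  proof (rule infsum_reindex_bij_witness[of _ "\<lambda>n. - int n" "\<lambda>n. nat (-n)"])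
    fix n :: int assume "n \<in> {..0}"
    hence "triangle n = nat (-n) * (nat (-n) + 1) div 2"
      using tri[of "nat (-n)"] triangle_one_minus[of n] by simp
    thus "Q ^ (nat (-n) * (nat (-n) + 1) div 2) = 1 powi n * Q ^ triangle n" by simp
  qed auto
  have "(UNIV :: int set) = {1..} \<union> {..0}" by auto
  hence "jacobi_sum Q 1 = (\<Sum>\<^sub>\<infinity>n\<in>{1..} \<union> {..0}. 1 powi n * Q ^ triangle n)"
    by (simp add: jacobi_sum_def)
  also have "\<dots> = ramanujan_psi Q + ramanujan_psi Q"
    by (subst infsum_Un_disjoint) (use pos neg jacobi_summable[of 1] in auto)
  finally show ?thesis by simp
qed

text \<open>The quotient of \<open>jacobi_sum Q (-x)\<close> by \<open>theta Q x\<close> is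
  periodic, and its singularity at 1 is removable because the numerator vanishes there too. The
  dependence of the constant on Q stays open at this point.\<close>

lemma jacobi_sum_proportional:
  obtains c where "\<And>y. y \<noteq> 0 \<Longrightarrow> theta Q (-y) \<noteq> 0 \<Longrightarrow> jacobi_sum Q y = c * theta Q (-y)"
proof -
  define f where "f = (\<lambda>x. jacobi_sum Q (-x) / theta Q x)"
  have hol: "f holomorphic_on {x. x \<noteq> 0 \<and> theta Q x \<noteq> 0}"
  proof -
    have "(jacobi_sum Q \<circ> uminus) holomorphic_on {x. x \<noteq> 0 \<and> theta Q x \<noteq> 0}"
      by (rule holomorphic_on_compose_gen[OF _ jacobi_sum_holomorphic]) (auto intro!: holomorphic_intros)
    hence 1: "(\<lambda>x. jacobi_sum Q (-x)) holomorphic_on {x. x \<noteq> 0 \<and> theta Q x \<noteq> 0}"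
      by (simp add: o_def)
    have 2: "theta Q holomorphic_on {x. x \<noteq> 0 \<and> theta Q x \<noteq> 0}"
      using theta_holomorphic[OF Q holomorphic_on_id, of "{x. x \<noteq> 0 \<and> theta Q x \<noteq> 0}"]
        open_theta_nonzero[OF Q] by (simp add: id_def)
    show ?thesis
      unfolding f_def by (intro holomorphic_on_divide 1 2) simp
  qed
  have per: "f (x * Q) = f x" if "x \<noteq> 0" "theta Q x \<noteq> 0" for x
    using jacobi_sum_shift[of "-x"] theta_shift[OF Q, of x] that by (simp add: f_def)
  obtain e where e: "0 < e" "e < 1" "theta Q holomorphic_on ball 1 e" "\<forall>x\<in>ball (1::complex) e. x \<noteq> 0"
    "\<forall>x\<in>ball 1 e. qpochhammer_inf (x * Q) Q * qpochhammer_inf (Q / x) Q \<noteq> 0"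
    "(\<lambda>x. qpochhammer_inf (x * Q) Q * qpochhammer_inf (Q / x) Q) holomorphic_on ball 1 e"
    by (rule theta_near_1[OF Q])
  define h where "h = (\<lambda>x. qpochhammer_inf (x * Q) Q * qpochhammer_inf (Q / x) Q)"
  define W where "W = (\<lambda>x. jacobi_sum Q (-x))"
  have Whol: "W holomorphic_on ball 1 e"
  proof -
    have "(jacobi_sum Q \<circ> uminus) holomorphic_on ball 1 e"
      by (rule holomorphic_on_compose_gen[OF _ jacobi_sum_holomorphic])
         (use e(4) in \<open>auto intro!: holomorphic_intros simp del: mem_ball\<close>)
    thus ?thesis by (simp add: W_def o_def)
  qed
  have W1: "W 1 = 0" by (simp add: W_def jacobi_sum_minus_1)
  define V where "V = (\<lambda>x. if x = 1 then deriv W 1 else W x / (x - 1))"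
  have Vhol: "V holomorphic_on ball 1 e"
    using pole_lemma_open[OF Whol open_ball, of 1] unfolding W1 V_def by (simp cong: if_cong)
  have "(\<lambda>x. - V x / h x) holomorphic_on ball 1 e"
  proof -
    have "h holomorphic_on ball 1 e" using e(6) by (simp add: h_def)
    moreover have "h x \<noteq> 0" if "x \<in> ball 1 e" for x using e(5) that unfolding h_def by blast
    ultimately show ?thesis by (intro holomorphic_intros Vhol)
  qed
  from holomorphic_on_imp_continuous_on[OF this] have "(\<lambda>x. - V x / h x) \<midarrow>1\<rightarrow> - V 1 / h 1"
    using e(1) by (auto simp: continuous_on_eq_continuous_at isCont_def)
  moreover have "\<forall>\<^sub>F x in at 1. x \<in> ball 1 e - {1}"
    using e(1) by (intro eventually_at_in_open) auto
  hence "\<forall>\<^sub>F x in at 1. - V x / h x = f x"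
  proof eventually_elim
    case (elim x)
    hence "x - 1 \<noteq> 0" by auto
    moreover have "theta Q x = - ((x - 1) * h x)"
      by (simp add: h_def theta_factor[OF Q] algebra_simps)
    ultimately show ?case by (simp add: f_def V_def W_def)
  qed
  ultimately have lim: "f \<midarrow>1\<rightarrow> - V 1 / h 1"
    by (subst tendsto_cong[symmetric])
  show ?thesis
  proof (rule that)
    fix y assume y: "y \<noteq> 0" "theta Q (-y) \<noteq> 0"
    have "f (-y) = - V 1 / h 1"
      by (rule elliptic_Liouville[OF Q hol per lim]) (use y in auto)
    thus "jacobi_sum Q y = - V 1 / h 1 * theta Q (-y)"
      using y by (simp add: f_def field_simps)
  qed
qed

end

lemma theta_minus_nonzero:
  assumes "Q \<noteq> 0" "norm Q < 1" "norm Q < norm y" "norm y \<le> 1" "y \<noteq> -1"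
  shows "theta Q (-y) \<noteq> 0"
  using assms by (intro theta_nonzero) (auto simp: minus_equation_iff[of y])

text \<open>Substituting \<open>y = - \<i> q\<close> into the product with \<open>Q = q\<^sup>2\<close> relates the constants of proportionality
  for \<open>q\<^sup>2\<close> and \<open>q\<^sup>8\<close>.\<close>
lemma jacobi_sum_ii:
  assumes q: "q \<noteq> 0" "norm q < 1"
  shows "jacobi_sum (q\<^sup>2) (- (\<i> * q)) = jacobi_sum (q ^ 8) (- (q ^ 4))"
proof -
  have q2: "q\<^sup>2 \<noteq> 0" "norm (q\<^sup>2) < 1" using nome_power[OF q, of 2] by auto
  define f where "f n = (- (\<i> * q)) powi n * (q\<^sup>2) ^ triangle n" for n
  \<comment> \<open>With y = - \<i> q and nome q^2 the exponents n and n (n - 1) add up to n^2,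
    which is symmetric under n -> - n.\<close>
  have pow: "(- (\<i> * q)) powi n * (q\<^sup>2) ^ triangle n = (-\<i>) powi n * q powi (n * n)" for n
  proof -
    have "(q\<^sup>2) ^ triangle n = q powi (2 * int (triangle n))"
      by (simp add: power_mult[symmetric] power_int_power power_int_mult)
    also have "\<dots> = q powi (n * (n - 1))" by (simp only: triangle_eq)
    finally have "(- (\<i> * q)) powi n * (q\<^sup>2) ^ triangle n = (-\<i>) powi n * (q powi n * q powi (n * (n - 1)))"
      by (simp add: power_int_mult_distrib[of "-\<i>" q, simplified] mult.assoc)
    also have "q powi n * q powi (n * (n - 1)) = q powi (n * n)"
      using q by (simp add: power_int_add[symmetric] algebra_simps)
    finally show ?thesis .
  qed
  have sum: "f summable_on S" for S
    unfolding f_def using q by (intro jacobi_summable[OF q2]) auto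
  have "jacobi_sum (q\<^sup>2) (- (\<i> * q)) = (\<Sum>j<2. \<Sum>\<^sub>\<infinity>k\<in>UNIV. f (int 2 * k + int j))"
    unfolding jacobi_sum_def f_def[symmetric] by (rule infsum_int_split[OF sum]) simp
  also have "\<dots> = (\<Sum>\<^sub>\<infinity>k\<in>UNIV. f (2 * k)) + (\<Sum>\<^sub>\<infinity>k\<in>UNIV. f (2 * k + 1))"
    by (simp add: numeral_2_eq_2)
  \<comment> \<open>For odd n the terms at n and - n cancel, since (-\<i>)^n and its inverse are
    negatives of each other; in terms of k this is the reflection k -> - k - 1.\<close>
  also have "(\<Sum>\<^sub>\<infinity>k\<in>UNIV. f (2 * k + 1)) = 0"
  proof -
    have "(\<Sum>\<^sub>\<infinity>k\<in>UNIV. f (2 * k + 1)) = (\<Sum>\<^sub>\<infinity>k\<in>UNIV. - f (2 * k + 1))"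
    proof (rule infsum_reindex_bij_witness[of _ "\<lambda>k. - k - 1" "\<lambda>k. - k - 1"])
      fix k :: int
      have "(-\<i>) powi (2 * (- k - 1) + 1) = inverse ((-\<i>) powi (2 * k + 1))"
      proof -
        have "2 * (- k - 1) + 1 = - (2 * k + 1)" by simp
        thus ?thesis by (simp only: power_int_minus)
      qed
      moreover have "(-\<i>) powi (2 * k + 1) * (-\<i>) powi (2 * k + 1) = -1"
      proof -
        have "(-\<i>) powi (2 * k + 1) * (-\<i>) powi (2 * k + 1) = ((-\<i>) powi (2 * k)) * ((-\<i>) powi (2 * k)) * ((-\<i>) * (-\<i>))"
          by (simp add: power_int_add mult_ac)
        also have "(-\<i>) powi (2 * k) = (-1) powi k"
          by (simp add: power_int_mult)
        also have "(-1) powi k * (-1) powi k = (1 :: complex)"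
          by (simp flip: power_int_mult_distrib)
        finally show ?thesis by simp
      qed
      ultimately have "(-\<i>) powi (2 * (- k - 1) + 1) = - ((-\<i>) powi (2 * k + 1))"
        by (metis inverse_unique minus_equation_iff mult_minus_right)
      moreover have "(2 * (- k - 1) + 1) * (2 * (- k - 1) + 1) = (2 * k + 1) * (2 * k + 1)"
        by (simp add: algebra_simps)
      ultimately show "- f (2 * (- k - 1) + 1) = f (2 * k + 1)"
        unfolding f_def pow by simp
    qed auto
    also have "\<dots> = - (\<Sum>\<^sub>\<infinity>k\<in>UNIV. f (2 * k + 1))" by (rule infsum_uminus)
    finally show ?thesis by (simp add: eq_neg_iff_add_eq_0)
  qed
  also have "(\<Sum>\<^sub>\<infinity>k\<in>UNIV. f (2 * k)) + 0 = jacobi_sum (q ^ 8) (- (q ^ 4))"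
    unfolding jacobi_sum_def add_0_right
  proof (rule infsum_cong)
    fix k :: int
    have "(q ^ 8) ^ triangle k = q powi (4 * (2 * int (triangle k)))"
      by (simp add: power_mult[symmetric] power_int_power power_int_mult)
    also have "\<dots> = q powi (4 * (k * (k - 1)))" by (simp only: triangle_eq)
    finally have "(- (q ^ 4)) powi k * (q ^ 8) ^ triangle k = (-1) powi k * (q powi (4 * k) * q powi (4 * (k * (k - 1))))"
      using power_int_mult_distrib[of "-1" "q ^ 4" k] by (simp add: power_int_mult mult.assoc)
    also have "q powi (4 * k) * q powi (4 * (k * (k - 1))) = q powi (2 * k * (2 * k))"
      using q by (simp add: power_int_add[symmetric] algebra_simps)
    also have "(-1) powi k = (-\<i>) powi (2 * k)" by (simp add: power_int_mult)
    finally show "f (2 * k) = (- (q ^ 4)) powi k * (q ^ 8) ^ triangle k"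
      unfolding f_def pow by simp
  qed
  finally show ?thesis .
qed

text \<open>The constant of proportionality as forced at y = 1, where the series is 2 \<psi>(Q) and
  \<open>theta Q (-1)\<close> is 2 / (Q;Q^2)^2.\<close>

definition jacobi_const :: "complex \<Rightarrow> complex" where
  "jacobi_const Q = ramanujan_psi Q * (odd_prod Q 1)\<^sup>2"

lemma jacobi_sum_eq_const:
  assumes Q: "Q \<noteq> 0" "norm Q < 1" and y: "y \<noteq> 0" "theta Q (-y) \<noteq> 0"
  shows "jacobi_sum Q y = jacobi_const Q * theta Q (-y)"
proof -
  obtain c where c: "\<And>y. y \<noteq> 0 \<Longrightarrow> theta Q (-y) \<noteq> 0 \<Longrightarrow> jacobi_sum Q y = c * theta Q (-y)"
    by (rule jacobi_sum_proportional[OF Q]) blast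
  have th: "theta Q (-1) = 2 / (odd_prod Q 1)\<^sup>2" using theta_minus_1[OF Q, of 1] by simp
  have o: "odd_prod Q 1 \<noteq> 0" using odd_prod_nonzero[OF Q] by simp
  have "2 * ramanujan_psi Q = c * (2 / (odd_prod Q 1)\<^sup>2)"
    using c[of 1] jacobi_sum_1[OF Q] th o by simp
  hence "c = jacobi_const Q" using o by (simp add: jacobi_const_def field_simps)
  thus ?thesis using c[OF y] by simp
qed

lemma jacobi_const_power_4:
  assumes Q: "Q \<noteq> 0" "norm Q < 1"
  shows "jacobi_const Q / euler_prod Q 1 = jacobi_const (Q ^ 4) / euler_prod (Q ^ 4) 1"
proof -
  define q where "q = csqrt Q"
  have Qq: "Q = q\<^sup>2" by (simp add: q_def)
  have q: "q \<noteq> 0" "norm q < 1"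
    using Q by (auto simp: Qq norm_power power_less_one_iff)
  have q2: "q\<^sup>2 \<noteq> 0" "norm (q\<^sup>2) < 1" and q8: "q ^ 8 \<noteq> 0" "norm (q ^ 8) < 1"
    using nome_power[OF q, of 2] nome_power[OF q, of 8] by auto
  have "norm (q ^ 2) < norm (- (\<i> * q))" "norm (- (\<i> * q)) \<le> 1"
    using q by (auto simp: norm_mult norm_power power2_eq_square)
  moreover have "- (\<i> * q) \<noteq> -1" using q by (metis norm_ii norm_minus_cancel norm_mult norm_one mult_1 less_irrefl)
  ultimately have 1: "theta (q\<^sup>2) (- (- (\<i> * q))) \<noteq> 0"
    by (intro theta_minus_nonzero q2)
  have 2: "theta (q ^ 8) (q ^ 4) \<noteq> 0"
    using theta_power_nonzero[OF q, of 4 8 1] by simp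
  have "jacobi_const (q\<^sup>2) * theta (q\<^sup>2) (\<i> * q) = jacobi_const (q ^ 8) * theta (q ^ 8) (q ^ 4)"
    using jacobi_sum_ii[OF q] jacobi_sum_eq_const[OF q2, of "- (\<i> * q)"] jacobi_sum_eq_const[OF q8, of "- (q ^ 4)"]
      1 2 q by simp
  moreover have "theta (q\<^sup>2) (\<i> * q) = odd_prod q 4 / odd_prod q 2"
  proof -
    have "q\<^sup>2 / (\<i> * q) = - (\<i> * q)" using q by (simp add: field_simps power2_eq_square)
    hence "theta (q\<^sup>2) (\<i> * q) = qpochhammer_inf (\<i> * q) (q\<^sup>2) * qpochhammer_inf (- (\<i> * q)) (q\<^sup>2)"
      by (simp add: theta_def)
    also have "\<dots> = qpochhammer_inf (- (q ^ 2)) (q ^ (2 * 2))"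
      using qpochhammer_mult_uminus[OF q2(2), of "\<i> * q"] by (simp add: power_mult_distrib power_mult[symmetric])
    finally show ?thesis using qpochhammer_minus_odd[OF q, of 2] by simp
  qed
  moreover have "theta (q ^ 8) (q ^ 4) = (odd_prod q 4)\<^sup>2"
    using theta_eq_theta_pow[OF q, of 1 4 8] theta_pow_half[OF q, of 4] by simp
  ultimately have "jacobi_const (q\<^sup>2) * (odd_prod q 4 / odd_prod q 2) = jacobi_const (q ^ 8) * (odd_prod q 4)\<^sup>2"
    by simp
  hence "jacobi_const (q\<^sup>2) = jacobi_const (q ^ 8) * odd_prod q 4 * odd_prod q 2"
    using odd_prod_nonzero[OF q, of 2] odd_prod_nonzero[OF q, of 4] by (simp add: field_simps power2_eq_square)
  moreover have "euler_prod q 2 = odd_prod q 2 * (odd_prod q 4 * euler_prod q 8)"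
    using euler_prod_eq[OF q, of 2] euler_prod_eq[OF q, of 4] by simp
  ultimately show ?thesis
    using odd_prod_nonzero[OF q, of 2] odd_prod_nonzero[OF q, of 4] euler_prod_nonzero[OF q, of 8]
    by (simp add: Qq power_mult[symmetric] euler_prod_power[of q 2 1, simplified] euler_prod_power[of q 8 1, simplified])
qed

text \<open>The ratio to (Q;Q) is invariant under Q -> Q^4, hence equal to its limit along Q^(4^k)
  -> 0, and that limit is 1.\<close>

lemma jacobi_const_eq:
  assumes Q: "Q \<noteq> 0" "norm Q < 1"
  shows "jacobi_const Q = euler_prod Q 1"
proof -
  define g where "g Q = jacobi_const Q / euler_prod Q 1" for Q
  have iter: "g Q = g (Q ^ (4 ^ k))" for k
  proof (induction k)
    case (Suc k)
    have "g (Q ^ (4 ^ k)) = g ((Q ^ (4 ^ k)) ^ 4)"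
      unfolding g_def using nome_power[OF Q, of "4 ^ k"] by (intro jacobi_const_power_4) auto
    with Suc show ?case by (simp add: power_mult[symmetric] mult.commute)
  qed simp
  have "(\<lambda>q. ramanujan_psi q - 1) \<midarrow>0\<rightarrow> 0"
  proof (rule Lim_null_comparison)
    show "\<forall>\<^sub>F q in at 0. norm (ramanujan_psi q - 1) \<le> norm q / (1 - norm q)"
    proof -
      have "\<forall>\<^sub>F q in at (0::complex). q \<in> ball 0 1"
        by (intro eventually_at_in_open') auto
      thus ?thesis by eventually_elim (use ramanujan_psi_has_sum(2) in auto)
    qed
    show "((\<lambda>q::complex. norm q / (1 - norm q)) \<longlongrightarrow> 0) (at 0)"
      by (auto intro!: tendsto_eq_intros)
  qed
  hence psi: "ramanujan_psi \<midarrow>0\<rightarrow> 1" by (simp add: LIM_zero_iff)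
  have cont: "(\<lambda>q. F q n) \<midarrow>0\<rightarrow> F 0 n" if "(\<lambda>q. F q n) holomorphic_on ball 0 1" for F :: "complex \<Rightarrow> nat \<Rightarrow> complex" and n
    using holomorphic_on_imp_continuous_on[OF that] by (auto simp: continuous_on_eq_continuous_at isCont_def)
  have "g \<midarrow>0\<rightarrow> 1 * 1\<^sup>2 / 1"
    unfolding g_def jacobi_const_def
    using cont[of odd_prod 1] cont[of euler_prod 1] odd_prod_holomorphic[of 1] euler_prod_holomorphic[of 1]
    by (intro tendsto_intros psi) auto
  moreover have "filterlim (\<lambda>k. Q ^ (4 ^ k)) (at 0) sequentially"
  proof -
    have "(\<lambda>n. Q ^ n) \<longlonglongrightarrow> 0" using Q by (intro LIMSEQ_power_zero)
    moreover have "strict_mono (\<lambda>k. 4 ^ k :: nat)" by (auto simp: strict_mono_def)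
    ultimately have "(\<lambda>k. Q ^ (4 ^ k)) \<longlonglongrightarrow> 0"
      using LIMSEQ_subseq_LIMSEQ[of "\<lambda>n. Q ^ n" 0 "\<lambda>k. 4 ^ k"] by (simp add: o_def)
    thus ?thesis using Q by (simp add: filterlim_at)
  qed
  ultimately have "(\<lambda>k. g (Q ^ (4 ^ k))) \<longlonglongrightarrow> 1 * 1\<^sup>2 / 1"
    by (rule filterlim_compose)
  hence "(\<lambda>k::nat. g Q) \<longlonglongrightarrow> 1" unfolding iter[symmetric] by simp
  hence "g Q = 1" by (simp add: LIMSEQ_const_iff)
  thus ?thesis using euler_prod_nonzero[OF Q, of 1] by (simp add: g_def)
qed

theorem Jacobi_triple_product:
  assumes "Q \<noteq> 0" "norm Q < 1" "y \<noteq> 0" "theta Q (-y) \<noteq> 0"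
  shows "jacobi_sum Q y = euler_prod Q 1 * theta Q (-y)"
  using jacobi_sum_eq_const[OF assms] jacobi_const_eq[OF assms(1,2)] by simp

theorem ramanujan_psi_eq:
  assumes Q: "Q \<noteq> 0" "norm Q < 1"
  shows "ramanujan_psi Q = psi_prod Q 1"
proof -
  have "ramanujan_psi Q * (odd_prod Q 1)\<^sup>2 = euler_prod Q 1"
    using jacobi_const_eq[OF Q] by (simp add: jacobi_const_def)
  thus ?thesis
    using euler_prod_eq[OF Q, of 1] odd_prod_nonzero[OF Q, of 1]
    by (simp add: psi_prod_def field_simps power2_eq_square)
qed

text \<open>Split 2 \<psi>(q) = \<Sum> q^(n (n - 1) / 2), over all integers n, modulo 3. The classes
  0 and 1 are exchanged by n -> 1 - n, and each is a triple product at y = q^6 for the nome q^9; the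
  class 2 gives 2 q \<psi>(q^9).\<close>

lemma psi_prod_dissection:
  assumes q: "q \<noteq> 0" "norm q < 1"
  shows "psi_prod q 1 - q * psi_prod q 9 = (odd_prod q 9)\<^sup>2 * euler_prod q 18 / odd_prod q 3"
proof -
  have q9: "q ^ 9 \<noteq> 0" "norm (q ^ 9) < 1" and q3: "q ^ 3 \<noteq> 0" "norm (q ^ 3) < 1"
    using nome_power[OF q, of 9] nome_power[OF q, of 3] by auto
  define f where "f n = 1 powi n * q ^ triangle n" for n
  have sum: "f summable_on S" for S
    unfolding f_def by (intro jacobi_summable[OF q]) auto
  have t0: "int (triangle (3 * k)) = 9 * int (triangle (1 - k)) + 6 * (- k) + 9 * k" for k
    using triangle_eq[of "3 * k"] triangle_eq[of "1 - k"] by (simp add: algebra_simps)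
  have t1: "int (triangle (3 * k + 1)) = 9 * int (triangle k) + 6 * k" for k
    using triangle_eq[of "3 * k + 1"] triangle_eq[of k] by (simp add: algebra_simps)
  have t0': "triangle (3 * k) = triangle (3 * (-k) + 1)" for k
    using triangle_one_minus[of "3 * k"] by (simp add: algebra_simps)
  have t2: "triangle (3 * k + 2) = 9 * triangle (k + 1) + 1" for k
    using triangle_eq[of "3 * k + 2"] triangle_eq[of "k + 1"] by (simp add: algebra_simps)
  have 1: "(\<Sum>\<^sub>\<infinity>k\<in>UNIV. f (3 * k + 1)) = jacobi_sum (q ^ 9) (q ^ 6)"
    unfolding jacobi_sum_def
  proof (rule infsum_cong)
    fix k :: int
    have "q ^ triangle (3 * k + 1) = q powi (9 * int (triangle k) + 6 * k)"
      by (simp only: t1[symmetric] power_int_of_nat)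
    also have "9 * int (triangle k) = int (9 * triangle k)" by simp
    also have "q powi (int (9 * triangle k) + 6 * k) = q powi int (9 * triangle k) * q powi (6 * k)"
      by (rule power_int_add) (use q in simp)
    also have "q powi int (9 * triangle k) = (q ^ 9) ^ triangle k"
      by (simp only: power_int_of_nat power_mult)
    also have "q powi (6 * k) = (q ^ 6) powi k"
      by (simp only: power_int_mult power_int_numeral)
    finally show "f (3 * k + 1) = (q ^ 6) powi k * (q ^ 9) ^ triangle k"
      by (simp add: f_def mult.commute)
  qed
  have 0: "(\<Sum>\<^sub>\<infinity>k\<in>UNIV. f (3 * k)) = (\<Sum>\<^sub>\<infinity>k\<in>UNIV. f (3 * k + 1))"
    by (rule infsum_reindex_bij_witness[of _ uminus uminus]) (auto simp: f_def t0')
  have 2: "(\<Sum>\<^sub>\<infinity>k\<in>UNIV. f (3 * k + 2)) = q * jacobi_sum (q ^ 9) 1"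
    unfolding jacobi_sum_def infsum_cmult_right'[symmetric]
    by (rule infsum_reindex_bij_witness[of _ "\<lambda>k. k - 1" "\<lambda>k. k + 1"]) (auto simp: f_def t2 power_mult)
  have "2 * ramanujan_psi q = (\<Sum>j<3. \<Sum>\<^sub>\<infinity>k\<in>UNIV. f (int 3 * k + int j))"
    unfolding jacobi_sum_1[OF q, symmetric] jacobi_sum_def f_def[symmetric] by (rule infsum_int_split[OF sum]) simp
  also have "\<dots> = (\<Sum>\<^sub>\<infinity>k\<in>UNIV. f (3 * k)) + (\<Sum>\<^sub>\<infinity>k\<in>UNIV. f (3 * k + 1)) + (\<Sum>\<^sub>\<infinity>k\<in>UNIV. f (3 * k + 2))"
    by (simp add: numeral_3_eq_3)
  also have "\<dots> = 2 * jacobi_sum (q ^ 9) (q ^ 6) + q * (2 * ramanujan_psi (q ^ 9))"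
    unfolding 0 1 2 jacobi_sum_1[OF q9] by simp
  finally have "2 * ramanujan_psi q = 2 * (jacobi_sum (q ^ 9) (q ^ 6) + q * ramanujan_psi (q ^ 9))"
    by (simp add: algebra_simps)
  hence "ramanujan_psi q = jacobi_sum (q ^ 9) (q ^ 6) + q * ramanujan_psi (q ^ 9)"
    by (simp only: mult_cancel_left) simp
  hence psi: "ramanujan_psi q - q * ramanujan_psi (q ^ 9) = jacobi_sum (q ^ 9) (q ^ 6)"
    by simp
  have th: "theta (q ^ 9) (- (q ^ 6)) = odd_prod q 9 / odd_prod q 3"
    using theta_eq_theta_pow[OF q3, of "-1" 2 3] theta_pow_sym[OF q3, of 1 3 "-1"] theta_pow_3_minus[OF q3]
    by (simp add: power_mult[symmetric] odd_prod_power[of q 3 1, simplified] odd_prod_power[of q 3 3, simplified])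
  hence "jacobi_sum (q ^ 9) (q ^ 6) = euler_prod q 9 * (odd_prod q 9 / odd_prod q 3)"
    using Jacobi_triple_product[OF q9, of "q ^ 6"] q odd_prod_nonzero[OF q, of 9] odd_prod_nonzero[OF q, of 3]
      euler_prod_power[of q 9 1] by simp
  moreover have "ramanujan_psi (q ^ 9) = psi_prod q 9"
    using ramanujan_psi_eq[OF q9] by (simp add: psi_prod_def euler_prod_power odd_prod_power)
  ultimately show ?thesis
    using psi ramanujan_psi_eq[OF q] euler_prod_eq[OF q, of 9] by (simp add: power2_eq_square)
qed

text \<open>\<open>level_6_cube\<close> at q^3 and the cube of the 3-dissection consist of the same
  products, which gives q \<psi>(q^3)^4 - y^4 = y (x - y)^3; on expansion y^4 drops out.\<close>

lemma level_18_cube: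
  assumes q: "q \<noteq> 0" "norm q < 1"
  defines "x \<equiv> psi_prod q 1" and "y \<equiv> q * psi_prod q 9"
  shows "q * psi_prod q 3 ^ 4 = x * y * (x\<^sup>2 - 3 * x * y + 3 * y\<^sup>2)"
proof -
  have q3: "q ^ 3 \<noteq> 0" "norm (q ^ 3) < 1" using nome_power[OF q, of 3] by auto
  note nz = odd_prod_nonzero[OF q, of 9] odd_prod_nonzero[OF q, of 3]
  have "psi_prod (q ^ 3) 1 = psi_prod q 3" "psi_prod (q ^ 3) 3 = psi_prod q 9"
    by (simp_all add: psi_prod_def euler_prod_power odd_prod_power)
  hence "psi_prod q 3 ^ 4 - q ^ 3 * psi_prod q 9 ^ 4 = euler_prod q 18 ^ 4 * odd_prod q 9 ^ 5 / odd_prod q 3 ^ 3"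
    using level_6_cube[OF q3] by (simp add: euler_prod_power odd_prod_power)
  hence "q * psi_prod q 3 ^ 4 - y ^ 4 = q * (euler_prod q 18 ^ 4 * odd_prod q 9 ^ 5 / odd_prod q 3 ^ 3)"
    by (simp add: y_def power_mult_distrib algebra_simps eval_nat_numeral)
  also have "\<dots> = y * (x - y) ^ 3"
  proof -
    have xy: "x - y = (odd_prod q 9)\<^sup>2 * euler_prod q 18 / odd_prod q 3"
      using psi_prod_dissection[OF q] by (simp add: x_def y_def)
    show ?thesis
      unfolding xy unfolding y_def psi_prod_def using nz by (simp add: field_simps eval_nat_numeral)
  qed
  finally show ?thesis by algebra
qed

section \<open>Powers of the nome and square root branches\<close>

lemma qpow_add: "qpow (r + s) z = qpow r z * qpow s z"
  by (simp add: qpow_def of_rat_add algebra_simps exp_add)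

lemma qpow_nonzero [simp]: "qpow r z \<noteq> 0"
  by (simp add: qpow_def)

lemma qpow_of_nat_mult: "qpow (of_nat n * r) z = qpow r z ^ n"
  by (simp add: qpow_def of_rat_mult exp_of_nat_mult[symmetric] mult_ac)

lemma qpow_of_nat_arg: "qpow r (of_nat n * z) = qpow r z ^ n"
  by (simp add: qpow_def exp_of_nat_mult[symmetric] mult_ac)

lemma norm_qpow: "norm (qpow r z) = exp (- 2 * pi * of_rat r * Im z)"
proof -
  have "Re (2 * of_real pi * \<i> * of_rat r * z) = - 2 * pi * of_rat r * Im z"
    by (cases r rule: Rat_cases) (simp add: of_rat_rat complex_eq_iff)
  thus ?thesis by (simp add: qpow_def)
qed

lemma qpow_imaginary: "qpow r (\<i> * of_real y) = of_real (exp (- 2 * pi * of_rat r * y))"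
proof -
  have "(of_rat r :: complex) = of_real (of_rat r)"
    by (cases r rule: Rat_cases) (simp add: of_rat_rat)
  hence "2 * of_real pi * \<i> * of_rat r * (\<i> * of_real y) = of_real (- 2 * pi * of_rat r * y)"
    by (simp add: mult_ac)
  thus ?thesis by (simp only: qpow_def exp_of_real)
qed

text \<open>On the imaginary axis every \<open>qpow r\<close> is real and positive, and dividing s
  by it leaves a power series in q^(1/N) that tends to \<open>a 0\<close>. So the condition on the
  leading coefficient becomes a sign at actual points.\<close>

lemma is_sqrt_branch_Re_pos:
  assumes "is_sqrt_branch F s"
  shows "\<forall>\<^sub>F y in at_top. Re (s (\<i> * of_real y)) > 0"
proof -
  obtain N :: nat and r :: rat and a :: "nat \<Rightarrow> complex" where
    N: "N > 0" and a: "Re (a 0) > 0"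
    and s: "\<And>z. z \<in> upper_half \<Longrightarrow> (\<lambda>n. a n * qpow (r + of_nat n / of_nat N) z) sums s z"
    using assms unfolding is_sqrt_branch_def by blast
  define X where "X = qpow (1 / of_nat N)"
  define p where "p x = (\<Sum>n. a n * x ^ n)" for x
  have eq: "a n * qpow (r + of_nat n / of_nat N) z = qpow r z * (a n * X z ^ n)" for n z
    using qpow_of_nat_mult[of n "1 / of_nat N" z] by (simp add: qpow_add X_def)
  have sums: "(\<lambda>n. a n * X z ^ n) sums (s z / qpow r z)" if "z \<in> upper_half" for z
    using sums_divide[OF s[OF that], of "qpow r z"] by (simp add: eq)
  have sz: "s z = qpow r z * p (X z)" if "z \<in> upper_half" for z
    using sums_unique[OF sums[OF that]] by (simp add: p_def nonzero_divide_eq_eq mult.commute)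
  have "\<i> \<in> upper_half" by (simp add: upper_half_def)
  have "isCont p 0"
    unfolding p_def
    by (rule isCont_powser[OF sums_summable[OF sums[OF \<open>\<i> \<in> upper_half\<close>]]]) (simp add: X_def)
  moreover have "p 0 = a 0"
    using powser_zero[of a] by (simp add: p_def)
  ultimately have p: "(p \<longlongrightarrow> a 0) (nhds 0)"
    by (metis isCont_def tendsto_at_iff_tendsto_nhds)
  have "((\<lambda>y. X (\<i> * of_real y)) \<longlongrightarrow> 0) at_top"
  proof (rule tendsto_norm_zero_cancel)
    have "filterlim (\<lambda>y. 2 * pi / N * y) at_top at_top"
      by (rule filterlim_tendsto_pos_mult_at_top[OF tendsto_const _ filterlim_ident]) (use N in auto)
    hence "filterlim (\<lambda>y. - (2 * pi / N * y)) at_bot at_top"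
      by (simp only: filterlim_uminus_at_top)
    hence "((\<lambda>y. exp (- (2 * pi / N * y))) \<longlongrightarrow> 0) at_top"
      by (rule filterlim_compose[OF exp_at_bot])
    moreover have "norm (X (\<i> * of_real y)) = exp (- (2 * pi / N * y))" for y
      by (simp add: X_def norm_qpow of_rat_divide)
    ultimately show "((\<lambda>y. norm (X (\<i> * of_real y))) \<longlongrightarrow> 0) at_top" by simp
  qed
  hence "((\<lambda>y. Re (p (X (\<i> * of_real y)))) \<longlongrightarrow> Re (a 0)) at_top"
    by (intro tendsto_Re filterlim_compose[OF p])
  hence "\<forall>\<^sub>F y in at_top. Re (p (X (\<i> * of_real y))) > 0"
    using a by (rule order_tendstoD)
  moreover have "\<forall>\<^sub>F y in at_top. (y::real) > 0" by (rule eventually_gt_at_top)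
  ultimately show ?thesis
  proof eventually_elim
    case (elim y)
    hence "\<i> * of_real y \<in> upper_half" by (simp add: upper_half_def)
    from sz[OF this] elim show ?case by (simp add: qpow_imaginary)
  qed
qed

lemma open_upper_half: "open upper_half"
  unfolding upper_half_def by (rule open_halfspace_Im_gt)

lemma connected_upper_half: "connected upper_half"
  unfolding upper_half_def by (rule connected_halfspace_Im_gt)

text \<open>Equal squares force s = t wherever s + t is nonzero. High up on the imaginary axis both
  real parts are positive, so this open set is nonempty, and analytic continuation does the
  rest.\<close>

lemma is_sqrt_branch_unique:
  assumes s: "is_sqrt_branch F s" and t: "is_sqrt_branch F t" and z: "z \<in> upper_half"
  shows "s z = t z"
proof -
  have hol: "s holomorphic_on upper_half" "t holomorphic_on upper_half"
    and sq: "\<And>z. z \<in> upper_half \<Longrightarrow> (s z)\<^sup>2 = (t z)\<^sup>2"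
    using s t by (auto simp: is_sqrt_branch_def)
  have "\<forall>\<^sub>F y in at_top. y > 0 \<and> Re (s (\<i> * of_real y)) > 0 \<and> Re (t (\<i> * of_real y)) > 0"
    using is_sqrt_branch_Re_pos[OF s] is_sqrt_branch_Re_pos[OF t] eventually_gt_at_top[of "0::real"]
    by eventually_elim auto
  then obtain y :: real where y: "y > 0" "Re (s (\<i> * of_real y)) > 0" "Re (t (\<i> * of_real y)) > 0"
    using eventually_happens'[OF trivial_limit_at_top_linorder] by blast
  define w where "w = \<i> * of_real y"
  have w: "w \<in> upper_half" using y by (simp add: w_def upper_half_def)
  have "Re (s w + t w) \<noteq> 0" using y by (simp add: w_def)
  hence nz: "s w + t w \<noteq> 0" by (metis zero_complex.sel(1))
  have "continuous_on upper_half (\<lambda>z. s z + t z)"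
    by (intro continuous_intros holomorphic_on_imp_continuous_on hol)
  hence op: "open (upper_half \<inter> (\<lambda>z. s z + t z) -` (-{0}))"
    by (intro continuous_open_preimage open_upper_half) auto
  show ?thesis
  proof (rule analytic_continuation_open[OF op open_upper_half _ connected_upper_half _ hol])
    show "upper_half \<inter> (\<lambda>z. s z + t z) -` (-{0}) \<noteq> {}" using w nz by auto
    fix x assume x: "x \<in> upper_half \<inter> (\<lambda>z. s z + t z) -` (-{0})"
    have "(s x - t x) * (s x + t x) = 0"
      using sq[of x] x by (simp add: power2_eq_square algebra_simps)
    thus "s x = t x" using x by simp
  qed (use z in auto)
qed

lemma equals_times_sqrtI:
  assumes "is_sqrt_branch F s" "\<And>z. z \<in> upper_half \<Longrightarrow> G z = c z * s z"
  shows "equals_times_sqrt G c F"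
  unfolding equals_times_sqrt_def using assms is_sqrt_branch_unique by metis

lemma nome_in_disc: "z \<in> upper_half \<Longrightarrow> nome z \<noteq> 0 \<and> norm (nome z) < 1"
  by (simp add: norm_qpow upper_half_def)

lemma nome_holomorphic [holomorphic_intros]: "qpow r holomorphic_on A"
  unfolding qpow_def[abs_def] by (intro holomorphic_intros)

lemma holomorphic_on_nome:
  assumes "h holomorphic_on ball 0 1"
  shows "(\<lambda>z. h (nome z)) holomorphic_on upper_half"
proof -
  have "(h \<circ> nome) holomorphic_on upper_half"
    by (rule holomorphic_on_compose_gen[OF nome_holomorphic assms]) (use nome_in_disc in auto)
  thus ?thesis by (simp add: o_def)
qed

text \<open>Existence of the branch for an explicitly known root: the Taylor coefficients of
  \<open>h\<close> at 0 provide the expansion, with N = 1.\<close>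

lemma is_sqrt_branch_power_series:
  assumes h: "h holomorphic_on ball 0 1" "h 0 = 1"
    and F: "\<And>z. z \<in> upper_half \<Longrightarrow> (qpow r z * h (nome z))\<^sup>2 = F z"
  shows "is_sqrt_branch F (\<lambda>z. qpow r z * h (nome z))"
  unfolding is_sqrt_branch_def
proof (intro conjI ballI F)
  show "(\<lambda>z. qpow r z * h (nome z)) holomorphic_on upper_half"
    by (intro holomorphic_intros holomorphic_on_nome h)
  define a where "a n = (deriv ^^ n) h 0 / fact n" for n
  have "(\<lambda>n. a n * qpow (r + of_nat n / of_nat 1) z) sums (qpow r z * h (nome z))" if "z \<in> upper_half" for z
  proof -
    have "(\<lambda>n. a n * nome z ^ n) sums h (nome z)"
      using holomorphic_power_series[OF h(1), of "nome z"] nome_in_disc[OF that] by (simp add: a_def)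
    from sums_mult[OF this, of "qpow r z"] show ?thesis
      using qpow_of_nat_mult[of _ 1 z] by (simp add: qpow_add mult_ac)
  qed
  moreover have "a 0 = 1" using h(2) by (simp add: a_def)
  ultimately show "\<exists>N r' a. N > 0 \<and> a 0 \<in> \<real> \<and> Re (a 0) > 0 \<and>
      (\<forall>z\<in>upper_half. (\<lambda>n. a n * qpow (r' + of_nat n / of_nat N) z) sums (qpow r z * h (nome z)))"
    by (intro exI[of _ 1] exI[of _ r] exI[of _ a]) auto
qed auto

section \<open>Sums of cubes\<close>

text \<open>The closed form of \<Sum> n^3 u^n, with the Eulerian polynomial 1 + 4 u + u^2;
  equivalently u d/du applied twice to \<open>koebe\<close>.\<close>

definition cubic_koebe :: "complex \<Rightarrow> complex" where
  "cubic_koebe u = u * (1 + 4 * u + u\<^sup>2) / (1 - u) ^ 4"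

text \<open>The second difference of \<open>koebe\<close> in the variable \<open>\<sigma> = (1 - y)\<^sup>2 / y\<close>, divided by \<open>\<sigma>\<close>.\<close>
definition koebe_diff2 :: "complex \<Rightarrow> complex \<Rightarrow> complex" where
  "koebe_diff2 u \<sigma> = u * ((1 - u)\<^sup>2 * (1 + 4 * u + u\<^sup>2) - 2 * u\<^sup>2 * \<sigma>) /
      ((1 - u)\<^sup>2 * ((1 - u)\<^sup>2 - u * \<sigma>)\<^sup>2)"

lemma koebe_diff2_0: "u \<noteq> 1 \<Longrightarrow> koebe_diff2 u 0 = cubic_koebe u"
proof -
  assume "u \<noteq> 1"
  hence "1 - u \<noteq> 0" by simp
  moreover have "u * (w\<^sup>2 * p) / (w\<^sup>2 * (w\<^sup>2)\<^sup>2) = u * p / w ^ 4" if "w \<noteq> 0" for w p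
    using that by (simp add: field_simps eval_nat_numeral)
  ultimately show ?thesis
    by (simp only: koebe_diff2_def cubic_koebe_def mult_zero_right diff_zero)
qed

text \<open>The left side is invariant under y -> 1/y and hence a function of \<sigma>; in fact (1 -
  u y) (1 - u / y) = (1 - u)^2 - u \<sigma>. The factor \<sigma> carries its double zero at y =
  1.\<close>

lemma koebe_diff2_eq:
  assumes y: "y \<noteq> 0" and u: "u \<noteq> 1" "u * y \<noteq> 1" "u \<noteq> y"
  shows "koebe (u * y) + koebe (u / y) - 2 * koebe u = (1 - y)\<^sup>2 / y * koebe_diff2 u ((1 - y)\<^sup>2 / y)"
proof -
  define a b w where "a = 1 - u * y" and "b = y - u" and "w = 1 - u"
  have nz: "a \<noteq> 0" "b \<noteq> 0" "w \<noteq> 0" using u by (auto simp: a_def b_def w_def)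
  define D where "D = (1 - u)\<^sup>2 - u * ((1 - y)\<^sup>2 / y)"
  have D: "D = a * b / y"
    using y by (simp add: D_def a_def b_def field_simps power2_eq_square)
  have 1: "koebe (u * y) = u * y / a\<^sup>2" by (simp add: koebe_def a_def)
  have "1 - u / y = b / y" using y by (simp add: b_def field_simps)
  hence 2: "koebe (u / y) = u * y / b\<^sup>2"
    using y by (simp add: koebe_def power_divide power2_eq_square)
  have 3: "koebe u = u / w\<^sup>2" by (simp add: koebe_def w_def)
  have poly: "(y * (b\<^sup>2 + a\<^sup>2)) * w\<^sup>2 - 2 * (a * b)\<^sup>2 =
      (1 - y)\<^sup>2 * (y * (w\<^sup>2 * (1 + 4 * u + u\<^sup>2)) - 2 * u\<^sup>2 * (1 - y)\<^sup>2)"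
    unfolding a_def b_def w_def by algebra
  have "koebe (u * y) + koebe (u / y) - 2 * koebe u = u * ((y * (b\<^sup>2 + a\<^sup>2)) * w\<^sup>2 - 2 * (a * b)\<^sup>2) / ((a * b)\<^sup>2 * w\<^sup>2)"
    unfolding 1 2 3 using nz by (simp add: field_simps)
  also have "\<dots> = (1 - y)\<^sup>2 / y * (u * (w\<^sup>2 * (1 + 4 * u + u\<^sup>2) - 2 * u\<^sup>2 * ((1 - y)\<^sup>2 / y)) / (w\<^sup>2 * (a * b / y)\<^sup>2))"
    unfolding poly using nz y by (simp add: field_simps power2_eq_square)
  also have "\<dots> = (1 - y)\<^sup>2 / y * koebe_diff2 u ((1 - y)\<^sup>2 / y)"
  proof -
    have "koebe_diff2 u ((1 - y)\<^sup>2 / y) = u * (w\<^sup>2 * (1 + 4 * u + u\<^sup>2) - 2 * u\<^sup>2 * ((1 - y)\<^sup>2 / y)) / (w\<^sup>2 * D\<^sup>2)"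
      by (simp only: koebe_diff2_def D_def w_def)
    thus ?thesis by (simp only: D)
  qed
  finally show ?thesis .
qed

text \<open>The majorant (n + 1) (n + 2) (n + 3) |u|^n comes from the third formal derivative of the
  geometric series, which converges in the same disc.\<close>

lemma summable_cubes:
  fixes u :: "'a :: {real_normed_field, banach}"
  assumes "norm u < 1" "k \<le> 3"
  shows "summable (\<lambda>n. norm (of_nat n ^ k * u ^ n))"
proof -
  have s0: "summable (\<lambda>n. (\<lambda>_. 1) n * x ^ n)" if "norm x < 1" for x :: real
    using that by (simp add: summable_geometric)
  have s1: "summable (\<lambda>n. diffs (\<lambda>_. 1) n * x ^ n)" if "norm x < 1" for x :: real
    by (rule termdiff_converges[OF that s0])
  have s2: "summable (\<lambda>n. diffs (diffs (\<lambda>_. 1)) n * x ^ n)" if "norm x < 1" for x :: real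
    by (rule termdiff_converges[OF that s1])
  have s3: "summable (\<lambda>n. diffs (diffs (diffs (\<lambda>_. 1))) n * x ^ n)" if "norm x < 1" for x :: real
    by (rule termdiff_converges[OF that s2])
  have eq: "diffs (diffs (diffs (\<lambda>_. 1))) n = (real n + 1) * (real n + 2) * (real n + 3)" for n
    by (simp add: diffs_def algebra_simps)
  show ?thesis
  proof (rule summable_comparison_test')
    show "summable (\<lambda>n. (real n + 1) * (real n + 2) * (real n + 3) * norm u ^ n)"
      using s3[of "norm u"] assms unfolding eq by simp
    fix n :: nat assume "n \<ge> 0"
    have "real n ^ k \<le> (real n + 1) ^ k" by (intro power_mono) auto
    also have "\<dots> \<le> (real n + 1) ^ 3" using assms(2) by (intro power_increasing) auto
    also have "\<dots> = (real n + 1) * (real n + 1) * (real n + 1)" by (simp add: power3_eq_cube)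
    also have "\<dots> \<le> (real n + 1) * (real n + 2) * (real n + 3)" by (intro mult_mono) auto
    finally have "real n ^ k * norm u ^ n \<le> (real n + 1) * (real n + 2) * (real n + 3) * norm u ^ n"
      by (intro mult_right_mono) auto
    thus "norm (norm (of_nat n ^ k * u ^ n)) \<le> (real n + 1) * (real n + 2) * (real n + 3) * norm u ^ n"
      by (simp add: norm_mult norm_power)
  qed
qed

text \<open>An index shift gives S_k = u \<Sum> (n + 1)^k u^n; the binomial expansion then reduces
  S_k to lower k, down to the geometric series.\<close>

lemma power_sums:
  fixes u :: complex
  assumes "norm u < 1"
  shows "(\<Sum>n. of_nat n * u ^ n) = koebe u" "(\<Sum>n. of_nat n ^ 3 * u ^ n) = cubic_koebe u"
proof -
  define S where "S k = (\<Sum>n. of_nat n ^ k * u ^ n)" for k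
  have sum: "summable (\<lambda>n. of_nat n ^ k * u ^ n)" if "k \<le> 3" for k
    using summable_norm_cancel[OF summable_cubes[OF assms that]] .
  have u: "1 - u \<noteq> 0" using assms by auto
  have S0: "S 0 = 1 / (1 - u)"
    using suminf_geometric[OF assms] by (simp add: S_def)
  have shift: "S k = u * (\<Sum>n. (of_nat n + 1) ^ k * u ^ n)"
    "summable (\<lambda>n. (of_nat n + 1) ^ k * u ^ n)" if "0 < k" "k \<le> 3" for k
  proof -
    have "k \<noteq> 0" using that by simp
    have 1: "(\<lambda>n. of_nat n ^ k * u ^ n) sums S k"
      unfolding S_def by (rule summable_sums[OF sum[OF that(2)]])
    have "(\<lambda>n. of_nat (Suc n) ^ k * u ^ Suc n) sums (S k - of_nat 0 ^ k * u ^ 0)"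
      using 1 by (subst sums_Suc_iff) simp
    hence 2: "(\<lambda>n. u * ((of_nat n + 1) ^ k * u ^ n)) sums S k"
      using \<open>k \<noteq> 0\<close> by (simp add: mult_ac add.commute power_0_left)
    show 3: "summable (\<lambda>n. (of_nat n + 1) ^ k * u ^ n)"
    proof (cases "u = 0")
      case True
      thus ?thesis by (intro summable_finite[of "{0}"]) auto
    next
      case False
      thus ?thesis using summable_mult[OF sums_summable[OF 2], of "inverse u"]
        by (simp add: mult.assoc[symmetric])
    qed
    show "S k = u * (\<Sum>n. (of_nat n + 1) ^ k * u ^ n)"
      using sums_unique[OF 2] suminf_mult[OF 3] by simp
  qed
  have sums: "(\<lambda>n. of_nat n ^ k * u ^ n) sums S k" if "k \<le> 3" for k
    unfolding S_def by (rule summable_sums[OF sum[OF that]])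
  have "(\<lambda>n. of_nat n ^ 1 * u ^ n + of_nat n ^ 0 * u ^ n) sums (S 1 + S 0)"
    by (intro sums_add sums) auto
  hence "(\<Sum>n. (of_nat n + 1) ^ 1 * u ^ n) = S 1 + S 0"
    by (intro sums_unique[symmetric]) (simp add: algebra_simps)
  hence S1: "S 1 = u * (S 1 + S 0)" using shift(1)[of 1] by simp
  have "(\<lambda>n. of_nat n ^ 2 * u ^ n + 2 * (of_nat n ^ 1 * u ^ n) + of_nat n ^ 0 * u ^ n) sums (S 2 + 2 * S 1 + S 0)"
    by (intro sums_add sums_mult sums) auto
  hence "(\<Sum>n. (of_nat n + 1) ^ 2 * u ^ n) = S 2 + 2 * S 1 + S 0"
    by (intro sums_unique[symmetric]) (simp add: algebra_simps power2_eq_square)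
  hence S2: "S 2 = u * (S 2 + 2 * S 1 + S 0)" using shift(1)[of 2] by simp
  have "(\<lambda>n. of_nat n ^ 3 * u ^ n + 3 * (of_nat n ^ 2 * u ^ n) + 3 * (of_nat n ^ 1 * u ^ n) + of_nat n ^ 0 * u ^ n)
      sums (S 3 + 3 * S 2 + 3 * S 1 + S 0)"
    by (intro sums_add sums_mult sums) auto
  hence "(\<Sum>n. (of_nat n + 1) ^ 3 * u ^ n) = S 3 + 3 * S 2 + 3 * S 1 + S 0"
    by (intro sums_unique[symmetric]) (simp add: algebra_simps power2_eq_square power3_eq_cube)
  hence S3: "S 3 = u * (S 3 + 3 * S 2 + 3 * S 1 + S 0)" using shift(1)[of 3] by simp
  have T0: "(1 - u) * S 0 = 1" using S0 u by simp
  have T1: "(1 - u) ^ 2 * S 1 = u" using S1 T0 by algebra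
  have T2: "(1 - u) ^ 3 * S 2 = u * (1 + u)" using S2 T1 T0 by algebra
  have T3: "(1 - u) ^ 4 * S 3 = u * (1 + 4 * u + u\<^sup>2)" using S3 T2 T1 T0 by algebra
  show "(\<Sum>n. of_nat n * u ^ n) = koebe u"
    using T1 u by (simp add: S_def koebe_def field_simps)
  show "(\<Sum>n. of_nat n ^ 3 * u ^ n) = cubic_koebe u"
    using T3 u by (simp add: S_def cubic_koebe_def field_simps)
qed

lemma power_has_sums:
  fixes u :: complex
  assumes u: "norm u < 1"
  shows "((\<lambda>n. of_nat n ^ 3 * u ^ n) has_sum cubic_koebe u) {1..}"
    and "((\<lambda>n. (if odd n then of_nat n else 0) * u ^ n) has_sum (koebe u - 2 * koebe (u\<^sup>2))) {1..}"
proof -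
  have *: "((\<lambda>n. of_nat n ^ k * u ^ n) has_sum (\<Sum>n. of_nat n ^ k * u ^ n)) {1..}" if "0 < k" "k \<le> 3" "norm u < 1"
    for k and u :: complex
  proof -
    have "((\<lambda>n. of_nat n ^ k * u ^ n) has_sum (\<Sum>n. of_nat n ^ k * u ^ n)) UNIV"
      by (rule norm_summable_imp_has_sum[OF summable_cubes[OF that(3,2)]
            summable_sums[OF summable_norm_cancel[OF summable_cubes[OF that(3,2)]]]])
    also have "?this \<longleftrightarrow> ?thesis"
    proof (rule has_sum_cong_neutral)
      fix n :: nat assume "n \<in> UNIV - {1..}"
      hence "n = 0" by auto
      thus "of_nat n ^ k * u ^ n = 0" using that by simp
    qed auto
    finally show ?thesis .
  qed
  show "((\<lambda>n. of_nat n ^ 3 * u ^ n) has_sum cubic_koebe u) {1..}"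
    using *[of 3 u] u power_sums[OF u] by simp
  have u2: "norm (u\<^sup>2) < 1" using u by (simp add: norm_power power_less_one_iff)
  have all: "((\<lambda>n. of_nat n * u ^ n) has_sum koebe u) {1..}"
    using *[of 1 u] u power_sums[OF u] by simp
  have "((\<lambda>n. 2 * (of_nat n * (u\<^sup>2) ^ n)) has_sum (2 * koebe (u\<^sup>2))) {1..}"
    using *[of 1 "u\<^sup>2"] u2 power_sums[OF u2] by (intro has_sum_cmult_right) simp
  also have "?this \<longleftrightarrow> ((\<lambda>n. of_nat n * u ^ n) has_sum (2 * koebe (u\<^sup>2))) {n. even n \<and> n \<ge> 1}"
  proof (rule has_sum_reindex_bij_witness[of _ "\<lambda>n. n div 2" "\<lambda>n. 2 * n"])
    fix n :: nat assume "n \<in> {n. even n \<and> n \<ge> 1}"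
    then obtain k where k: "n = 2 * k" "k \<ge> 1" by (auto elim!: evenE)
    show "2 * (n div 2) = n" "n div 2 \<in> {1..}" using k by simp_all
  qed (auto simp: power_mult)
  also have "\<dots> \<longleftrightarrow> ((\<lambda>n. (if even n then of_nat n else 0) * u ^ n) has_sum (2 * koebe (u\<^sup>2))) {1..}"
    by (rule has_sum_cong_neutral) auto
  finally have even: "((\<lambda>n. (if even n then of_nat n else 0) * u ^ n) has_sum (2 * koebe (u\<^sup>2))) {1..}" .
  have "((\<lambda>n. of_nat n * u ^ n + - ((if even n then of_nat n else 0) * u ^ n)) has_sum
      (koebe u + - (2 * koebe (u\<^sup>2)))) {1..}"
    by (intro has_sum_add all has_sum_uminusI even)
  also have "?this \<longleftrightarrow> ((\<lambda>n. (if odd n then of_nat n else 0) * u ^ n) has_sum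
      (koebe u + - (2 * koebe (u\<^sup>2)))) {1..}"
    by (rule has_sum_cong) auto
  finally show "((\<lambda>n. (if odd n then of_nat n else 0) * u ^ n) has_sum (koebe u - 2 * koebe (u\<^sup>2))) {1..}"
    by simp
qed

text \<open>Expanding 1 / (1 - q^(2 n)) turns the left side into a double sum over q^(n (2 m + 1)),
  in which n is then summed first. The cubic bound covers the coefficients n^3 of level 2 and those
  of level 4, supported on odd n.\<close>

lemma lambert_double_sum:
  fixes q :: complex and a :: "nat \<Rightarrow> complex"
  assumes q: "norm q < 1" and a: "\<And>n. norm (a n) \<le> real n ^ 3"
    and g: "\<And>m. ((\<lambda>n. a n * (q ^ (2 * m + 1)) ^ n) has_sum g m) {1..}"
  shows "(\<Sum>\<^sub>\<infinity>n\<in>{1..}. a n * q ^ n / (1 - q ^ (2 * n))) = (\<Sum>\<^sub>\<infinity>m\<in>UNIV. g m)"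
proof -
  define f where "f n m = a n * q ^ (n * (2 * m + 1))" for n m
  have inner: "(f n has_sum (a n * q ^ n / (1 - q ^ (2 * n)))) UNIV" if "n \<in> {1..}" for n
  proof -
    have n: "norm (q ^ (2 * n)) < 1" using q that by (simp add: norm_power power_less_one_iff)
    have "((\<lambda>m. (q ^ (2 * n)) ^ m) has_sum (1 / (1 - q ^ (2 * n)))) UNIV"
      using n by (intro norm_summable_imp_has_sum geometric_sums) (simp_all add: norm_power summable_geometric)
    from has_sum_cmult_right[OF this, of "a n * q ^ n"] show ?thesis
      by (simp add: f_def[abs_def] power_add power_mult[symmetric] mult_ac)
  qed
  have outer: "((\<lambda>n. f n m) has_sum g m) {1..}" for m
  proof -
    have "f n m = a n * (q ^ (2 * m + 1)) ^ n" for n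
      by (simp only: f_def power_mult[symmetric] mult.commute)
    thus ?thesis using g[of m] by simp
  qed
  have "(\<lambda>(n, m). real n ^ 3 * norm q ^ n * norm q ^ m) summable_on ({1..} \<times> UNIV)"
  proof (rule summable_on_SigmaI)
    fix n :: nat
    have "((\<lambda>m. norm q ^ m) has_sum (1 / (1 - norm q))) UNIV"
      using q by (intro norm_summable_imp_has_sum geometric_sums) (auto simp: norm_power summable_geometric)
    from has_sum_cmult_right[OF this, of "real n ^ 3 * norm q ^ n"]
    show "((\<lambda>m. case (n, m) of (n, m) \<Rightarrow> real n ^ 3 * norm q ^ n * norm q ^ m) has_sum
        real n ^ 3 * norm q ^ n * (1 / (1 - norm q))) UNIV" by simp
  next
    have "(\<lambda>n. real n ^ 3 * norm q ^ n) summable_on UNIV"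
      using summable_cubes[OF q, of 3] by (intro norm_summable_imp_summable_on) (simp add: norm_mult norm_power)
    hence "(\<lambda>n. real n ^ 3 * norm q ^ n) summable_on {1..}" by (rule summable_on_subset) auto
    thus "(\<lambda>n. real n ^ 3 * norm q ^ n * (1 / (1 - norm q))) summable_on {1..}"
      by (rule summable_on_cmult_left)
  qed auto
  hence "(\<lambda>p. norm ((\<lambda>(n, m). f n m) p)) summable_on ({1..} \<times> UNIV)"
  proof (rule Infinite_Sum.abs_summable_on_comparison_test')
    fix p :: "nat \<times> nat" assume p: "p \<in> {1..} \<times> UNIV"
    obtain n m where [simp]: "p = (n, m)" by (cases p)
    \<comment> \<open>For n >= 1 the mixed exponent dominates n + m, which separates the majorant
      into a product.\<close>
    have "n + m \<le> n * (2 * m + 1)" using p by (cases n) auto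
    hence "norm q ^ (n * (2 * m + 1)) \<le> norm q ^ (n + m)" using q by (intro power_decreasing) auto
    hence "norm (a n) * norm q ^ (n * (2 * m + 1)) \<le> real n ^ 3 * norm q ^ (n + m)"
      using a by (intro mult_mono) auto
    thus "norm ((\<lambda>(n, m). f n m) p) \<le> (\<lambda>(n, m). real n ^ 3 * norm q ^ n * norm q ^ m) p"
      by (simp add: f_def norm_mult norm_power power_add mult.assoc)
  qed
  hence "(\<lambda>(n, m). f n m) summable_on ({1..} \<times> UNIV)"
    by (rule Infinite_Sum.abs_summable_summable)
  hence "(\<Sum>\<^sub>\<infinity>n\<in>{1..}. \<Sum>\<^sub>\<infinity>m\<in>UNIV. f n m) = (\<Sum>\<^sub>\<infinity>m\<in>UNIV. \<Sum>\<^sub>\<infinity>n\<in>{1..}. f n m)"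
    by (rule infsum_swap_banach)
  moreover have "(\<Sum>\<^sub>\<infinity>n\<in>{1..}. \<Sum>\<^sub>\<infinity>m\<in>UNIV. f n m) = (\<Sum>\<^sub>\<infinity>n\<in>{1..}. a n * q ^ n / (1 - q ^ (2 * n)))"
    using infsumI[OF inner] by (intro infsum_cong) auto
  moreover have "(\<Sum>\<^sub>\<infinity>m\<in>UNIV. \<Sum>\<^sub>\<infinity>n\<in>{1..}. f n m) = (\<Sum>\<^sub>\<infinity>m\<in>UNIV. g m)"
    using infsumI[OF outer] by (intro infsum_cong) auto
  ultimately show ?thesis by simp
qed

context
  fixes q :: complex
  assumes q: "q \<noteq> 0" "norm q < 1"
begin

lemma odd_power_bounds:
  "norm (q ^ (2 * m + 1)) \<le> norm q" "norm (q ^ (2 * m + 1)) \<le> norm q ^ m"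
proof -
  show "norm (q ^ (2 * m + 1)) \<le> norm q"
    using q power_decreasing[of 1 "2 * m + 1" "norm q"] by (simp only: norm_power) simp
  show "norm (q ^ (2 * m + 1)) \<le> norm q ^ m"
    unfolding norm_power using q by (intro power_decreasing) auto
qed

text \<open>The index n = - m - 1 contributes the argument y / q^(2 m + 1), the inverse of q^(2 m +
  1) / y; so the bilateral sum folds onto positive odd powers.\<close>

lemma koebe_sum_odd:
  assumes y: "y \<noteq> 0"
  shows "((\<lambda>m. koebe (q ^ (2 * m + 1) * y) + koebe (q ^ (2 * m + 1) / y)) has_sum
           koebe_sum (q\<^sup>2) UNIV (q * y)) UNIV"
proof -
  have q2: "q\<^sup>2 \<noteq> 0" "norm (q\<^sup>2) < 1" using nome_power[OF q, of 2] by auto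
  define f where "f n = koebe (q * y * (q\<^sup>2) powi n)" for n
  have sum: "f summable_on S" for S
    unfolding f_def using q y by (intro koebe_summable'[OF q2]) auto
  have pos: "((\<lambda>m. koebe (q ^ (2 * m + 1) * y)) has_sum infsum f {0..}) UNIV"
  proof -
    have "(f has_sum infsum f {0..}) {0..}" using sum by simp
    also have "?this \<longleftrightarrow> ?thesis"
      by (rule has_sum_reindex_bij_witness[of _ int nat])
         (auto simp: f_def power_int_def power_mult[symmetric] mult_ac)
    finally show ?thesis .
  qed
  have neg: "((\<lambda>m. koebe (q ^ (2 * m + 1) / y)) has_sum infsum f {..-1}) UNIV"
  proof -
    have "(f has_sum infsum f {..-1}) {..-1}" using sum by simp
    also have "?this \<longleftrightarrow> ?thesis"
    proof (rule has_sum_reindex_bij_witness[of _ "\<lambda>m. - int m - 1" "\<lambda>n. nat (- n - 1)"])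
      fix n :: int assume n: "n \<in> {..-1}"
      define m where "m = nat (- n - 1)"
      have nm: "n = - int (Suc m)" using n by (simp add: m_def)
      have "(q\<^sup>2) powi n = inverse (q ^ (2 * Suc m))"
        unfolding nm power_int_minus power_int_of_nat power_mult ..
      hence "q * y * (q\<^sup>2) powi n = inverse (q ^ (2 * m + 1) / y)"
        using q y by (simp add: field_simps)
      thus "koebe (q ^ (2 * nat (- n - 1) + 1) / y) = f n"
        unfolding f_def m_def[symmetric] by (simp only: koebe_inverse)
    qed auto
    finally show ?thesis .
  qed
  have U: "(UNIV :: int set) = {0..} \<union> {..-1}" by auto
  have "koebe_sum (q\<^sup>2) UNIV (q * y) = infsum f UNIV"
    by (simp add: koebe_sum_def f_def[abs_def])
  also have "\<dots> = infsum f ({0..} \<union> {..-1})"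
    by (rule arg_cong[OF U])
  also have "\<dots> = infsum f {0..} + infsum f {..-1}"
    by (rule infsum_Un_disjoint) (use sum in auto)
  finally show ?thesis using has_sum_add[OF pos neg] by simp
qed

lemma koebe_diff2_sum_continuous:
  "isCont (\<lambda>\<sigma>. \<Sum>\<^sub>\<infinity>m\<in>UNIV. koebe_diff2 (q ^ (2 * m + 1)) \<sigma>) 0"
proof -
  define r where "r = (1 - norm q)\<^sup>2"
  have r: "r > 0" "r \<le> 1" using q by (auto simp: r_def power_le_one)
  have w: "r \<le> norm ((1 - q ^ (2 * m + 1))\<^sup>2)" for m
  proof -
    have "1 - norm q \<le> norm (1 - q ^ (2 * m + 1))"
      using norm_triangle_ineq2[of 1 "q ^ (2 * m + 1)"] odd_power_bounds(1)[of m] by simp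
    thus ?thesis unfolding r_def norm_power using q by (intro power_mono) auto
  qed
  have den: "r / 2 \<le> norm ((1 - q ^ (2 * m + 1))\<^sup>2 - q ^ (2 * m + 1) * \<sigma>)" if "norm \<sigma> \<le> r / 2" for m \<sigma>
  proof -
    have "norm (q ^ (2 * m + 1) * \<sigma>) \<le> 1 * (r / 2)"
      unfolding norm_mult using that odd_power_bounds(1)[of m] q by (intro mult_mono) auto
    thus ?thesis
      using w[of m] norm_triangle_ineq2[of "(1 - q ^ (2 * m + 1))\<^sup>2" "q ^ (2 * m + 1) * \<sigma>"] by simp
  qed
  \<comment> \<open>The bracket in the numerator is at most 2^2 times 6 plus 2, that is 26, and the
    denominator is at least r (r/2)^2 = r^3 / 4, which gives 104.\<close>
  have bound: "norm (koebe_diff2 (q ^ (2 * m + 1)) \<sigma>) \<le> 104 / r ^ 3 * norm q ^ m" if \<sigma>: "norm \<sigma> \<le> r / 2" for m \<sigma>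
  proof -
    define u where "u = q ^ (2 * m + 1)"
    have u: "norm u \<le> 1" "norm u \<le> norm q ^ m" using odd_power_bounds[of m] q by (auto simp: u_def)
    have u2: "norm (u\<^sup>2) \<le> 1" using u by (simp add: norm_power power_le_one)
    have "norm (1 - u) \<le> 2" using norm_triangle_ineq4[of 1 u] u by simp
    hence w2: "norm ((1 - u)\<^sup>2) \<le> 2\<^sup>2" unfolding norm_power by (intro power_mono) auto
    have "norm (1 + 4 * u + u\<^sup>2) \<le> norm (1 + 4 * u) + norm (u\<^sup>2)" by (rule norm_triangle_ineq)
    also have "norm (1 + 4 * u) \<le> 1 + norm (4 * u)" using norm_triangle_ineq[of 1 "4 * u"] by simp
    finally have p: "norm (1 + 4 * u + u\<^sup>2) \<le> 6" using u u2 by (simp add: norm_mult)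
    have "norm ((1 - u)\<^sup>2 * (1 + 4 * u + u\<^sup>2)) \<le> 2\<^sup>2 * 6"
      unfolding norm_mult using w2 p by (intro mult_mono) auto
    moreover have "norm (2 * u\<^sup>2 * \<sigma>) \<le> 2 * 1 * 1"
      unfolding norm_mult using u2 \<sigma> r by (intro mult_mono) auto
    ultimately have num: "norm ((1 - u)\<^sup>2 * (1 + 4 * u + u\<^sup>2) - 2 * u\<^sup>2 * \<sigma>) \<le> 26"
      using norm_triangle_ineq4[of "(1 - u)\<^sup>2 * (1 + 4 * u + u\<^sup>2)" "2 * u\<^sup>2 * \<sigma>"] by simp
    have "r * (r / 2)\<^sup>2 \<le> norm ((1 - u)\<^sup>2) * (norm ((1 - u)\<^sup>2 - u * \<sigma>))\<^sup>2"
      using w[of m] den[OF \<sigma>, of m] r unfolding u_def by (intro mult_mono power_mono) auto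
    hence "norm (koebe_diff2 u \<sigma>) \<le> norm u * 26 / (r * (r / 2)\<^sup>2)"
      unfolding koebe_diff2_def norm_divide norm_mult norm_power[of "(1 - u)\<^sup>2 - u * \<sigma>"]
      using num r by (intro frac_le mult_left_mono) auto
    also have "\<dots> = 104 / r ^ 3 * norm u" using r by (simp add: field_simps eval_nat_numeral)
    also have "\<dots> \<le> 104 / r ^ 3 * norm q ^ m" using u r by (intro mult_left_mono) auto
    finally show ?thesis by (simp add: u_def)
  qed
  have "(\<lambda>\<sigma>. \<Sum>\<^sub>\<infinity>m\<in>UNIV. koebe_diff2 (q ^ (2 * m + 1)) \<sigma>) holomorphic_on ball 0 (r / 2)"
  proof (rule holomorphic_on_infsum)
    fix m :: nat
    have "(1 - q ^ (2 * m + 1))\<^sup>2 \<noteq> 0" using w[of m] r by auto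
    moreover have "(1 - q ^ (2 * m + 1))\<^sup>2 - q ^ (2 * m + 1) * \<sigma> \<noteq> 0" if "\<sigma> \<in> ball 0 (r / 2)" for \<sigma>
      using den[of \<sigma> m] that r by auto
    ultimately show "koebe_diff2 (q ^ (2 * m + 1)) holomorphic_on ball 0 (r / 2)"
      unfolding koebe_diff2_def[abs_def] by (intro holomorphic_intros) auto
  next
    fix z :: complex assume z: "z \<in> ball 0 (r / 2)"
    obtain d where d: "d > 0" "cball z d \<subseteq> ball 0 (r / 2)"
      using open_contains_cball[THEN iffD1, OF open_ball, rule_format, OF z] by blast
    have "(\<lambda>m. 104 / r ^ 3 * norm q ^ m) summable_on UNIV"
      using q by (intro summable_on_cmult_right norm_summable_imp_summable_on)
        (simp add: norm_power summable_geometric)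
    moreover have "norm (koebe_diff2 (q ^ (2 * m + 1)) x) \<le> 104 / r ^ 3 * norm q ^ m" if "x \<in> cball z d" for m x
      using bound[of x m] d(2) that by (auto simp: subset_iff)
    ultimately show "\<exists>d>0. \<exists>M F. M summable_on UNIV \<and> finite F \<and>
        (\<forall>n\<in>UNIV - F. \<forall>x\<in>cball z d. norm (koebe_diff2 (q ^ (2 * n + 1)) x) \<le> M n)"
      using d(1) by (intro exI[of _ d] exI[of _ "\<lambda>m. 104 / r ^ 3 * norm q ^ m"] exI[of _ "{}"] conjI ballI) auto
  qed auto
  from holomorphic_on_imp_continuous_on[OF this] show ?thesis
    using r by (auto simp: continuous_on_eq_continuous_at)
qed

text \<open>As q is a half period modulo q^2, p(q y) - p(q) vanishes to second order at y = 1. Its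
  series and its theta product both show the factor \<sigma> = (1 - y)^2 / y; cancelling it leaves
  \<open>G\<close> and \<open>R\<close>, which are compared in the limit y -> 1.\<close>

lemma cubic_koebe_sum: "(\<Sum>\<^sub>\<infinity>m\<in>UNIV. cubic_koebe (q ^ (2 * m + 1))) = q * psi_prod q 1 ^ 8"
proof -
  have q2: "q\<^sup>2 \<noteq> 0" "norm (q\<^sup>2) < 1" using nome_power[OF q, of 2] by auto
  define G where "G \<sigma> = (\<Sum>\<^sub>\<infinity>m\<in>UNIV. koebe_diff2 (q ^ (2 * m + 1)) \<sigma>)" for \<sigma>
  define h where "h = (\<lambda>x. qpochhammer_inf (x * q\<^sup>2) (q\<^sup>2) * qpochhammer_inf (q\<^sup>2 / x) (q\<^sup>2))"
  define R where "R y = euler_prod q 2 ^ 4 * q * (h y)\<^sup>2 / (theta (q\<^sup>2) (q * y) * theta (q\<^sup>2) q)\<^sup>2" for y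
  have thq: "theta (q\<^sup>2) q \<noteq> 0" using theta_power_nonzero[OF q, of 1 2 1] by simp
  have hcont: "isCont h 1"
  proof -
    have hol: "h holomorphic_on -{0}"
      unfolding h_def using q2 by (intro holomorphic_intros) auto
    thus ?thesis
      using holomorphic_on_imp_continuous_on[OF hol] by (auto simp: continuous_on_eq_continuous_at open_Compl)
  qed
  have tcont: "isCont (\<lambda>y. theta (q\<^sup>2) (q * y)) 1"
  proof -
    have hol: "(\<lambda>y. theta (q\<^sup>2) (q * y)) holomorphic_on -{0}"
      using q by (intro theta_holomorphic[OF q2] holomorphic_intros) auto
    thus ?thesis
      using holomorphic_on_imp_continuous_on[OF hol] by (auto simp: continuous_on_eq_continuous_at open_Compl)
  qed
  have "isCont R 1"
    unfolding R_def using thq by (intro continuous_intros hcont tcont) auto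
  hence Rlim: "R \<midarrow>1\<rightarrow> R 1" by (simp add: isCont_def)
  have Glim: "(\<lambda>y. G ((1 - y)\<^sup>2 / y)) \<midarrow>1\<rightarrow> G 0"
  proof -
    have "isCont (\<lambda>y::complex. (1 - y)\<^sup>2 / y) 1" by (intro continuous_intros) auto
    moreover have "isCont G ((1 - 1)\<^sup>2 / 1)"
      using koebe_diff2_sum_continuous by (simp add: G_def[abs_def])
    ultimately have "isCont (\<lambda>y. G ((1 - y)\<^sup>2 / y)) 1" by (rule isCont_o2)
    thus ?thesis by (simp add: isCont_def)
  qed
  have "\<forall>\<^sub>F y in at 1. theta (q\<^sup>2) (q * y) \<noteq> 0"
    using tcont thq by (intro tendsto_imp_eventually_ne[of _ "theta (q\<^sup>2) q"]) (simp_all add: isCont_def)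
  moreover have "\<forall>\<^sub>F y in at (1::complex). y \<in> - {0} - {1}"
    by (intro eventually_at_in_open) auto
  ultimately have ev: "\<forall>\<^sub>F y in at 1. G ((1 - y)\<^sup>2 / y) = R y"
  proof eventually_elim
    case (elim y)
    hence y: "y \<noteq> 0" "y \<noteq> 1" by auto
    define \<sigma> where "\<sigma> = (1 - y)\<^sup>2 / y"
    have \<sigma>: "\<sigma> \<noteq> 0" using y by (simp add: \<sigma>_def)
    have ne: "q ^ (2 * m + 1) \<noteq> 1" "q ^ (2 * m + 1) * y \<noteq> 1" "q ^ (2 * m + 1) \<noteq> y" for m
    proof -
      show "q ^ (2 * m + 1) \<noteq> 1" using odd_power_bounds(1)[of m] q by auto
      have *: "q * y * (q\<^sup>2) powi k \<noteq> 1" for k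
        using elim(1) theta_eq_0_iff[OF q2, of "q * y"] q y by auto
      have "q ^ (2 * m + 1) * y = q * y * (q\<^sup>2) powi int m"
        by (simp add: power_mult[symmetric] mult_ac)
      thus "q ^ (2 * m + 1) * y \<noteq> 1" using * by metis
      show "q ^ (2 * m + 1) \<noteq> y"
      proof
        assume "q ^ (2 * m + 1) = y"
        hence "q * y = q ^ (2 * Suc m)" by auto
        hence "q * y * (q\<^sup>2) powi (- int (Suc m)) = q ^ (2 * Suc m) * inverse (q ^ (2 * Suc m))"
          by (simp only: power_int_minus power_int_of_nat power_mult)
        hence "q * y * (q\<^sup>2) powi (- int (Suc m)) = 1"
          using q by (simp only: right_inverse power_not_zero not_False_eq_True)
        thus False using * by blast
      qed
    qed
    have "((\<lambda>m. (koebe (q ^ (2 * m + 1) * y) + koebe (q ^ (2 * m + 1) / y)) +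
         - (koebe (q ^ (2 * m + 1) * 1) + koebe (q ^ (2 * m + 1) / 1))) has_sum
          (koebe_sum (q\<^sup>2) UNIV (q * y) + - koebe_sum (q\<^sup>2) UNIV (q * 1))) UNIV"
      using y by (intro has_sum_add has_sum_uminusI koebe_sum_odd) auto
    also have "(\<lambda>m. (koebe (q ^ (2 * m + 1) * y) + koebe (q ^ (2 * m + 1) / y)) +
         - (koebe (q ^ (2 * m + 1) * 1) + koebe (q ^ (2 * m + 1) / 1))) =
         (\<lambda>m. \<sigma> * koebe_diff2 (q ^ (2 * m + 1)) \<sigma>)"
      using koebe_diff2_eq[OF y(1) ne] by (simp add: fun_eq_iff \<sigma>_def del: power_Suc)
    finally have "koebe_sum (q\<^sup>2) UNIV (q * y) - koebe_sum (q\<^sup>2) UNIV q = (\<Sum>\<^sub>\<infinity>m\<in>UNIV. \<sigma> * koebe_diff2 (q ^ (2 * m + 1)) \<sigma>)"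
      by (simp add: infsumI)
    also have "\<dots> = \<sigma> * G \<sigma>" by (simp add: G_def infsum_cmult_right')
    finally have L: "koebe_sum (q\<^sup>2) UNIV (q * y) - koebe_sum (q\<^sup>2) UNIV q = \<sigma> * G \<sigma>" .
    have th: "theta (q\<^sup>2) y = (1 - y) * h y" by (simp add: h_def theta_factor[OF q2])
    have form: "theta_form (q\<^sup>2) (q * y) q = q * y * (- theta (q\<^sup>2) y / y) * (- theta (q\<^sup>2) y / y)"
    proof -
      have eqs: "q * y * q = y * q\<^sup>2" "q / (q * y) = inverse y"
        using q y by (simp_all add: power2_eq_square field_simps)
      show ?thesis
        by (simp only: theta_form_def eqs theta_shift[OF q2 y(1)] theta_inverse[OF q2 y(1)])
    qed
    have "\<sigma> * G \<sigma> = euler_prod q 2 ^ 4 * (q * y * (- theta (q\<^sup>2) y / y) * (- theta (q\<^sup>2) y / y)) /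
        (theta (q\<^sup>2) (q * y) * theta (q\<^sup>2) q)\<^sup>2"
      unfolding L[symmetric] form[symmetric] euler_prod_def
      using koebe_sum_diff_theta_form[OF q2, of "q * y" q] q y elim(1) thq by simp
    also have "\<dots> = \<sigma> * R y"
      unfolding th R_def \<sigma>_def using y thq elim(1) by (simp add: power2_eq_square)
    finally show ?case using \<sigma> by (simp add: \<sigma>_def)
  qed
  have "G 0 = R 1"
    by (rule tendsto_unique[OF _ Glim]) (use Rlim tendsto_cong[OF ev] in auto)
  moreover have "G 0 = (\<Sum>\<^sub>\<infinity>m\<in>UNIV. cubic_koebe (q ^ (2 * m + 1)))"
  proof -
    have "q ^ (2 * m + 1) \<noteq> 1" for m using odd_power_bounds(1)[of m] q by auto
    thus ?thesis unfolding G_def by (intro infsum_cong koebe_diff2_0)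
  qed
  moreover have "R 1 = q * psi_prod q 1 ^ 8"
  proof -
    have "theta (q\<^sup>2) q = (odd_prod q 1)\<^sup>2"
      using theta_eq_theta_pow[OF q, of 1 1 2] theta_pow_half[OF q, of 1] by simp
    moreover have "h 1 = (euler_prod q 2)\<^sup>2" by (simp add: h_def euler_prod_def power2_eq_square)
    ultimately show ?thesis
      using odd_prod_nonzero[OF q, of 1] by (simp add: R_def psi_prod_def field_simps eval_nat_numeral)
  qed
  ultimately show ?thesis by simp
qed

end

section \<open>The identities\<close>

lemma psi_prod_power: "psi_prod (q ^ m) n = psi_prod q (m * n)"
  by (simp add: psi_prod_def euler_prod_power odd_prod_power mult.left_commute)

lemma lambert_all_eq: "lambert_all d z = lambert_koebe (nome z ^ d)"
  by (simp add: lambert_all_def lambert_koebe_def koebe_def power_mult)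

section \<open>Levels 2, 4 and 6\<close>

context
  fixes z :: complex
  assumes z: "z \<in> upper_half"
begin

lemma nome_z: "nome z \<noteq> 0" "norm (nome z) < 1"
  using nome_in_disc[OF z] by auto

lemma nome_z_power: "n > 0 \<Longrightarrow> nome z ^ n \<noteq> 0" "n > 0 \<Longrightarrow> norm (nome z ^ n) < 1"
  using nome_power[OF nome_z] by auto

lemma qpow_quarter_4: "qpow (1/4) z ^ 4 = nome z"
  using qpow_of_nat_mult[of 4 "1/4" z] by simp

lemma lambert_odd_eq:
  "d > 0 \<Longrightarrow> lambert_odd d z = lambert_koebe (nome z ^ d) - lambert_koebe (nome z ^ (2 * d))"
  using lambert_odd_koebe[OF nome_z_power, of d]
  by (simp add: lambert_odd_def koebe_def power_mult[symmetric] mult.commute)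

lemma Pi_q_eq:
  assumes "n > 0"
  shows "Pi_q n z = qpow (1/4) z ^ n * (psi_prod (nome z) n)\<^sup>2"
  by (simp add: Pi_q_def Pi_fun_def qpow_of_nat_arg psi_prod_def euler_prod_def odd_prod_def
      power_divide power_mult[symmetric] mult.commute[of n])

lemma sqrt_Pi_q_eq:
  assumes "n > 0"
  shows "sqrt_Pi_q n z = qpow (1/8) z ^ n * psi_prod (nome z) n"
  using ramanujan_psi_eq[OF nome_z_power[OF assms]] qpow_of_nat_mult[of n "1/8" z]
  by (simp add: sqrt_Pi_q_def psi_prod_power)

lemma qpow_eighth: "qpow (1/8) z ^ 8 = nome z"
  using qpow_of_nat_mult[of 8 "1/8" z] by simp

lemma La2_1:
  "Pi_q 1 z ^ 4 =
        6 * (\<Sum>\<^sub>\<infinity>n\<in>{1..}. nome z ^ (4 * n - 2) / (1 - nome z ^ (2 * n - 1)) ^ 4)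
        + (\<Sum>\<^sub>\<infinity>n\<in>{1..}. nome z ^ (2 * n - 1) / (1 - nome z ^ (2 * n - 1)) ^ 2)"
  "Pi_q 1 z ^ 4 = (\<Sum>\<^sub>\<infinity>n\<in>{1..}. of_nat n ^ 3 * nome z ^ n / (1 - nome z ^ (2 * n)))"
proof -
  define q where "q = nome z"
  have q: "q \<noteq> 0" "norm q < 1" using nome_z by (auto simp: q_def)
  have Pi: "Pi_q 1 z ^ 4 = q * psi_prod q 1 ^ 8"
    using qpow_quarter_4 by (simp add: Pi_q_eq power_mult_distrib q_def flip: power_mult)
  show "Pi_q 1 z ^ 4 = (\<Sum>\<^sub>\<infinity>n\<in>{1..}. of_nat n ^ 3 * nome z ^ n / (1 - nome z ^ (2 * n)))"
    unfolding Pi cubic_koebe_sum[OF q, symmetric] unfolding q_def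
  proof (rule lambert_double_sum[symmetric])
    fix m
    have "norm (nome z ^ (2 * m + 1)) < 1" by (rule nome_z_power) simp
    thus "((\<lambda>n. of_nat n ^ 3 * (nome z ^ (2 * m + 1)) ^ n) has_sum cubic_koebe (nome z ^ (2 * m + 1))) {1..}"
      by (rule power_has_sums)
  qed (use nome_z in \<open>auto simp: norm_power\<close>)
  have ne: "q ^ (2 * m + 1) \<noteq> 1" for m using odd_power_bounds(1)[OF q, of m] q by auto
  \<comment> \<open>At y = 1 the folded series contains each term twice, hence the factor
    1/2.\<close>
  have koebe_sum: "(\<lambda>m. koebe (q ^ (2 * m + 1))) summable_on UNIV"
    using has_sum_imp_summable[OF koebe_sum_odd[OF q, of 1]]
      summable_on_cmult_right[of "\<lambda>m. koebe (q ^ (2 * m + 1) * 1) + koebe (q ^ (2 * m + 1) / 1)" UNIV "1/2"]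
    by simp
  have le: "norm (cubic_koebe (q ^ (2 * m + 1))) \<le> 6 / (1 - norm q) ^ 4 * norm q ^ m" for m
  proof -
    define u where "u = q ^ (2 * m + 1)"
    have u: "norm u \<le> norm q" "norm u \<le> norm q ^ m" using odd_power_bounds[OF q, of m] by (auto simp: u_def)
    have u1: "norm u \<le> 1" using u q by simp
    have "norm (1 + 4 * u + u\<^sup>2) \<le> norm (1 + 4 * u) + norm (u\<^sup>2)" by (rule norm_triangle_ineq)
    also have "norm (1 + 4 * u) \<le> 1 + norm (4 * u)" using norm_triangle_ineq[of 1 "4 * u"] by simp
    also have "norm (u\<^sup>2) \<le> 1" using u1 by (simp add: norm_power power_le_one)
    finally have p: "norm (1 + 4 * u + u\<^sup>2) \<le> 6" using u1 by (simp add: norm_mult)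
    have "1 - norm q \<le> norm (1 - u)" using norm_triangle_ineq2[of 1 u] u by simp
    hence "(1 - norm q) ^ 4 \<le> norm (1 - u) ^ 4" using q by (intro power_mono) auto
    hence "norm (cubic_koebe u) \<le> norm q ^ m * 6 / (1 - norm q) ^ 4"
      unfolding cubic_koebe_def norm_divide norm_mult norm_power using p u q
      by (intro frac_le mult_mono) auto
    thus ?thesis by (simp add: u_def mult_ac)
  qed
  have "(\<lambda>m. norm (cubic_koebe (q ^ (2 * m + 1)))) summable_on UNIV"
  proof (rule Infinite_Sum.abs_summable_on_comparison_test'[OF _ le])
    show "(\<lambda>m. 6 / (1 - norm q) ^ 4 * norm q ^ m) summable_on UNIV"
      using q by (intro summable_on_cmult_right norm_summable_imp_summable_on)
        (simp add: norm_power summable_geometric)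
  qed
  hence cubic_sum: "(\<lambda>m. cubic_koebe (q ^ (2 * m + 1))) summable_on UNIV"
    by (rule Infinite_Sum.abs_summable_summable)
  define f where "f m = (q ^ (2 * m + 1)) ^ 2 / (1 - q ^ (2 * m + 1)) ^ 4" for m
  \<comment> \<open>From u (1 + 4 u + u^2) = 6 u^2 + u (1 - u)^2.\<close>
  have eq: "cubic_koebe (q ^ (2 * m + 1)) = 6 * f m + koebe (q ^ (2 * m + 1))" for m
  proof -
    define w where "w = 1 - q ^ (2 * m + 1)"
    have w: "w \<noteq> 0" "q ^ (2 * m + 1) = 1 - w" using ne[of m] by (auto simp: w_def)
    show ?thesis unfolding f_def cubic_koebe_def koebe_def w(2)
      using w(1) by (simp add: field_simps eval_nat_numeral)
  qed
  have "(\<lambda>m. 1 / 6 * (cubic_koebe (q ^ (2 * m + 1)) + - koebe (q ^ (2 * m + 1)))) summable_on UNIV"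
    by (intro summable_on_cmult_right summable_on_add summable_on_uminus[THEN iffD2] koebe_sum cubic_sum)
  hence f: "f summable_on UNIV" unfolding eq by simp
  have "q * psi_prod q 1 ^ 8 = (\<Sum>\<^sub>\<infinity>m\<in>UNIV. 6 * f m + koebe (q ^ (2 * m + 1)))"
    unfolding cubic_koebe_sum[OF q, symmetric] eq ..
  also have "\<dots> = 6 * (\<Sum>\<^sub>\<infinity>m\<in>UNIV. f m) + (\<Sum>\<^sub>\<infinity>m\<in>UNIV. koebe (q ^ (2 * m + 1)))"
    using f koebe_sum by (simp add: infsum_add summable_on_cmult_right infsum_cmult_right')
  also have "(\<Sum>\<^sub>\<infinity>m\<in>UNIV. f m) = (\<Sum>\<^sub>\<infinity>n\<in>{1..}. nome z ^ (4 * n - 2) / (1 - nome z ^ (2 * n - 1)) ^ 4)"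
  proof (rule infsum_reindex_bij_witness[of _ "\<lambda>n. n - 1" "\<lambda>m. m + 1"])
    fix m :: nat
    have "4 * (m + 1) - 2 = (2 * m + 1) * 2" "2 * (m + 1) - 1 = 2 * m + 1" by auto
    thus "nome z ^ (4 * (m + 1) - 2) / (1 - nome z ^ (2 * (m + 1) - 1)) ^ 4 = f m"
      by (simp only: f_def power_mult q_def)
  qed auto
  also have "(\<Sum>\<^sub>\<infinity>m\<in>UNIV. koebe (q ^ (2 * m + 1))) = (\<Sum>\<^sub>\<infinity>n\<in>{1..}. nome z ^ (2 * n - 1) / (1 - nome z ^ (2 * n - 1)) ^ 2)"
  proof (rule infsum_reindex_bij_witness[of _ "\<lambda>n. n - 1" "\<lambda>m. m + 1"])
    fix m :: nat
    have "2 * (m + 1) - 1 = 2 * m + 1" by auto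
    thus "nome z ^ (2 * (m + 1) - 1) / (1 - nome z ^ (2 * (m + 1) - 1))\<^sup>2 = koebe (q ^ (2 * m + 1))"
      by (simp only: koebe_def q_def)
  qed auto
  finally show "Pi_q 1 z ^ 4 =
        6 * (\<Sum>\<^sub>\<infinity>n\<in>{1..}. nome z ^ (4 * n - 2) / (1 - nome z ^ (2 * n - 1)) ^ 4)
        + (\<Sum>\<^sub>\<infinity>n\<in>{1..}. nome z ^ (2 * n - 1) / (1 - nome z ^ (2 * n - 1)) ^ 2)"
    unfolding Pi .
qed

lemma Pi_q_2_square: "Pi_q 2 z ^ 2 = nome z * psi_prod (nome z) 2 ^ 4"
  using qpow_quarter_4 by (simp add: Pi_q_eq power_mult_distrib flip: power_mult)

lemma Pi_q_ratio: "Pi_q 1 z ^ 4 / Pi_q 2 z ^ 2 = psi_prod (nome z) 1 ^ 8 / psi_prod (nome z) 2 ^ 4"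
  using qpow_quarter_4 nome_z by (simp add: Pi_q_eq power_mult_distrib flip: power_mult)

lemma La4_3a: "lambert_odd 1 z - 2 * lambert_odd 2 z = Pi_q 2 z ^ 2"
proof -
  have "lambert_odd 1 z = lambert_koebe (nome z) - lambert_koebe (nome z ^ 2)"
    "lambert_odd 2 z = lambert_koebe (nome z ^ 2) - lambert_koebe (nome z ^ 4)"
    by (simp_all add: lambert_odd_eq)
  thus ?thesis
    using level_4_odd[OF nome_z] unfolding Pi_q_2_square by algebra
qed

text \<open>With coefficients n for odd n and 0 otherwise, the inner sums are
  \<open>koebe u - 2 * koebe (u\<^sup>2)\<close>; summed over u = q^(2 m + 1) they reproduce the
  left side of \<open>level_4_odd\<close>.\<close>

lemma La4_3b:
  "Pi_q 2 z ^ 2 =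
     (\<Sum>\<^sub>\<infinity>n\<in>{1..}. of_nat (2 * n - 1) * nome z ^ (2 * n - 1) / (1 - nome z ^ (4 * n - 2)))"
proof -
  define q where "q = nome z"
  have q: "q \<noteq> 0" "norm q < 1" using nome_z by (auto simp: q_def)
  have q2: "q\<^sup>2 \<noteq> 0" "norm (q\<^sup>2) < 1" using nome_z_power[of 2] by (auto simp: q_def)
  define a where "a n = (if odd n then of_nat n else 0 :: complex)" for n :: nat
  have sum: "(\<lambda>m. koebe (q ^ (2 * m + 1))) summable_on UNIV" if "q \<noteq> 0" "norm q < 1" for q
    using has_sum_imp_summable[OF koebe_sum_odd[OF that, of 1]]
      summable_on_cmult_right[of "\<lambda>m. koebe (q ^ (2 * m + 1) * 1) + koebe (q ^ (2 * m + 1) / 1)" UNIV "1/2"]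
    by simp
  have odd: "(\<Sum>\<^sub>\<infinity>m\<in>UNIV. koebe (q ^ (2 * m + 1))) = lambert_koebe q - lambert_koebe (q\<^sup>2)"
    if "q \<noteq> 0" "norm q < 1" for q
    unfolding lambert_odd_koebe[OF that, symmetric]
    by (rule infsum_reindex_bij_witness[of _ "\<lambda>n. n - 1" "\<lambda>m. m + 1"]) auto
  have "(\<Sum>\<^sub>\<infinity>n\<in>{1..}. a n * q ^ n / (1 - q ^ (2 * n))) =
      (\<Sum>\<^sub>\<infinity>m\<in>UNIV. koebe (q ^ (2 * m + 1)) - 2 * koebe ((q ^ (2 * m + 1))\<^sup>2))"
  proof (rule lambert_double_sum[OF q(2)])
    show "norm (a n) \<le> real n ^ 3" for n
      using self_le_power[of "real n" 3] by (cases "n = 0") (auto simp: a_def)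
    fix m
    have "norm (q ^ (2 * m + 1)) < 1" unfolding q_def by (rule nome_z_power) simp
    thus "((\<lambda>n. a n * (q ^ (2 * m + 1)) ^ n) has_sum koebe (q ^ (2 * m + 1)) - 2 * koebe ((q ^ (2 * m + 1))\<^sup>2)) {1..}"
      unfolding a_def by (rule power_has_sums)
  qed
  also have "(\<lambda>m. koebe (q ^ (2 * m + 1)) - 2 * koebe ((q ^ (2 * m + 1))\<^sup>2)) =
      (\<lambda>m. koebe (q ^ (2 * m + 1)) + (-2) * koebe ((q\<^sup>2) ^ (2 * m + 1)))"
  proof
    fix m
    have "(q ^ (2 * m + 1))\<^sup>2 = (q\<^sup>2) ^ (2 * m + 1)"
      by (simp only: power_mult[symmetric] mult.commute)
    thus "koebe (q ^ (2 * m + 1)) - 2 * koebe ((q ^ (2 * m + 1))\<^sup>2) =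
        koebe (q ^ (2 * m + 1)) + (-2) * koebe ((q\<^sup>2) ^ (2 * m + 1))"
      by (simp only:) simp
  qed
  also have "(\<Sum>\<^sub>\<infinity>m\<in>UNIV. koebe (q ^ (2 * m + 1)) + (-2) * koebe ((q\<^sup>2) ^ (2 * m + 1))) =
      (\<Sum>\<^sub>\<infinity>m\<in>UNIV. koebe (q ^ (2 * m + 1))) + (-2) * (\<Sum>\<^sub>\<infinity>m\<in>UNIV. koebe ((q\<^sup>2) ^ (2 * m + 1)))"
    by (subst infsum_add[OF sum[OF q] summable_on_cmult_right[OF sum[OF q2]]]) (simp only: infsum_cmult_right')
  also have "\<dots> = lambert_koebe q - 3 * lambert_koebe (q\<^sup>2) + 2 * lambert_koebe (q ^ 4)"
    unfolding odd[OF q] odd[OF q2] by (simp add: power_mult[symmetric])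
  also have "\<dots> = Pi_q 2 z ^ 2"
    using level_4_odd[OF q] by (simp add: Pi_q_2_square q_def)
  finally have "(\<Sum>\<^sub>\<infinity>n\<in>{1..}. a n * q ^ n / (1 - q ^ (2 * n))) = Pi_q 2 z ^ 2" .
  moreover have "(\<Sum>\<^sub>\<infinity>n\<in>{1..}. a n * q ^ n / (1 - q ^ (2 * n))) =
      (\<Sum>\<^sub>\<infinity>n\<in>{n. odd n}. of_nat n * q ^ n / (1 - q ^ (2 * n)))"
    by (rule infsum_cong_neutral) (auto simp: a_def Suc_le_eq odd_pos)
  moreover have "(\<Sum>\<^sub>\<infinity>n\<in>{n. odd n}. of_nat n * q ^ n / (1 - q ^ (2 * n))) =
      (\<Sum>\<^sub>\<infinity>n\<in>{1..}. of_nat (2 * n - 1) * nome z ^ (2 * n - 1) / (1 - nome z ^ (4 * n - 2)))"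
  proof (rule infsum_reindex_bij_witness[of _ "\<lambda>n. 2 * n - 1" "\<lambda>n. Suc n div 2"])
    fix n :: nat assume "n \<in> {n. odd n}"
    then obtain k where k: "n = 2 * k + 1" by (auto elim!: oddE)
    show "2 * (Suc n div 2) - 1 = n" "Suc n div 2 \<in> {1..}" using k by auto
    have "2 * (Suc n div 2) - 1 = n" "4 * (Suc n div 2) - 2 = 2 * n" using k by auto
    thus "of_nat (2 * (Suc n div 2) - 1) * nome z ^ (2 * (Suc n div 2) - 1) / (1 - nome z ^ (4 * (Suc n div 2) - 2)) =
        of_nat n * q ^ n / (1 - q ^ (2 * n))"
      by (simp only: q_def)
  qed auto
  ultimately show ?thesis by simp
qed

lemma La4_2: "lambert_all 1 z - 4 * lambert_all 4 z = 1 / 8 * (Pi_q 1 z ^ 4 / Pi_q 2 z ^ 2 - 1)"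
  using level_4_all[OF nome_z] unfolding lambert_all_eq Pi_q_ratio by simp

text \<open>Eight times \<open>La4_2\<close> plus sixteen times \<open>level_4_odd\<close>
  eliminates \<open>lambert_all 4 z\<close>.\<close>

lemma La4_1:
  "lambert_all 1 z - 2 * lambert_all 2 z =
     1 / 24 * (Pi_q 1 z ^ 4 / Pi_q 2 z ^ 2 - 1) + 2 / 3 * Pi_q 2 z ^ 2"
proof -
  have "lambert_all 1 z - 3 * lambert_all 2 z + 2 * lambert_all 4 z = Pi_q 2 z ^ 2"
    using level_4_odd[OF nome_z] by (simp add: lambert_all_eq Pi_q_2_square)
  moreover have "8 * (lambert_all 1 z - 4 * lambert_all 4 z) = Pi_q 1 z ^ 4 / Pi_q 2 z ^ 2 - 1"
    unfolding La4_2 by simp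
  ultimately have "24 * (lambert_all 1 z - 2 * lambert_all 2 z) =
      (Pi_q 1 z ^ 4 / Pi_q 2 z ^ 2 - 1) + 16 * Pi_q 2 z ^ 2"
    by algebra
  thus ?thesis by (simp add: field_simps)
qed

lemma La6_2: "lambert_odd 1 z - 3 * lambert_odd 3 z = Pi_q 1 z * Pi_q 3 z"
proof -
  have "Pi_q 1 z * Pi_q 3 z = nome z * (psi_prod (nome z) 1)\<^sup>2 * (psi_prod (nome z) 3)\<^sup>2"
    using qpow_quarter_4 by (simp add: Pi_q_eq eval_nat_numeral mult_ac)
  moreover have "lambert_odd 1 z = lambert_koebe (nome z) - lambert_koebe (nome z ^ 2)"
    "lambert_odd 3 z = lambert_koebe (nome z ^ 3) - lambert_koebe (nome z ^ 6)"
    by (simp_all add: lambert_odd_eq)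
  ultimately show ?thesis
    using level_6_odd[OF nome_z] by algebra
qed

lemma La6_1:
  "lambert_all 1 z - 3 * lambert_all 3 z =
     (Pi_q 1 z ^ 2 + 3 * Pi_q 3 z ^ 2) ^ 2 / (12 * Pi_q 1 z * Pi_q 3 z) - 1 / 12"
proof -
  define q w x y where qw: "q = nome z" "w = qpow (1/4) z" "x = psi_prod q 1" "y = psi_prod q 3"
  have nz: "q \<noteq> 0" "w \<noteq> 0" "x \<noteq> 0" "y \<noteq> 0"
    using nome_z psi_prod_nonzero[OF nome_z] by (auto simp: qw)
  have w4: "q = w ^ 4" using qpow_quarter_4 by (simp add: qw)
  have Pi: "Pi_q 1 z = w * x\<^sup>2" "Pi_q 3 z = w ^ 3 * y\<^sup>2" by (simp_all add: Pi_q_eq qw)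
  have "lambert_all 1 z - 3 * lambert_all 3 z = (x ^ 4 + 3 * q * y ^ 4)\<^sup>2 / (12 * x\<^sup>2 * y\<^sup>2 * q) * q - 1 / 12"
    using level_6_all[OF nome_z] by (simp add: lambert_all_eq qw)
  \<comment> \<open>The two factors q become the square of w^2 above and w times w^3 below, which
    are the fractional powers contained in the \<open>Pi_q\<close>.\<close>
  also have "(x ^ 4 + 3 * q * y ^ 4)\<^sup>2 / (12 * x\<^sup>2 * y\<^sup>2 * q) * q = (w\<^sup>2 * (x ^ 4 + 3 * q * y ^ 4))\<^sup>2 / (12 * (w * x\<^sup>2) * (w ^ 3 * y\<^sup>2))"
    using nz by (simp add: field_simps eval_nat_numeral)
  also have "w\<^sup>2 * (x ^ 4 + 3 * q * y ^ 4) = Pi_q 1 z ^ 2 + 3 * Pi_q 3 z ^ 2"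
    unfolding Pi w4 by (simp add: algebra_simps eval_nat_numeral)
  finally show ?thesis unfolding Pi .
qed

end

section \<open>Levels 8 to 20: multiples of z and curve relations\<close>

lemma Pi_q_mult: "Pi_q n (of_nat k * z) = Pi_q (n * k) z"
  by (simp add: Pi_q_def mult.assoc)

lemma lambert_all_mult: "lambert_all d (of_nat k * z) = lambert_all (d * k) z"
  unfolding lambert_all_eq qpow_of_nat_arg by (simp only: power_mult[symmetric] mult.commute)

lemma upper_half_mult: "z \<in> upper_half \<Longrightarrow> k > 0 \<Longrightarrow> of_nat k * z \<in> upper_half"
  by (simp add: upper_half_def)

lemma lambert_odd_eq_all: "z \<in> upper_half \<Longrightarrow> d > 0 \<Longrightarrow> lambert_odd d z = lambert_all d z - lambert_all (2 * d) z"
  by (simp add: lambert_odd_eq lambert_all_eq)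

lemma qpow_minus_three_halves: "qpow (-3/2) z * qpow (1/4) z ^ 6 = 1"
proof -
  have "qpow (1/4) z ^ 6 = qpow (3/2) z"
    using qpow_of_nat_mult[of 6 "1/4" z] by simp
  moreover have "qpow (-3/2) z * qpow (3/2) z = qpow (-3/2 + 3/2) z"
    by (rule qpow_add[symmetric])
  ultimately show ?thesis by (simp add: qpow_def)
qed

context
  fixes z :: complex
  assumes z: "z \<in> upper_half"
begin

text \<open>The difference of \<open>La4_2\<close> at z and at 2 z gives the first equation;
  \<open>La4_3a\<close> at z plus twice \<open>La4_3a\<close> at 2 z gives the second.\<close>

lemma La8_1:
  "lambert_odd 1 z - 4 * lambert_odd 4 z =
        1 / 8 * (Pi_q 1 z ^ 4 / Pi_q 2 z ^ 2 - Pi_q 2 z ^ 4 / Pi_q 4 z ^ 2)"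
  "1 / 8 * (Pi_q 1 z ^ 4 / Pi_q 2 z ^ 2 - Pi_q 2 z ^ 4 / Pi_q 4 z ^ 2) = Pi_q 2 z ^ 2 + 2 * Pi_q 4 z ^ 2"
proof -
  have z2: "of_nat 2 * z \<in> upper_half" by (rule upper_half_mult[OF z]) simp
  define L where "L n = lambert_all n z" for n
  define A B where "A = Pi_q 1 z ^ 4 / Pi_q 2 z ^ 2" and "B = Pi_q 2 z ^ 4 / Pi_q 4 z ^ 2"
  have odd: "lambert_odd 1 z = L 1 - L 2" "lambert_odd 2 z = L 2 - L 4" "lambert_odd 4 z = L 4 - L 8"
    using lambert_odd_eq_all[OF z, of 1] lambert_odd_eq_all[OF z, of 2] lambert_odd_eq_all[OF z, of 4]
    by (simp_all add: L_def)
  have 1: "L 1 - 4 * L 4 = 1 / 8 * (A - 1)"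
    unfolding A_def L_def by (rule La4_2[OF z])
  have 2: "L 2 - 4 * L 8 = 1 / 8 * (B - 1)"
    using La4_2[OF z2] unfolding Pi_q_mult lambert_all_mult by (simp add: B_def L_def)
  have 3: "L 1 - L 2 - 2 * (L 2 - L 4) = Pi_q 2 z ^ 2"
    using La4_3a[OF z] unfolding odd .
  have 4: "L 2 - L 4 - 2 * (L 4 - L 8) = Pi_q 4 z ^ 2"
  proof -
    have "lambert_odd 1 (of_nat 2 * z) = L 2 - L 4" "lambert_odd 2 (of_nat 2 * z) = L 4 - L 8"
      using lambert_odd_eq_all[OF z2, of 1] lambert_odd_eq_all[OF z2, of 2]
      unfolding lambert_all_mult by (simp_all add: L_def)
    thus ?thesis using La4_3a[OF z2] unfolding Pi_q_mult by simp
  qed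
  have "8 * (L 1 - 4 * L 4) = A - 1" "8 * (L 2 - 4 * L 8) = B - 1"
    unfolding 1 2 by simp_all
  hence AB: "8 * (L 1 - L 2 - 4 * (L 4 - L 8)) = A - B"
    by algebra
  show "lambert_odd 1 z - 4 * lambert_odd 4 z = 1 / 8 * (Pi_q 1 z ^ 4 / Pi_q 2 z ^ 2 - Pi_q 2 z ^ 4 / Pi_q 4 z ^ 2)"
    unfolding odd A_def[symmetric] B_def[symmetric] AB[symmetric] by simp
  have "L 1 - L 2 - 4 * (L 4 - L 8) = Pi_q 2 z ^ 2 + 2 * Pi_q 4 z ^ 2"
    unfolding 3[symmetric] 4[symmetric] by (simp add: algebra_simps)
  thus "1 / 8 * (Pi_q 1 z ^ 4 / Pi_q 2 z ^ 2 - Pi_q 2 z ^ 4 / Pi_q 4 z ^ 2) = Pi_q 2 z ^ 2 + 2 * Pi_q 4 z ^ 2"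
    unfolding A_def[symmetric] B_def[symmetric] AB[symmetric] by simp
qed

text \<open>One expression is \<open>La4_3a\<close> at z plus twice \<open>La6_2\<close> at 2 z, the
  other \<open>La6_2\<close> at z plus three times \<open>La4_3a\<close> at 3 z.\<close>

lemma La12_1:
  "lambert_odd 1 z - 6 * lambert_odd 6 z = Pi_q 2 z ^ 2 + 2 * Pi_q 2 z * Pi_q 6 z"
  "Pi_q 2 z ^ 2 + 2 * Pi_q 2 z * Pi_q 6 z = Pi_q 1 z * Pi_q 3 z + 3 * Pi_q 6 z ^ 2"
proof -
  have z2: "of_nat 2 * z \<in> upper_half" and z3: "of_nat 3 * z \<in> upper_half"
    by (rule upper_half_mult[OF z]; simp)+
  define L where "L n = lambert_all n z" for n
  have odd: "lambert_odd 1 z = L 1 - L 2" "lambert_odd 2 z = L 2 - L 4" "lambert_odd 3 z = L 3 - L 6" "lambert_odd 6 z = L 6 - L 12"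
    using lambert_odd_eq_all[OF z, of 1] lambert_odd_eq_all[OF z, of 2] lambert_odd_eq_all[OF z, of 3] lambert_odd_eq_all[OF z, of 6]
    by (simp_all add: L_def)
  have 1: "L 1 - L 2 - 2 * (L 2 - L 4) = Pi_q 2 z ^ 2"
    using La4_3a[OF z] unfolding odd .
  have 2: "L 2 - L 4 - 3 * (L 6 - L 12) = Pi_q 2 z * Pi_q 6 z"
  proof -
    have "lambert_odd 1 (of_nat 2 * z) = L 2 - L 4" "lambert_odd 3 (of_nat 2 * z) = L 6 - L 12"
      using lambert_odd_eq_all[OF z2, of 1] lambert_odd_eq_all[OF z2, of 3]
      unfolding lambert_all_mult by (simp_all add: L_def)
    thus ?thesis using La6_2[OF z2] unfolding Pi_q_mult by simp
  qed
  have 3: "L 1 - L 2 - 3 * (L 3 - L 6) = Pi_q 1 z * Pi_q 3 z"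
    using La6_2[OF z] unfolding odd .
  have 4: "L 3 - L 6 - 2 * (L 6 - L 12) = Pi_q 6 z ^ 2"
  proof -
    have "lambert_odd 1 (of_nat 3 * z) = L 3 - L 6" "lambert_odd 2 (of_nat 3 * z) = L 6 - L 12"
      using lambert_odd_eq_all[OF z3, of 1] lambert_odd_eq_all[OF z3, of 2]
      unfolding lambert_all_mult by (simp_all add: L_def)
    thus ?thesis using La4_3a[OF z3] unfolding Pi_q_mult by simp
  qed
  show "lambert_odd 1 z - 6 * lambert_odd 6 z = Pi_q 2 z ^ 2 + 2 * Pi_q 2 z * Pi_q 6 z"
    using 1 2 unfolding odd by algebra
  show "Pi_q 2 z ^ 2 + 2 * Pi_q 2 z * Pi_q 6 z = Pi_q 1 z * Pi_q 3 z + 3 * Pi_q 6 z ^ 2"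
    using 1 2 3 4 by algebra
qed

text \<open>The exponents 1/4 and 5/4 differ by 1, so quotients of \<open>Pi_q 1\<close> and
  \<open>Pi_q 5\<close> contain no fractional powers and the results on the disc apply.\<close>

lemma level_10_quotients:
  defines "q \<equiv> nome z" and "X \<equiv> (psi_prod (nome z) 1)\<^sup>2" and "Y \<equiv> nome z * (psi_prod (nome z) 5)\<^sup>2"
  shows "X \<noteq> 0" "Y \<noteq> 0" "Pi_q 1 z / Pi_q 5 z = X / Y" "Pi_q 5 z / Pi_q 1 z = Y / X"
    "Pi_q 1 z ^ 2 / Pi_q 5 z ^ 2 = (X / Y) ^ 2" "Pi_q 1 z ^ 3 / Pi_q 5 z ^ 3 = (X / Y) ^ 3"
    "lambert_odd 1 z - 5 * lambert_odd 5 z = q * level_10_odd q"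
proof -
  note nz = psi_prod_nonzero[OF nome_z[OF z]]
  show XY: "X \<noteq> 0" "Y \<noteq> 0" using nz nome_z[OF z] by (auto simp: X_def Y_def)
  have 5: "qpow (1/4) z ^ 5 = qpow (1/4) z * nome z"
    unfolding qpow_quarter_4[OF z, symmetric] by (simp add: eval_nat_numeral)
  show P: "Pi_q 1 z / Pi_q 5 z = X / Y"
    using nz nome_z[OF z] by (simp add: Pi_q_eq[OF z] X_def Y_def 5 field_simps)
  show "Pi_q 5 z / Pi_q 1 z = Y / X"
    using arg_cong[OF P, of inverse] by simp
  show "Pi_q 1 z ^ 2 / Pi_q 5 z ^ 2 = (X / Y) ^ 2" "Pi_q 1 z ^ 3 / Pi_q 5 z ^ 3 = (X / Y) ^ 3"
    unfolding P[symmetric] by (simp_all add: power_divide)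
  have odd: "lambert_odd 1 z = lambert_koebe q - lambert_koebe (q ^ 2)"
    "lambert_odd 5 z = lambert_koebe (q ^ 5) - lambert_koebe (q ^ 10)"
    by (simp_all add: lambert_odd_eq[OF z] q_def)
  show "lambert_odd 1 z - 5 * lambert_odd 5 z = q * level_10_odd q"
    unfolding odd using level_10_odd_eq[OF nome_z[OF z]] unfolding q_def by algebra
qed

lemma La10_1:
  "6 * (lambert_all 1 z - 5 * lambert_all 5 z) + 1 =
        (Pi_q 1 z / Pi_q 5 z + 2 + 5 * (Pi_q 5 z / Pi_q 1 z))
        * (lambert_odd 1 z - 5 * lambert_odd 5 z)"
proof -
  define q X Y where qXY: "q = nome z" "X = (psi_prod (nome z) 1)\<^sup>2" "Y = nome z * (psi_prod (nome z) 5)\<^sup>2"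
  note quot = level_10_quotients[folded qXY]
  define S where "S = (psi_prod q 5)\<^sup>2"
  have YS: "Y = q * S" by (simp add: qXY S_def)
  have q: "q \<noteq> 0" "norm q < 1" using nome_z[OF z] by (auto simp: qXY)
  have eo: "2 * level_10_even q * X * S = level_10_odd q * (X - Y) * (X - 5 * Y)"
    using level_10_even_odd[OF q(2)] by (simp add: qXY S_def)
  have L: "lambert_all 1 z = lambert_koebe q" "lambert_all 5 z = lambert_koebe (q ^ 5)"
    by (simp_all add: lambert_all_eq qXY)
  have ev: "8 * lambert_koebe (q ^ 2) - 2 * lambert_koebe q - 40 * lambert_koebe (q ^ 10) + 10 * lambert_koebe (q ^ 5) + 1 =
      2 * level_10_even q"
    unfolding level_10_even_eq[OF q, symmetric] by simp
  have A: "6 * (lambert_all 1 z - 5 * lambert_all 5 z) + 1 = 8 * (q * level_10_odd q) + 2 * level_10_even q"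
    unfolding L using ev level_10_odd_eq[OF q] by algebra
  \<comment> \<open>\<open>eo\<close> replaces the even part, and 8 X Y + (X - Y) (X - 5 Y) = X^2 +
    2 X Y + 5 Y^2.\<close>
  have "(6 * (lambert_all 1 z - 5 * lambert_all 5 z) + 1) * (X * Y) = (X\<^sup>2 + 2 * X * Y + 5 * Y\<^sup>2) * (q * level_10_odd q)"
    unfolding A using eo YS by algebra
  hence "6 * (lambert_all 1 z - 5 * lambert_all 5 z) + 1 = (X\<^sup>2 + 2 * X * Y + 5 * Y\<^sup>2) * (q * level_10_odd q) / (X * Y)"
    using quot(1,2) by (simp add: field_simps)
  also have "\<dots> = (X / Y + 2 + 5 * (Y / X)) * (q * level_10_odd q)"
    using quot(1,2) by (simp add: field_simps power2_eq_square)
  finally show ?thesis unfolding quot(3,4,7) .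
qed

text \<open>The power -3/2 is that of q divided by the square of q^(5/4). With t = X / Y the
  radicand is t ((t - 1)^2 + 4), the shape found in \<open>level_10_odd_square\<close>.\<close>

lemma level_10_root:
  "1 / Pi_q 5 z ^ 2 * (lambert_odd 1 z - 5 * lambert_odd 5 z) =
      qpow (-3/2) z * (level_10_odd (nome z) / psi_prod (nome z) 5 ^ 4)"
  "(qpow (-3/2) z * (level_10_odd (nome z) / psi_prod (nome z) 5 ^ 4))\<^sup>2 =
     Pi_q 1 z ^ 3 / Pi_q 5 z ^ 3 - 2 * (Pi_q 1 z ^ 2 / Pi_q 5 z ^ 2) + 5 * (Pi_q 1 z / Pi_q 5 z)"
proof -
  define q X Y w y l where qXY: "q = nome z" "X = (psi_prod (nome z) 1)\<^sup>2" "Y = nome z * (psi_prod (nome z) 5)\<^sup>2"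
    "w = qpow (1/4) z" "y = psi_prod (nome z) 5" "l = level_10_odd (nome z)"
  note quot = level_10_quotients[folded qXY]
  have w: "w \<noteq> 0" "w ^ 4 = q" "y \<noteq> 0" "q \<noteq> 0"
    using qpow_quarter_4[OF z] psi_prod_nonzero[OF nome_z[OF z]] nome_z[OF z] by (auto simp: qXY)
  have r: "qpow (-3/2) z = 1 / w ^ 6"
    using qpow_minus_three_halves[of z] w by (simp add: qXY field_simps)
  have Y: "Y = q * y\<^sup>2" by (simp add: qXY)
  have Pi5: "Pi_q 5 z = w ^ 5 * y\<^sup>2" by (simp add: Pi_q_eq[OF z] qXY)
  have L: "lambert_odd 1 z - 5 * lambert_odd 5 z = q * l"
    using quot(7) by (simp add: qXY)
  show "1 / Pi_q 5 z ^ 2 * (lambert_odd 1 z - 5 * lambert_odd 5 z) =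
      qpow (-3/2) z * (level_10_odd (nome z) / psi_prod (nome z) 5 ^ 4)"
    unfolding r L Pi5 qXY(5,6)[symmetric] w(2)[symmetric] using w(1,3)
    by (simp add: field_simps flip: power_add)
  have sq: "q * l\<^sup>2 = X * Y * ((X - Y)\<^sup>2 + 4 * Y\<^sup>2)"
    using level_10_odd_square[OF nome_z[OF z]] by (simp add: qXY)
  have w12: "(w ^ 6)\<^sup>2 = q ^ 3" unfolding w(2)[symmetric] by (simp flip: power_mult)
  have "(qpow (-3/2) z * (l / y ^ 4))\<^sup>2 = l\<^sup>2 / (q ^ 3 * (y ^ 4)\<^sup>2)"
    unfolding r power_mult_distrib power_divide w12 by simp
  also have "\<dots> = q * l\<^sup>2 / Y ^ 4"
    unfolding Y using w by (simp add: field_simps flip: power_mult) (simp add: eval_nat_numeral)?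
  also have "\<dots> = (X / Y) ^ 3 - 2 * (X / Y) ^ 2 + 5 * (X / Y)"
    unfolding sq using quot(1,2) by (simp add: field_simps eval_nat_numeral)
  finally show "(qpow (-3/2) z * (level_10_odd (nome z) / psi_prod (nome z) 5 ^ 4))\<^sup>2 =
     Pi_q 1 z ^ 3 / Pi_q 5 z ^ 3 - 2 * (Pi_q 1 z ^ 2 / Pi_q 5 z ^ 2) + 5 * (Pi_q 1 z / Pi_q 5 z)"
    unfolding quot(3,5,6) qXY(5,6) .
qed

text \<open>Level 18 is parametrised by t, r and \<open>Pi_q 9 z\<close> on the curve r^2 = (t -
  1)^3 + 1, so that its identities become algebra. The last clause exhibits r as a power of q times
  a function holomorphic in q, as needed for the square root branch.\<close>

lemma level_18_parameters:
  defines "t \<equiv> sqrt_Pi_q 1 z / sqrt_Pi_q 9 z" and "r \<equiv> Pi_q 3 z / Pi_q 9 z"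
  shows "t \<noteq> 0" "r \<noteq> 0" "Pi_q 9 z \<noteq> 0" "Pi_q 1 z = t\<^sup>2 * Pi_q 9 z" "Pi_q 3 z = r * Pi_q 9 z"
    "r\<^sup>2 = t ^ 3 - 3 * t\<^sup>2 + 3 * t"
    "r = qpow (-3/2) z * ((psi_prod (nome z) 3)\<^sup>2 / (psi_prod (nome z) 9)\<^sup>2)"
proof -
  define q w x a b where qw: "q = nome z" "w = qpow (1/4) z" "x = psi_prod q 1" "a = psi_prod q 3" "b = psi_prod q 9"
  have q: "q \<noteq> 0" "norm q < 1" using nome_z[OF z] by (auto simp: qw)
  have nz: "w \<noteq> 0" "x \<noteq> 0" "a \<noteq> 0" "b \<noteq> 0" using psi_prod_nonzero[OF q] by (auto simp: qw)
  have w4: "w ^ 4 = q" using qpow_quarter_4[OF z] by (simp add: qw)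
  have Pi: "Pi_q 1 z = w * x\<^sup>2" "Pi_q 3 z = w ^ 3 * a\<^sup>2" "Pi_q 9 z = w ^ 9 * b\<^sup>2"
    by (simp_all add: Pi_q_eq[OF z] qw)
  have "qpow (1/8) z ^ 9 = qpow (1/8) z * q"
    unfolding qw qpow_eighth[OF z, symmetric] by (simp add: eval_nat_numeral)
  hence t: "t = x / (q * b)"
    using q nz by (simp add: t_def sqrt_Pi_q_eq[OF z] qw[symmetric] field_simps) (simp add: qw)?
  have r: "r = a\<^sup>2 / (w ^ 6 * b\<^sup>2)"
    unfolding r_def Pi using nz by (simp add: field_simps eval_nat_numeral)
  show "t \<noteq> 0" "r \<noteq> 0" "Pi_q 9 z \<noteq> 0" using q nz by (auto simp: t r Pi)
  show "Pi_q 3 z = r * Pi_q 9 z" using Pi nz by (simp add: r_def)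
  show "Pi_q 1 z = t\<^sup>2 * Pi_q 9 z"
    unfolding t Pi w4[symmetric] using nz by (simp add: field_simps eval_nat_numeral)
  have "r\<^sup>2 = a ^ 4 / (q ^ 3 * b ^ 4)"
    unfolding r w4[symmetric] by (simp add: power_divide power_mult_distrib flip: power_mult)
  also have "\<dots> = q * a ^ 4 / (q * b) ^ 4"
    using q nz by (simp add: field_simps eval_nat_numeral)
  also have "q * a ^ 4 = x * (q * b) * (x\<^sup>2 - 3 * x * (q * b) + 3 * (q * b)\<^sup>2)"
    using level_18_cube[OF q] by (simp add: qw)
  also have "\<dots> / (q * b) ^ 4 = t ^ 3 - 3 * t\<^sup>2 + 3 * t"
    unfolding t using q nz by (simp add: field_simps eval_nat_numeral)
  finally show "r\<^sup>2 = t ^ 3 - 3 * t\<^sup>2 + 3 * t" .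
  have "qpow (-3/2) z = 1 / w ^ 6"
    using qpow_minus_three_halves[of z] nz by (simp add: qw field_simps)
  thus "r = qpow (-3/2) z * ((psi_prod (nome z) 3)\<^sup>2 / (psi_prod (nome z) 9)\<^sup>2)"
    unfolding r by (simp add: qw)
qed

text \<open>\<open>La6_2\<close> at z plus three times \<open>La6_2\<close> at 3 z; the terms
  \<open>lambert_odd 3 z\<close> cancel.\<close>

lemma level_18_odd: "lambert_odd 1 z - 9 * lambert_odd 9 z = Pi_q 3 z * (Pi_q 1 z + 3 * Pi_q 9 z)"
proof -
  have z3: "of_nat 3 * z \<in> upper_half" by (rule upper_half_mult[OF z]) simp
  have "lambert_odd 1 (of_nat 3 * z) = lambert_odd 3 z" "lambert_odd 3 (of_nat 3 * z) = lambert_odd 9 z"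
    using lambert_odd_eq_all[OF z3, of 1] lambert_odd_eq_all[OF z3, of 3]
      lambert_odd_eq_all[OF z, of 3] lambert_odd_eq_all[OF z, of 9]
    unfolding lambert_all_mult by simp_all
  hence "lambert_odd 3 z - 3 * lambert_odd 9 z = Pi_q 3 z * Pi_q 9 z"
    using La6_2[OF z3] unfolding Pi_q_mult by simp
  thus ?thesis using La6_2[OF z] by algebra
qed

text \<open>\<open>La6_1\<close> at z plus three times \<open>La6_1\<close> at 3 z gives the
  combination over all exponents; subtracting \<open>level_18_odd\<close> leaves the even
  ones.\<close>

lemma La18_1:
  "lambert_all 2 z - 9 * lambert_all 18 z = Pi_q 3 z ^ 3 / Pi_q 1 z + 1 / 3 * (Pi_q 3 z ^ 3 / Pi_q 9 z - 1)"
proof -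
  have z3: "of_nat 3 * z \<in> upper_half" by (rule upper_half_mult[OF z]) simp
  define t r p where trp: "t = sqrt_Pi_q 1 z / sqrt_Pi_q 9 z" "r = Pi_q 3 z / Pi_q 9 z" "p = Pi_q 9 z"
  note par = level_18_parameters[folded trp]
  define L where "L n = lambert_all n z" for n
  have odd: "lambert_odd 1 z = L 1 - L 2" "lambert_odd 3 z = L 3 - L 6" "lambert_odd 9 z = L 9 - L 18"
    using lambert_odd_eq_all[OF z, of 1] lambert_odd_eq_all[OF z, of 3] lambert_odd_eq_all[OF z, of 9]
    by (simp_all add: L_def)
  have 1: "L 1 - 3 * L 3 = (Pi_q 1 z ^ 2 + 3 * Pi_q 3 z ^ 2) ^ 2 / (12 * Pi_q 1 z * Pi_q 3 z) - 1 / 12"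
    unfolding L_def by (rule La6_1[OF z])
  have 2: "L 3 - 3 * L 9 = (Pi_q 3 z ^ 2 + 3 * Pi_q 9 z ^ 2) ^ 2 / (12 * Pi_q 3 z * Pi_q 9 z) - 1 / 12"
    using La6_1[OF z3] unfolding Pi_q_mult lambert_all_mult by (simp add: L_def)
  have 3: "L 1 - L 2 - 9 * (L 9 - L 18) = Pi_q 3 z * (Pi_q 1 z + 3 * Pi_q 9 z)"
    using level_18_odd unfolding odd .
  have "L 2 - 9 * L 18 = (L 1 - 3 * L 3) + 3 * (L 3 - 3 * L 9) - (L 1 - L 2 - 9 * (L 9 - L 18))"
    by (simp add: algebra_simps)
  also have "\<dots> = p\<^sup>2 * (((t ^ 4 + 3 * r\<^sup>2)\<^sup>2 + 3 * t\<^sup>2 * (r\<^sup>2 + 3)\<^sup>2 - 12 * t\<^sup>2 * r\<^sup>2 * (t\<^sup>2 + 3)) / (12 * t\<^sup>2 * r)) - 1 / 3"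
    unfolding 1 2 3 par(4,5) trp(3)[symmetric] using par(1,2,3)
    by (simp add: field_simps eval_nat_numeral)
  \<comment> \<open>Modulo the curve only terms with r^4 survive; against the r in the denominator
    they yield the cubes of \<open>Pi_q 3 z\<close>.\<close>
  also have "(t ^ 4 + 3 * r\<^sup>2)\<^sup>2 + 3 * t\<^sup>2 * (r\<^sup>2 + 3)\<^sup>2 - 12 * t\<^sup>2 * r\<^sup>2 * (t\<^sup>2 + 3) = 12 * (r\<^sup>2)\<^sup>2 + 4 * t\<^sup>2 * (r\<^sup>2)\<^sup>2"
    unfolding par(6) by algebra
  also have "p\<^sup>2 * ((12 * (r\<^sup>2)\<^sup>2 + 4 * t\<^sup>2 * (r\<^sup>2)\<^sup>2) / (12 * t\<^sup>2 * r)) - 1 / 3 =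
      Pi_q 3 z ^ 3 / Pi_q 1 z + 1 / 3 * (Pi_q 3 z ^ 3 / Pi_q 9 z - 1)"
    unfolding par(4,5) trp(3)[symmetric] using par(1,2,3)
    by (simp add: field_simps eval_nat_numeral)
  finally show ?thesis by (simp add: L_def)
qed

lemma La18_4:
  "3 * (lambert_all 1 z - 9 * lambert_all 9 z) + 1 =
        3 * Pi_q 1 z * Pi_q 3 z + 9 * Pi_q 3 z * Pi_q 9 z
        + 3 * (Pi_q 3 z ^ 3 / Pi_q 1 z) + Pi_q 3 z ^ 3 / Pi_q 9 z"
proof -
  have odd: "lambert_odd 1 z = lambert_all 1 z - lambert_all 2 z" "lambert_odd 9 z = lambert_all 9 z - lambert_all 18 z"
    using lambert_odd_eq_all[OF z, of 1] lambert_odd_eq_all[OF z, of 9] by simp_all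
  have "3 * (lambert_all 1 z - 9 * lambert_all 9 z) + 1 =
      3 * (lambert_all 2 z - 9 * lambert_all 18 z) + 3 * (lambert_odd 1 z - 9 * lambert_odd 9 z) + 1"
    unfolding odd by (simp add: algebra_simps)
  thus ?thesis unfolding level_18_odd La18_1 by (simp add: algebra_simps)
qed

lemma La18_3:
  "3 * (lambert_all 1 z - 9 * lambert_all 9 z) + 1 =
        (sqrt_Pi_q 1 z / sqrt_Pi_q 9 z + 3 * (sqrt_Pi_q 9 z / sqrt_Pi_q 1 z))
        * (lambert_odd 1 z - 9 * lambert_odd 9 z)"
proof -
  define t r p where trp: "t = sqrt_Pi_q 1 z / sqrt_Pi_q 9 z" "r = Pi_q 3 z / Pi_q 9 z" "p = Pi_q 9 z"
  note par = level_18_parameters[folded trp]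
  have inv: "sqrt_Pi_q 9 z / sqrt_Pi_q 1 z = 1 / t" by (simp add: trp)
  have "3 * Pi_q 1 z * Pi_q 3 z + 9 * Pi_q 3 z * Pi_q 9 z + 3 * (Pi_q 3 z ^ 3 / Pi_q 1 z) + Pi_q 3 z ^ 3 / Pi_q 9 z =
      r * p\<^sup>2 * (3 * t\<^sup>2 + 9 + r\<^sup>2 * (3 + t\<^sup>2) / t\<^sup>2)"
    unfolding par(4,5) trp(3)[symmetric] using par(1,2,3) by (simp add: field_simps eval_nat_numeral)
  \<comment> \<open>The curve relation in the form 3 + r^2 / t^2 = t + 3 / t.\<close>
  also have "\<dots> = (t + 3 * (1 / t)) * (r * p * (t\<^sup>2 * p + 3 * p))"
    unfolding par(6) using par(1) by (simp add: field_simps eval_nat_numeral)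
  finally show ?thesis
    unfolding La18_4 level_18_odd inv trp(1)[symmetric] par(4,5) trp(3)[symmetric] .
qed

text \<open>\<open>level_20\<close> is free of denominators and holds on the whole disc; dividing it
  by X Y produces the denominator of the statement as a factor on the left.\<close>

lemma La20_1:
  assumes "Pi_q 1 z / Pi_q 5 z - 4 - Pi_q 5 z / Pi_q 1 z \<noteq> 0"
  shows "1 / Pi_q 5 z ^ 2 * (lambert_odd 1 z - 5 * lambert_odd 5 z) =
        (Pi_q 5 z ^ 2 / Pi_q 10 z ^ 2 + 16 * (Pi_q 10 z ^ 2 / Pi_q 5 z ^ 2))
        / (Pi_q 1 z / Pi_q 5 z - 4 - Pi_q 5 z / Pi_q 1 z)"
proof -
  define q X Y w y c l where qXY: "q = nome z" "X = (psi_prod (nome z) 1)\<^sup>2" "Y = nome z * (psi_prod (nome z) 5)\<^sup>2"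
    "w = qpow (1/4) z" "y = psi_prod (nome z) 5" "c = psi_prod (nome z) 10" "l = level_10_odd (nome z)"
  note quot = level_10_quotients[folded qXY]
  have nz: "w \<noteq> 0" "w ^ 4 = q" "y \<noteq> 0" "c \<noteq> 0" "q \<noteq> 0"
    using qpow_quarter_4[OF z] psi_prod_nonzero[OF nome_z[OF z]] nome_z[OF z] by (auto simp: qXY)
  have Y: "Y = q * y\<^sup>2" by (simp add: qXY)
  have Pi: "Pi_q 5 z ^ 2 = q ^ 2 * w ^ 2 * y ^ 4" "Pi_q 10 z ^ 2 = q ^ 5 * c ^ 4"
    unfolding nz(2)[symmetric] by (simp_all add: Pi_q_eq[OF z] qXY power_mult_distrib flip: power_mult power_add)
  have L: "lambert_odd 1 z - 5 * lambert_odd 5 z = q * l"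
    using quot(7) by (simp add: qXY)
  have l: "l * (X\<^sup>2 - 4 * X * Y - Y\<^sup>2) = X * y\<^sup>2 * (y ^ 8 / c ^ 4 + 16 * q ^ 5 * c ^ 4)"
    using level_20[OF nome_z(2)[OF z]] by (simp add: qXY power_mult_distrib mult_ac flip: power_mult)
  have "q * l * ((X\<^sup>2 - 4 * X * Y - Y\<^sup>2) / (X * Y)) = q * (l * (X\<^sup>2 - 4 * X * Y - Y\<^sup>2)) / (X * Y)"
    by simp
  also have "\<dots> = y ^ 8 / c ^ 4 + 16 * q ^ 5 * c ^ 4"
    unfolding l unfolding Y using quot(1) nz by simp
  finally have "q * l * ((X\<^sup>2 - 4 * X * Y - Y\<^sup>2) / (X * Y)) = y ^ 8 / c ^ 4 + 16 * q ^ 5 * c ^ 4" .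
  moreover have "(X\<^sup>2 - 4 * X * Y - Y\<^sup>2) / (X * Y) = X / Y - 4 - Y / X"
    using quot(1,2) by (simp add: field_simps power2_eq_square)
  ultimately have "q * l * (X / Y - 4 - Y / X) = y ^ 8 / c ^ 4 + 16 * q ^ 5 * c ^ 4" by simp
  hence "1 / Pi_q 5 z ^ 2 * (q * l) * (X / Y - 4 - Y / X) = 1 / Pi_q 5 z ^ 2 * (y ^ 8 / c ^ 4 + 16 * q ^ 5 * c ^ 4)"
    by (simp only: mult.assoc)
  also have "\<dots> = Pi_q 5 z ^ 2 / Pi_q 10 z ^ 2 + 16 * (Pi_q 10 z ^ 2 / Pi_q 5 z ^ 2)"
  proof -
    \<comment> \<open>The leftover w^4 = q supplies the fifth power of q.\<close>
    have "q ^ 2 * w ^ 2 * y ^ 4 * (q ^ 2 * w ^ 2 * y ^ 4) = q ^ 5 * y ^ 8"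
      unfolding nz(2)[symmetric] by (simp add: mult_ac flip: power_mult power_add)
    hence "q ^ 2 * w ^ 2 * y ^ 4 / (q ^ 5 * c ^ 4) = y ^ 8 / c ^ 4 / (q ^ 2 * w ^ 2 * y ^ 4)"
      using nz by (simp add: field_simps)
    thus ?thesis unfolding Pi by (simp add: add_divide_distrib)
  qed
  finally show ?thesis
    using assms unfolding quot(3,4) L by (simp add: eq_divide_eq)
qed

end

text \<open>The root is explicit, q^(-3/2) times a function holomorphic on the disc with value 1 at
  0, and uniqueness of the branch extends the identity to every admissible s.\<close>

lemma La10_2:
  "equals_times_sqrt
     (\<lambda>z. 1 / Pi_q 5 z ^ 2 * (lambert_odd 1 z - 5 * lambert_odd 5 z))
     (\<lambda>z. 1)
     (\<lambda>z. Pi_q 1 z ^ 3 / Pi_q 5 z ^ 3 - 2 * (Pi_q 1 z ^ 2 / Pi_q 5 z ^ 2)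
           + 5 * (Pi_q 1 z / Pi_q 5 z))"
proof (rule equals_times_sqrtI)
  show "is_sqrt_branch (\<lambda>z. Pi_q 1 z ^ 3 / Pi_q 5 z ^ 3 - 2 * (Pi_q 1 z ^ 2 / Pi_q 5 z ^ 2) + 5 * (Pi_q 1 z / Pi_q 5 z))
      (\<lambda>z. qpow (-3/2) z * (level_10_odd (nome z) / psi_prod (nome z) 5 ^ 4))"
  proof (rule is_sqrt_branch_power_series[of "\<lambda>q. level_10_odd q / psi_prod q 5 ^ 4"])
    show "(\<lambda>q. level_10_odd q / psi_prod q 5 ^ 4) holomorphic_on ball 0 1"
      by (intro holomorphic_intros) (auto simp: nonzero_in_disc)
    show "level_10_odd 0 / psi_prod 0 5 ^ 4 = 1" by (simp add: level_10_odd_def)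
  qed (rule level_10_root(2))
  show "1 / Pi_q 5 z ^ 2 * (lambert_odd 1 z - 5 * lambert_odd 5 z) =
      1 * (qpow (-3/2) z * (level_10_odd (nome z) / psi_prod (nome z) 5 ^ 4))" if "z \<in> upper_half" for z
    using level_10_root(1)[OF that] by simp
qed

text \<open>By the curve relation the root is \<open>Pi_q 3 z / Pi_q 9 z\<close>; the identity is
  \<open>level_18_odd\<close> with this quotient factored out.\<close>

lemma La18_2:
  "equals_times_sqrt
     (\<lambda>z. lambert_odd 1 z - 9 * lambert_odd 9 z)
     (\<lambda>z. Pi_q 1 z * Pi_q 9 z + 3 * Pi_q 9 z ^ 2)
     (\<lambda>z. (sqrt_Pi_q 1 z / sqrt_Pi_q 9 z) ^ 3 - 3 * (Pi_q 1 z / Pi_q 9 z)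
           + 3 * (sqrt_Pi_q 1 z / sqrt_Pi_q 9 z))"
proof (rule equals_times_sqrtI)
  show "is_sqrt_branch (\<lambda>z. (sqrt_Pi_q 1 z / sqrt_Pi_q 9 z) ^ 3 - 3 * (Pi_q 1 z / Pi_q 9 z)
           + 3 * (sqrt_Pi_q 1 z / sqrt_Pi_q 9 z))
      (\<lambda>z. qpow (-3/2) z * ((psi_prod (nome z) 3)\<^sup>2 / (psi_prod (nome z) 9)\<^sup>2))"
  proof (rule is_sqrt_branch_power_series[of "\<lambda>q. (psi_prod q 3)\<^sup>2 / (psi_prod q 9)\<^sup>2"])
    fix z assume z: "z \<in> upper_half"
    show "(qpow (-3/2) z * ((psi_prod (nome z) 3)\<^sup>2 / (psi_prod (nome z) 9)\<^sup>2))\<^sup>2 =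
        (sqrt_Pi_q 1 z / sqrt_Pi_q 9 z) ^ 3 - 3 * (Pi_q 1 z / Pi_q 9 z) + 3 * (sqrt_Pi_q 1 z / sqrt_Pi_q 9 z)"
      using level_18_parameters(3,4)[OF z] level_18_parameters(6,7)[OF z] by simp
  qed (auto intro!: holomorphic_intros simp: nonzero_in_disc)
  fix z assume z: "z \<in> upper_half"
  have "Pi_q 3 z * (Pi_q 1 z + 3 * Pi_q 9 z) = (Pi_q 1 z * Pi_q 9 z + 3 * Pi_q 9 z ^ 2) * (Pi_q 3 z / Pi_q 9 z)"
    using level_18_parameters(3)[OF z] by (simp add: field_simps power2_eq_square)
  thus "lambert_odd 1 z - 9 * lambert_odd 9 z = (Pi_q 1 z * Pi_q 9 z + 3 * Pi_q 9 z ^ 2) *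
      (qpow (-3/2) z * ((psi_prod (nome z) 3)\<^sup>2 / (psi_prod (nome z) 9)\<^sup>2))"
    unfolding level_18_odd[OF z] level_18_parameters(7)[OF z, symmetric] .
qed

text \<open>Clearing denominators gives a holomorphic function \<open>N\<close> of the nome with
  value 1 at 0, so it does not vanish identically and its zeros are isolated.\<close>

lemma La20_1_denominator:
  "\<forall>\<^sub>\<approx>z\<in>upper_half. Pi_q 1 z / Pi_q 5 z - 4 - Pi_q 5 z / Pi_q 1 z \<noteq> 0"
proof -
  define N where "N q = ((psi_prod q 1)\<^sup>2)\<^sup>2 - 4 * (psi_prod q 1)\<^sup>2 * (q * (psi_prod q 5)\<^sup>2) - (q * (psi_prod q 5)\<^sup>2)\<^sup>2" for q
  have N: "N holomorphic_on ball 0 1"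
    unfolding N_def by (intro holomorphic_intros) auto
  have zero: "Pi_q 1 z / Pi_q 5 z - 4 - Pi_q 5 z / Pi_q 1 z \<noteq> 0 \<longleftrightarrow> N (nome z) \<noteq> 0" if z: "z \<in> upper_half" for z
    using level_10_quotients(1,2)[OF z] unfolding level_10_quotients(3,4)[OF z] N_def
    by (simp add: field_simps power2_eq_square)
  have "isCont N 0"
    using holomorphic_on_imp_continuous_on[OF N] by (auto simp: continuous_on_eq_continuous_at)
  moreover have "N 0 \<noteq> 0" by (simp add: N_def)
  ultimately obtain e where e: "e > 0" "\<And>q. dist 0 q < e \<Longrightarrow> N q \<noteq> 0"
    using continuous_at_avoid[of 0 N 0] by auto
  \<comment> \<open>The height makes the nome, of norm exp (-2 \<pi> y), smaller than e, where
    \<open>N\<close> is known to be nonzero.\<close>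
  define y where "y = max 1 (- ln e / (2 * pi) + 1)"
  have y: "y > 0" "- ln e / (2 * pi) < y" by (auto simp: y_def)
  define z0 where "z0 = \<i> * of_real y"
  have z0: "z0 \<in> upper_half" using y by (simp add: z0_def upper_half_def)
  have "norm (nome z0) = exp (- (2 * pi * y))" by (simp add: norm_qpow z0_def)
  also have "\<dots> < exp (ln e)" using y(2) by (simp add: field_simps)
  finally have "N (nome z0) \<noteq> 0" using e by simp
  moreover have "(\<lambda>z. N (nome z)) holomorphic_on upper_half" by (rule holomorphic_on_nome[OF N])
  ultimately have *: "\<forall>\<^sub>F w in at z. N (nome w) \<noteq> 0 \<and> w \<in> upper_half" if "z \<in> upper_half" for z
    using non_zero_neighbour_alt[OF _ open_upper_half connected_upper_half that z0] by blast
  have "\<forall>\<^sub>F w in at z. Pi_q 1 w / Pi_q 5 w - 4 - Pi_q 5 w / Pi_q 1 w \<noteq> 0" if "z \<in> upper_half" for z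
    using *[OF that] by eventually_elim (use zero in blast)
  thus ?thesis
    by (simp add: eventually_cosparse_open_eq[OF open_upper_half])
qed

theorem theorem1p3:
  shows
  \<comment> \<open>La2-1\<close>
  "(\<forall>z\<in>upper_half.
      Pi_q 1 z ^ 4 =
        6 * (\<Sum>\<^sub>\<infinity>n\<in>{1..}. nome z ^ (4 * n - 2) / (1 - nome z ^ (2 * n - 1)) ^ 4)
        + (\<Sum>\<^sub>\<infinity>n\<in>{1..}. nome z ^ (2 * n - 1) / (1 - nome z ^ (2 * n - 1)) ^ 2)
    \<and> Pi_q 1 z ^ 4 = (\<Sum>\<^sub>\<infinity>n\<in>{1..}. of_nat n ^ 3 * nome z ^ n / (1 - nome z ^ (2 * n))))
  \<and> \<comment> \<open>La4-1\<close>
   (\<forall>z\<in>upper_half.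
      lambert_all 1 z - 2 * lambert_all 2 z =
        1 / 24 * (Pi_q 1 z ^ 4 / Pi_q 2 z ^ 2 - 1) + 2 / 3 * Pi_q 2 z ^ 2)
  \<and> \<comment> \<open>La4-2\<close>
   (\<forall>z\<in>upper_half.
      lambert_all 1 z - 4 * lambert_all 4 z = 1 / 8 * (Pi_q 1 z ^ 4 / Pi_q 2 z ^ 2 - 1))
  \<and> \<comment> \<open>La4-3\<close>
   (\<forall>z\<in>upper_half.
      lambert_odd 1 z - 2 * lambert_odd 2 z = Pi_q 2 z ^ 2
    \<and> Pi_q 2 z ^ 2 =
        (\<Sum>\<^sub>\<infinity>n\<in>{1..}. of_nat (2 * n - 1) * nome z ^ (2 * n - 1) / (1 - nome z ^ (4 * n - 2))))
  \<and> \<comment> \<open>La6-1\<close>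
   (\<forall>z\<in>upper_half.
      lambert_all 1 z - 3 * lambert_all 3 z =
        (Pi_q 1 z ^ 2 + 3 * Pi_q 3 z ^ 2) ^ 2 / (12 * Pi_q 1 z * Pi_q 3 z) - 1 / 12)
  \<and> \<comment> \<open>La6-2\<close>
   (\<forall>z\<in>upper_half.
      lambert_odd 1 z - 3 * lambert_odd 3 z = Pi_q 1 z * Pi_q 3 z)
  \<and> \<comment> \<open>La8-1\<close>
   (\<forall>z\<in>upper_half.
      lambert_odd 1 z - 4 * lambert_odd 4 z =
        1 / 8 * (Pi_q 1 z ^ 4 / Pi_q 2 z ^ 2 - Pi_q 2 z ^ 4 / Pi_q 4 z ^ 2)
    \<and> 1 / 8 * (Pi_q 1 z ^ 4 / Pi_q 2 z ^ 2 - Pi_q 2 z ^ 4 / Pi_q 4 z ^ 2) =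
        Pi_q 2 z ^ 2 + 2 * Pi_q 4 z ^ 2)
  \<and> \<comment> \<open>La10-1\<close>
   (\<forall>z\<in>upper_half.
      6 * (lambert_all 1 z - 5 * lambert_all 5 z) + 1 =
        (Pi_q 1 z / Pi_q 5 z + 2 + 5 * (Pi_q 5 z / Pi_q 1 z))
        * (lambert_odd 1 z - 5 * lambert_odd 5 z))
  \<and> \<comment> \<open>La10-2\<close>
   equals_times_sqrt
     (\<lambda>z. 1 / Pi_q 5 z ^ 2 * (lambert_odd 1 z - 5 * lambert_odd 5 z))
     (\<lambda>z. 1)
     (\<lambda>z. Pi_q 1 z ^ 3 / Pi_q 5 z ^ 3 - 2 * (Pi_q 1 z ^ 2 / Pi_q 5 z ^ 2)
           + 5 * (Pi_q 1 z / Pi_q 5 z))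
  \<and> \<comment> \<open>La12-1\<close>
   (\<forall>z\<in>upper_half.
      lambert_odd 1 z - 6 * lambert_odd 6 z = Pi_q 2 z ^ 2 + 2 * Pi_q 2 z * Pi_q 6 z
    \<and> Pi_q 2 z ^ 2 + 2 * Pi_q 2 z * Pi_q 6 z = Pi_q 1 z * Pi_q 3 z + 3 * Pi_q 6 z ^ 2)
  \<and> \<comment> \<open>La18-1\<close>
   (\<forall>z\<in>upper_half.
      lambert_all 2 z - 9 * lambert_all 18 z =
        Pi_q 3 z ^ 3 / Pi_q 1 z + 1 / 3 * (Pi_q 3 z ^ 3 / Pi_q 9 z - 1))
  \<and> \<comment> \<open>La18-2; the powers \<open>3/2\<close> and \<open>1/2\<close> are those of the fixed root of \<open>\<Pi>\<close>\<close>
   equals_times_sqrt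
     (\<lambda>z. lambert_odd 1 z - 9 * lambert_odd 9 z)
     (\<lambda>z. Pi_q 1 z * Pi_q 9 z + 3 * Pi_q 9 z ^ 2)
     (\<lambda>z. (sqrt_Pi_q 1 z / sqrt_Pi_q 9 z) ^ 3 - 3 * (Pi_q 1 z / Pi_q 9 z)
           + 3 * (sqrt_Pi_q 1 z / sqrt_Pi_q 9 z))
  \<and> \<comment> \<open>La18-3\<close>
   (\<forall>z\<in>upper_half.
      3 * (lambert_all 1 z - 9 * lambert_all 9 z) + 1 =
        (sqrt_Pi_q 1 z / sqrt_Pi_q 9 z + 3 * (sqrt_Pi_q 9 z / sqrt_Pi_q 1 z))
        * (lambert_odd 1 z - 9 * lambert_odd 9 z))
  \<and> \<comment> \<open>La18-4\<close>
   (\<forall>z\<in>upper_half.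
      3 * (lambert_all 1 z - 9 * lambert_all 9 z) + 1 =
        3 * Pi_q 1 z * Pi_q 3 z + 9 * Pi_q 3 z * Pi_q 9 z
        + 3 * (Pi_q 3 z ^ 3 / Pi_q 1 z) + Pi_q 3 z ^ 3 / Pi_q 9 z)
  \<and> \<comment> \<open>La20-1: the denominator has zeros in the upper half plane, but only isolated ones\<close>
   (\<forall>\<^sub>\<approx>z\<in>upper_half. Pi_q 1 z / Pi_q 5 z - 4 - Pi_q 5 z / Pi_q 1 z \<noteq> 0)
  \<and> (\<forall>z\<in>upper_half. Pi_q 1 z / Pi_q 5 z - 4 - Pi_q 5 z / Pi_q 1 z \<noteq> 0 \<longrightarrow>
      1 / Pi_q 5 z ^ 2 * (lambert_odd 1 z - 5 * lambert_odd 5 z) =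
        (Pi_q 5 z ^ 2 / Pi_q 10 z ^ 2 + 16 * (Pi_q 10 z ^ 2 / Pi_q 5 z ^ 2))
        / (Pi_q 1 z / Pi_q 5 z - 4 - Pi_q 5 z / Pi_q 1 z))"
  by (intro conjI ballI impI La2_1 La4_1 La4_2 La4_3a La4_3b La6_1 La6_2 La8_1 La10_1 La10_2 La12_1
      La18_1 La18_2 La18_3 La18_4 La20_1 La20_1_denominator)

end
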